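(* Assume that $(\alpha,\beta)\in\Omega=\{(\alpha,\beta)\in\mathbb{C}^2:\Re(\alpha+\beta)>-1,\ \Re(\alpha-\beta)\ge 0\}$. Then, for $\theta\in[-\pi,\pi)$ and $n,k\in\mathbb{N}$, $$ \begin{aligned} P_n\left(e^{\frac{i\theta}{n}};\alpha,\beta\right)={}&{}_1F_1(\alpha+\beta+1;2\alpha+1;i\theta)\\ &+\sum_{j=1}^{k}\ \sum_{i_1+i_2+i_3=j}\frac{B_{i_1}^{(-\alpha-\beta)}(\alpha-\beta)}{i_1!}\,\frac{B_{i_2}^{(-\alpha+\beta+1)}(0)}{i_2!}\,\frac{B_{i_3}^{(2\alpha)}(0)}{i_3!}\\ &\quad\times\frac{(\alpha+\beta+1)_{i_1}(\alpha-\beta)_{i_2}}{(2\alpha+1)_{i_1+i_2}}\,{}_1F_1(1+\alpha+\beta+i_1;1+2\alpha+i_1+i_2;i\theta)\left(\frac{i\theta}{n}\right)^{j}+R_{k,n}(\theta), \end{aligned} $$ where the inner sum runs over all $i_1,i_2,i_3\in\mathbb{N}\cup\{0\}$ with $i_1+i_2+i_3=j$ (and $i$ without subscript is the imaginary unit), and $$ |R_{k,n}(\theta)|\le\frac{\Gamma(\Re(\alpha+\beta+1))\,\Gamma(\Re(\alpha-\beta))}{|\Gamma(\alpha+\beta+1)\,\Gamma(\alpha-\beta)|}\left|\frac{1}{1-\frac{2\theta}{3\pi n}}\right|\left|\frac{2\theta}{3\pi n}\right|^{k+1}C(\alpha,\beta), $$ where $$ C(\alpha,\beta)=\max_{|z|=\frac{3\pi}{2}}\left|e^{z(\alpha-\beta)}\left(\frac{z}{e^{z}-1}\right)^{-\alpha-\beta}\right|\cdot\max_{|z|=\frac{3\pi}{2}}\left|\left(\frac{z}{e^{z}-1}\right)^{-\alpha+\beta+1}\right|\cdot\max_{|z|=\frac{3\pi}{2}}\left|\left(\frac{z}{e^{z}-1}\right)^{2\alpha}\right|.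 $$
   Context: $\mathbb{N}=\{1,2,3,\dots\}$. $\Gamma$ is the Euler Gamma function, $(a)_m=a(a+1)\cdots(a+m-1)$, $(a)_0=1$, is the Pochhammer symbol, and ${}_1F_1$, ${}_2F_1$ are the usual (confluent and Gauss) hypergeometric functions. For $n\in\mathbb{N}$, $P_n(z;\alpha,\beta)={}_2F_1(-n,\alpha+\beta+1;2\alpha+1;1-z)$, a polynomial in $z$. Complex powers $w^{\gamma}$ ($w,\gamma\in\mathbb{C}$, $w\neq0$) are taken with the branch $-\pi<\arg w\le\pi$. The generalized Bernoulli polynomials $B_m^{(a)}(x)$ ($a,x\in\mathbb{C}$, $m\ge0$) are defined by the generating function $$\left(\frac{z}{e^z-1}\right)^{a}e^{xz}=\sum_{m=0}^{\infty}B_m^{(a)}(x)\frac{z^m}{m!},\qquad |z|<2\pi.$$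
   Formalization: When Re(α−β)=0 the stated bound contains Γ(0), which is undefined; there the quotient Γ(Re(α−β))/|Γ(α−β)| is read as +∞ if α≠β (so the bound on the remainder is void for θ≠0) and as 1 if α=β. *)

theory Defs
  imports "HOL-Complex_Analysis.Complex_Analysis"
begin

definition hyp1f1 :: "complex \<Rightarrow> complex \<Rightarrow> complex \<Rightarrow> complex" where
  "hyp1f1 a c z = eval_fps (fps_hypergeo [a] [c] 1) z"

text \<open>
  The Gauss series, meaningful here for \<open>norm z < 1\<close> or when it terminates, i.e. when \<open>a\<close> or \<open>b\<close>
  is a nonpositive integer.
\<close>

definition hyp2f1 :: "complex \<Rightarrow> complex \<Rightarrow> complex \<Rightarrow> complex \<Rightarrow> complex" where
  "hyp2f1 a b c z = eval_fps (fps_hypergeo [a, b] [c] 1) z"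

lemma hyp1f1_series:
  "hyp1f1 a c z = (\<Sum>m. pochhammer a m / pochhammer c m * z ^ m / fact m)"
  by (simp add: hyp1f1_def eval_fps_def fps_hypergeo_def field_simps)

lemma hyp2f1_series:
  "hyp2f1 a b c z =
     (\<Sum>m. pochhammer a m * pochhammer b m / pochhammer c m * z ^ m / fact m)"
  by (simp add: hyp2f1_def eval_fps_def fps_hypergeo_def field_simps)

definition P_poly :: "nat \<Rightarrow> complex \<Rightarrow> complex \<Rightarrow> complex \<Rightarrow> complex" where
  "P_poly n \<alpha> \<beta> z = hyp2f1 (- of_nat n) (\<alpha> + \<beta> + 1) (2 * \<alpha> + 1) (1 - z)"

definition Omega :: "(complex \<times> complex) set" where
  "Omega = {(\<alpha>, \<beta>). Re (\<alpha> + \<beta>) > -1 \<and> Re (\<alpha> - \<beta>) \<ge> 0}"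

definition bernoulli_gf :: "complex \<Rightarrow> complex \<Rightarrow> complex \<Rightarrow> complex" where
  "bernoulli_gf a x z = (if z = 0 then 1 else (z / (exp z - 1)) powr a * exp (x * z))"

text \<open>
  \<open>gen_bernoulli m a x\<close> is the generalized Bernoulli polynomial \<open>B\<^sub>m\<close> with parameter \<open>a\<close> at \<open>x\<close>,
  i.e. \<open>fact m\<close> times the \<open>m\<close>-th Taylor coefficient at 0 of the generating function. The
  principal power of \<open>z / (exp z - 1)\<close> is analytic near 0, which determines the coefficients, but
  has jumps further out in the disc of radius \<open>2 * pi\<close>; on that whole disc the power has to be the
  analytic continuation from 0. This is what \<open>gen_bernoulli_sums\<close> below says.
\<close>

definition gen_bernoulli :: "nat \<Rightarrow> complex \<Rightarrow> complex \<Rightarrow> complex" where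
  "gen_bernoulli m a x = (deriv ^^ m) (bernoulli_gf a x) 0"

lemma exp_neq_1_disc:
  assumes "norm (z::complex) < 2 * pi" "z \<noteq> 0"
  shows "exp z \<noteq> 1"
proof
  assume "exp z = 1"
  then obtain k :: int where k: "Re z = 0" "Im z = of_int (2 * k) * pi"
    by (auto simp: exp_eq_1)
  with assms(2) have "k \<noteq> 0" by (auto simp: complex_eq_iff)
  hence "1 \<le> \<bar>real_of_int k\<bar>" by linarith
  hence "2 * pi \<le> \<bar>real_of_int k\<bar> * (2 * pi)" by simp
  also have "\<dots> = \<bar>Im z\<bar>" using k by (simp add: abs_mult)
  also have "\<dots> \<le> norm z" by (rule abs_Im_le_cmod)
  finally show False using assms(1) by simp
qed

lemma log_branch_exists:
  obtains H where "H holomorphic_on ball 0 (2 * pi)" "H 0 = 0"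
    "\<And>z. z \<in> ball 0 (2 * pi) \<Longrightarrow> z \<noteq> 0 \<Longrightarrow> exp (H z) = z / (exp z - 1)"
proof -
  define q where "q = (\<lambda>z::complex. if z = 0 then 1 else (exp z - 1) / z)"
  have lim: "((\<lambda>z::complex. (exp z - 1) / z) \<longlongrightarrow> 1) (at 0)"
    using DERIV_exp[of "0::complex"] by (simp add: has_field_derivative_iff)
  have qh: "q holomorphic_on ball 0 (2 * pi)"
  proof (rule no_isolated_singularity'[where K = "{0}"])
    fix z :: complex assume "z \<in> {0}"
    hence z: "z = 0" by simp
    have "(q \<longlongrightarrow> 1) (at 0)"
      by (rule Lim_transform_eventually[OF lim])
         (auto simp: q_def eventually_at intro!: exI[of _ 1])
    thus "(q \<longlongrightarrow> q z) (at z within ball 0 (2 * pi))"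
      unfolding z by (auto simp: q_def intro: tendsto_within_subset)
  next
    have "(\<lambda>z. (exp z - 1) / z) holomorphic_on ball 0 (2 * pi) - {0}"
      by (auto intro!: holomorphic_intros)
    thus "q holomorphic_on ball 0 (2 * pi) - {0}"
      by (rule holomorphic_transform) (auto simp: q_def)
  qed auto
  have qnz: "q z \<noteq> 0" if "z \<in> ball 0 (2 * pi)" for z
    using exp_neq_1_disc[of z] that by (auto simp: q_def)
  obtain h where h: "h holomorphic_on ball 0 (2 * pi)"
    "\<And>z. z \<in> ball 0 (2 * pi) \<Longrightarrow> q z = exp (h z)"
    using contractible_imp_holomorphic_log[OF qh convex_imp_contractible[OF convex_ball] qnz]
    by blast
  show thesis
  proof (rule that[of "\<lambda>z. h 0 - h z"])
    show "(\<lambda>z. h 0 - h z) holomorphic_on ball 0 (2 * pi)"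
      by (intro holomorphic_intros h)
    fix z :: complex assume z: "z \<in> ball 0 (2 * pi)" "z \<noteq> 0"
    have "exp (h 0) = 1" using h(2)[of 0] by (simp add: q_def)
    thus "exp (h 0 - h z) = z / (exp z - 1)"
      using z(2) by (simp add: exp_diff q_def h(2)[OF z(1), symmetric])
  qed simp
qed

lemma gen_bernoulli_sums:
  assumes H: "H holomorphic_on ball 0 (2 * pi)" "H 0 = 0"
    "\<And>z. z \<in> ball 0 (2 * pi) \<Longrightarrow> z \<noteq> 0 \<Longrightarrow> exp (H z) = z / (exp z - 1)"
    and z: "norm z < 2 * pi"
  shows "(\<lambda>m. gen_bernoulli m a x * z ^ m / fact m) sums (exp (a * H z) * exp (x * z))"
proof -
  define F where "F = (\<lambda>z. exp (a * H z) * exp (x * z))"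
  have "isCont H 0"
    using continuous_on_interior[OF holomorphic_on_imp_continuous_on[OF H(1)], of 0] by simp
  hence "(H \<longlongrightarrow> 0) (nhds 0)"
    using H(2) tendsto_at_iff_tendsto_nhds[of H 0] by (simp add: isCont_def)
  hence "\<forall>\<^sub>F z in nhds 0. norm (H z) < pi"
    using tendstoD[of H 0 "nhds 0" pi] by simp
  moreover have "\<forall>\<^sub>F z in nhds 0. z \<in> ball (0::complex) (2 * pi)"
    by (intro eventually_nhds_in_open) auto
  ultimately have "\<forall>\<^sub>F z in nhds 0. bernoulli_gf a x z = F z"
  proof eventually_elim
    case (elim z)
    show ?case
    proof (cases "z = 0")
      case False
      have "\<bar>Im (H z)\<bar> < pi" using elim(1) abs_Im_le_cmod[of "H z"] by linarith
      hence "Ln (exp (H z)) = H z" by (intro Ln_exp) auto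
      thus ?thesis
        using False by (simp add: bernoulli_gf_def F_def powr_def H(3)[OF elim(2) False, symmetric])
    qed (use H(2) in \<open>simp_all add: bernoulli_gf_def F_def\<close>)
  qed
  hence "gen_bernoulli m a x = (deriv ^^ m) F 0" for m
    unfolding gen_bernoulli_def by (intro higher_deriv_cong_ev) auto
  moreover have "(\<lambda>m. (deriv ^^ m) F 0 / fact m * (z - 0) ^ m) sums F z"
    by (rule holomorphic_power_series[of _ _ "2 * pi"])
       (use z in \<open>auto simp: F_def intro!: holomorphic_intros H\<close>)
  ultimately show ?thesis by (simp add: F_def)
qed

text \<open>
  The quotient \<open>\<Gamma>(Re w) / |\<Gamma>(w)|\<close> for \<open>Re w \<ge> 0\<close>. If \<open>Re w = 0\<close> and \<open>w \<noteq> 0\<close>, the numerator is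
  \<open>\<Gamma>(0) = \<infinity>\<close> and the denominator is finite and nonzero (whereas \<open>Gamma 0 = 0\<close> as a real number in
  the library). At \<open>w = 0\<close> the quotient has the form \<open>|\<Gamma>(0)| / |\<Gamma>(0)|\<close> and is read as 1, the value
  it takes at all real \<open>w > 0\<close>.
\<close>

definition Gamma_quot :: "complex \<Rightarrow> ereal" where
  "Gamma_quot w =
     (if w = 0 then 1 else if Re w = 0 then \<infinity> else ereal (Gamma (Re w) / norm (Gamma w)))"

text \<open>
  The suprema are maxima: on the circle \<open>|z| = 3\<pi>/2\<close> the function \<open>z / (exp z - 1)\<close> does not meet
  the branch cut, so the functions are continuous there.
\<close>

definition C_const :: "complex \<Rightarrow> complex \<Rightarrow> real" where
  "C_const \<alpha> \<beta> =
     (SUP z\<in>sphere 0 (3 * pi / 2). norm (exp (z * (\<alpha> - \<beta>)) * (z / (exp z - 1)) powr (- \<alpha> - \<beta>))) *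
     (SUP z\<in>sphere 0 (3 * pi / 2). norm ((z / (exp z - 1)) powr (- \<alpha> + \<beta> + 1))) *
     (SUP z\<in>sphere 0 (3 * pi / 2). norm ((z / (exp z - 1)) powr (2 * \<alpha>)))"

end

theory Submission
  imports Defs
begin

text \<open>
  Put \<open>a = \<alpha> + \<beta> + 1\<close>, \<open>b = \<alpha> - \<beta>\<close>, \<open>w = \<i> * \<theta> / n\<close> and let \<open>H\<close> be the holomorphic logarithm of \<open>z / (exp z - 1)\<close>
  with \<open>H 0 = 0\<close>. Substituting \<open>t = (exp (w * s) - 1) / (exp w - 1)\<close> in Euler's Beta integral writes \<open>P\<^sub>n (exp w)\<close> as
  the mean of \<open>exp (\<i> * \<theta> * s) * f (w, s)\<close> under the (complex) Beta distribution of \<open>s\<close> with parameters \<open>a\<close>, \<open>b\<close>, where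
  \<open>f (w, s) = exp (b * w * s + (1 - a) * H (w * s) + (1 - b) * H (w * (1 - s)) + (a + b - 1) * H w)\<close>. The Taylor
  expansion of \<open>f\<close> in \<open>w\<close> gives the stated sum, the moments giving the confluent functions.

  For \<open>\<theta> < 0\<close> the claimed bound has the factor \<open>1 / (1 + q)\<close> with \<open>q = 2 * \<bar>\<theta>\<bar> / (3 * pi * n) \<le> 2 / 3\<close> instead of the
  \<open>1 / (1 - q)\<close> that a geometric series yields. The gain has three sources. The mean of \<open>f (w, s)\<close> is 1 for every \<open>w\<close>
  (the case \<open>n = 0\<close>), so the Taylor remainder has mean 0 and \<open>exp (\<i> * \<theta> * s)\<close> may be replaced by
  \<open>exp (\<i> * \<theta> * s) - \<kappa>\<close>. The Taylor remainder is estimated by the mean of \<open>1 / \<bar>1 - z\<bar>\<close> over \<open>\<bar>z\<bar> = q\<close>, at most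
  \<open>1.15265\<close>. On \<open>\<bar>z\<bar> = 3 * pi / 2\<close> the inequality of Borel and Caratheodory bounds \<open>f (z, s)\<close> by the product of the three
  maxima times \<open>exp (- m1 * (1 - s) / (1 + s) - m2 * s / (2 - s))\<close>, where \<open>m1\<close> and \<open>m2\<close> are the logarithms of the
  first two maxima. With a suitable \<open>\<kappa>\<close> the mean of \<open>\<bar>exp (\<i> * \<theta> * s) - \<kappa>\<bar>\<close> times this exponential is at most
  \<open>0.5205\<close>, and \<open>1.15265 * 0.5205 < 3 / 5\<close>.
\<close>

section \<open>A majorant of the integral kernel\<close>

text \<open>For imaginary \<open>w\<close> the curve \<open>t\<close> leaves the real line, so it is
  not substituted into Euler's integral directly. Differentiating
  \<open>t powr a * (1 - t) powr b\<close> along the curve yields a recurrence for all moments of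
  \<open>t\<close>; the total mass is found for real \<open>w\<close>, where the substitution is a
  real one, and continued analytically in \<open>w\<close>. Expanding
  \<open>exp (n * w * s) = (1 + (exp w - 1) * t) ^ n\<close> then produces the terminating Gauss
  sum. The target \<open>3 / 5\<close> is the smallest value of \<open>1 / (1 + q)\<close>, attained
  for \<open>n = 1\<close>, \<theta> = -\<pi>. The damping exponential is indispensable: for small
  parameters the Beta mass may sit half at \<open>s = 0\<close> and half at \<open>s = 1\<close>,
  where exp(\<i>\<theta>s) is 1 and -1 if \<theta> = -\<pi>, and no \<kappa> has mean distance below
  1 from these two values. Hence \<open>m1\<close> and \<open>m2\<close> must be bounded below in
  terms of x = Re a and y = Re b, which is done by evaluating the exponents at the four points of
  the circle on the axes.\<close>

lemma exp_moebius_le: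
  fixes m a k u :: real
  defines "N \<equiv> \<lambda>u. 4 * m * (1 - a * u - k * u\<^sup>2) - (a + 2 * k * u) * (2 - u)\<^sup>2"
  assumes cross: "\<And>u v. 0 \<le> u \<Longrightarrow> u \<le> v \<Longrightarrow> v \<le> 1 \<Longrightarrow> N v \<ge> 0 \<Longrightarrow> N u \<ge> 0"
    and pos: "\<And>u. 0 \<le> u \<Longrightarrow> u \<le> 1 \<Longrightarrow> 1 - a * u - k * u\<^sup>2 > 0"
    and one: "exp (- 2 * m) \<le> 1 - a - k"
    and u: "0 \<le> u" "u \<le> 1"
  shows "exp (- 2 * m * (u / (2 - u))) \<le> 1 - a * u - k * u\<^sup>2"
proof -
  \<comment> \<open>\<open>D\<close> is the logarithm of the right side divided by the left side. It
    vanishes at 0, and \<open>one\<close> makes it nonnegative at 1. \<open>N\<close> has the sign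
    of \<open>D'\<close>, and by \<open>cross\<close> this sign can change only from plus to minus,
    so \<open>D\<close> rises and then falls and never drops below the smaller end value.\<close>
  define D where "D = (\<lambda>u. ln (1 - a * u - k * u\<^sup>2) + 2 * m * (u / (2 - u)))"
  define D' where "D' = (\<lambda>u. N u / ((1 - a * u - k * u\<^sup>2) * (2 - u)\<^sup>2))"
  have der: "(D has_real_derivative D' t) (at t)" if "0 \<le> t" "t \<le> 1" for t
  proof -
    have "(D has_real_derivative (- a - k * (2 * t)) / (1 - a * t - k * t\<^sup>2) + 2 * m * (2 / (2 - t)\<^sup>2)) (at t)"
      unfolding D_def using pos[OF that] that
      by (auto intro!: derivative_eq_intros simp: power2_eq_square algebra_simps)
    also have "(- a - k * (2 * t)) / (1 - a * t - k * t\<^sup>2) + 2 * m * (2 / (2 - t)\<^sup>2) = D' t"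
      unfolding D'_def N_def using pos[OF that] that
      by (subst times_divide_eq_right, subst add_frac_eq) (auto simp: algebra_simps)
    finally show ?thesis .
  qed
  have sgn: "D' t \<ge> 0 \<longleftrightarrow> N t \<ge> 0" if "0 \<le> t" "t \<le> 1" for t
    using pos[OF that] that by (simp add: D'_def zero_le_divide_iff mult_le_0_iff)
  have "D u \<ge> 0"
  proof (cases "N u \<ge> 0")
    case True
    have "D 0 \<le> D u"
      by (rule DERIV_nonneg_imp_nondecreasing[OF u(1)])
         (use der sgn cross[OF _ _ u(2) True] u in \<open>meson order_trans\<close>)
    thus ?thesis by (simp add: D_def)
  next
    case False
    have "D 1 \<le> D u"
    proof (rule DERIV_nonpos_imp_nonincreasing[OF u(2)])
      fix t assume t: "u \<le> t" "t \<le> 1"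
      have "\<not> N t \<ge> 0" using cross[OF u(1) t] False by blast
      hence "D' t \<le> 0" using sgn[of t] t u by simp
      thus "\<exists>y. (D has_real_derivative y) (at t) \<and> y \<le> 0" using der[of t] t u by auto
    qed
    moreover have "ln (exp (- 2 * m)) \<le> ln (1 - a - k)"
      using one less_le_trans[OF exp_gt_zero one] by (subst ln_le_cancel_iff) auto
    ultimately show ?thesis by (simp add: D_def)
  qed
  hence "- 2 * m * (u / (2 - u)) \<le> ln (1 - a * u - k * u\<^sup>2)" by (simp add: D_def)
  hence "exp (- 2 * m * (u / (2 - u))) \<le> exp (ln (1 - a * u - k * u\<^sup>2))" by simp
  thus ?thesis using pos[OF u] by simp
qed

section \<open>Certified quadratic bounds for the squared damping factors\<close>

lemma exp_Taylor_le:
  assumes t: "0 \<le> (t::real)"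
  shows "(\<Sum>j\<le>n. t ^ j / fact j) \<le> exp t"
proof -
  have s: "(\<lambda>j. t ^ j / fact j) sums exp t"
    using exp_converges[of t] by (simp add: field_simps)
  have "sum (\<lambda>j. t ^ j / fact j) {..n} \<le> suminf (\<lambda>j. t ^ j / fact j)"
    by (rule sum_le_suminf) (use s t in \<open>auto simp: sums_iff\<close>)
  thus ?thesis using s by (simp add: sums_iff)
qed

text \<open>The Taylor polynomial of degree 10 in Horner form. Rational arithmetic evaluates it
  exactly, which certifies the numerical estimates of exponentials below.\<close>

definition exp_lower :: "real \<Rightarrow> real" where
  "exp_lower t = 1 + t * (1 + t / 2 * (1 + t / 3 * (1 + t / 4 * (1 + t / 5 * (1 + t / 6 * (1 + t / 7 * (1 + t / 8 * (1 + t / 9 * (1 + t / 10)))))))))"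

lemma exp_lower_le: "0 \<le> t \<Longrightarrow> exp_lower t \<le> exp t"
proof -
  assume "0 \<le> t"
  hence "(\<Sum>j\<le>10. t ^ j / fact j) \<le> exp t" by (rule exp_Taylor_le)
  moreover have "(\<Sum>j\<le>10. t ^ j / fact j) = exp_lower t"
  proof -
    have "{..10::nat} = {0, 1, 2, 3, 4, 5, 6, 7, 8, 9, 10}" by (simp add: set_eq_iff) presburger
    thus ?thesis by (simp add: exp_lower_def fact_numeral field_simps eval_nat_numeral)
  qed
  ultimately show ?thesis by simp
qed

text \<open>Three families of coefficients for which
  \<open>exp (- 2 * m * (u / (2 - u))) \<le> (1 - u) + al * u + k * u * (1 - u)\<close> on the unit interval: a chord, a parabola that
  is tangent at 0, and a special choice for \<open>m = 2\<close>.\<close>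

definition exp_coeffs :: "real \<Rightarrow> real \<Rightarrow> real \<Rightarrow> bool" where
  "exp_coeffs m al k \<longleftrightarrow> 0 \<le> m \<and> 0 < al \<and>
     1 \<le> al * exp_lower (2 * m) \<and> al \<le> 1 \<and>
     (k = 0 \<and> 1 - m \<le> al \<or> al = 1 - m - k \<and> 0 \<le> k \<and> 2 * k \<le> m * (1 - m) \<or>
      m = 2 \<and> al = 93 / 5000 \<and> k = - 1 / 2)"

text \<open>At \<open>u = 1 - s\<close> and \<open>u = s\<close> the quotient
  \<open>u / (2 - u)\<close> becomes \<open>(1 - s) / (1 + s)\<close> and
  \<open>s / (2 - s)\<close>, so one bound serves both damping factors. The 2 in the exponent is
  there because the factors enter squared.\<close>

lemma exp_coeffs_bound:
  assumes w: "exp_coeffs m al k" and u: "0 \<le> u" "u \<le> 1"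
  shows "exp (- 2 * m * (u / (2 - u))) \<le> (1 - u) + al * u + k * u * (1 - u)"
proof -
  define a where "a = 1 - al - k"
  from w have m: "0 \<le> m" and al: "0 < al" and e: "1 \<le> al * exp_lower (2 * m)"
    by (auto simp: exp_coeffs_def)
  have "1 \<le> al * exp (2 * m)"
    using order_trans[OF e mult_left_mono[OF exp_lower_le[of "2 * m"], of al]] m al by simp
  hence one: "exp (- 2 * m) \<le> 1 - a - k"
    by (simp add: a_def exp_minus field_simps)
  have eq: "1 - a * v - k * v\<^sup>2 = (1 - v) + al * v + k * v * (1 - v)" for v
    by (simp add: a_def algebra_simps power2_eq_square)
  have k12: "k \<ge> - 1 / 2" using w m mult_nonneg_nonneg[OF m, of 1] by (auto simp: exp_coeffs_def)
  have pos: "1 - a * v - k * v\<^sup>2 > 0" if "0 \<le> v" "v \<le> 1" for v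
  proof -
    have "(- 1 / 2) * (v * (1 - v)) \<le> k * (v * (1 - v))"
      using k12 that by (intro mult_right_mono) auto
    moreover have "v * (1 - v) \<le> 1 - v" using that by (simp add: mult_left_le_one_le)
    moreover have "al * v > 0 \<or> v = 0" using al that by auto
    ultimately show ?thesis unfolding eq using that by (cases "v = 0") (auto simp: mult.assoc)
  qed
  define N where "N = (\<lambda>u. 4 * m * (1 - a * u - k * u\<^sup>2) - (a + 2 * k * u) * (2 - u)\<^sup>2)"
  have N: "N v = 4 * (m - a) + v * (4 * a * (1 - m) - 8 * k) + v\<^sup>2 * (8 * k - a - 4 * m * k) - 2 * k * v ^ 3" for v
    by (simp add: N_def algebra_simps power2_eq_square power3_eq_cube)
  \<comment> \<open>The sign condition follows from monotonicity: in the three families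
    \<open>N u / u\<close>, \<open>N u / u ^ 2\<close> and \<open>N u\<close> itself, respectively,
    decrease in \<open>u\<close>. The identities below are these statements with the denominators
    cleared.\<close>
  have cross: "N s \<ge> 0" if "0 \<le> s" "s \<le> v" "v \<le> 1" "N v \<ge> 0" for s v
  proof (cases "s = v \<or> s = 0")
    case False
    hence sv: "0 < s" "s < v" "v > 0" using that by auto
    consider "k = 0" "a \<le> m" "0 \<le> a" | "a = m" "0 \<le> k" "2 * k \<le> m * (1 - m)" | "m = 2" "al = 93 / 5000" "k = - 1 / 2"
      using w by (fastforce simp: exp_coeffs_def a_def)
    thus ?thesis
    proof cases
      case 1
      have "v * N s = s * N v + 4 * (m - a) * (v - s) + a * s * v * (v - s)"
        unfolding N 1 by (simp add: algebra_simps power2_eq_square)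
      hence "v * N s \<ge> 0" using 1 sv that by (auto intro!: add_nonneg_nonneg mult_nonneg_nonneg)
      thus ?thesis using sv by (simp add: zero_le_mult_iff)
    next
      case 2
      have "v\<^sup>2 * N s = s\<^sup>2 * N v + (4 * (m * (1 - m) - 2 * k) + 2 * k * s * v) * (s * v * (v - s))"
        unfolding N 2 by (simp add: algebra_simps power2_eq_square power3_eq_cube)
      hence "v\<^sup>2 * N s \<ge> 0" using 2 sv that by (auto intro!: add_nonneg_nonneg mult_nonneg_nonneg)
      thus ?thesis using sv by (simp add: zero_le_mult_iff)
    next
      case 3
      have d: "N s - N v = (v - s) * (4 * a - 4 + (a) * (v + s) - (v\<^sup>2 + v * s + s\<^sup>2))"
        unfolding N 3 by (simp add: algebra_simps power2_eq_square power3_eq_cube)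
      have a: "a = 7407 / 5000" using 3 by (simp add: a_def)
      have "v\<^sup>2 \<le> v" "s\<^sup>2 \<le> s" "v * s \<le> s" using that sv by (auto simp: power2_eq_square mult_left_le_one_le mult_left_le)
      hence "v\<^sup>2 + v * s + s\<^sup>2 \<le> v + 2 * s" by linarith
      hence "4 * a - 4 + a * (v + s) - (v\<^sup>2 + v * s + s\<^sup>2) \<ge> 0"
        using sv that unfolding a by (simp add: distrib_left)
      with d have "N s - N v \<ge> 0" using sv by simp
      thus ?thesis using that by simp
    qed
  next
    case True
    have "N 0 \<ge> 0" using w by (auto simp: N exp_coeffs_def a_def)
    thus ?thesis using True that by auto
  qed
  show ?thesis
    using exp_moebius_le[OF cross[unfolded N_def] pos one u] by (simp add: eq)
qed

text \<open>With \<open>p = s * (1 - s)\<close> the polynomial \<open>p + p ^ 2\<close> equals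
  \<open>s - 2 * s ^ 3 + s ^ 4\<close>. Like the sine it has no quadratic term at 0 and is symmetric
  about \<open>1 / 2\<close>, so it is accurate near both end points, and it integrates to the Beta
  moments of orders (1, 1) and (2, 2).\<close>

lemma sin_pi_ge:
  assumes "0 \<le> s" "s \<le> (1::real)"
  shows "sin (pi * s) \<ge> pi * (s * (1 - s) + (s * (1 - s))\<^sup>2)"
proof -
  have *: "sin (pi * s) \<ge> pi * (s * (1 - s) + (s * (1 - s))\<^sup>2)" if s: "0 \<le> s" "s \<le> 1 / 2" for s :: real
  proof -
    define t where "t = pi * s"
    have "\<bar>sin t - (\<Sum>m<7. sin_coeff m * t ^ m)\<bar> \<le> inverse (fact 7) * \<bar>t\<bar> ^ 7"
      by (rule Maclaurin_sin_bound)
    moreover have "(\<Sum>m<7. sin_coeff m * t ^ m) = t - t ^ 3 / 6 + t ^ 5 / 120"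
    proof -
      have "{..<7::nat} = {0, 1, 2, 3, 4, 5, 6}" by auto
      thus ?thesis by (simp add: sin_coeff_def fact_numeral)
    qed
    moreover have "inverse (fact 7) * \<bar>t\<bar> ^ 7 = t ^ 7 / 5040"
      using s by (simp add: t_def fact_numeral field_simps)
    ultimately have sin: "sin t \<ge> t - t ^ 3 / 6 + t ^ 5 / 120 - t ^ 7 / 5040" by linarith
    have p: "pi > 3.1415" "pi < 3.1416" using pi_approx by auto
    have p2: "pi\<^sup>2 \<ge> 9.869" "pi\<^sup>2 \<le> 9.8697"
    proof -
      have "3.1415\<^sup>2 \<le> pi\<^sup>2" "pi\<^sup>2 \<le> 3.1416\<^sup>2" using p by (intro power_mono; simp)+
      thus "pi\<^sup>2 \<ge> 9.869" "pi\<^sup>2 \<le> 9.8697" by (simp_all add: power2_eq_square)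
    qed
    have p4: "pi ^ 4 \<ge> 97.3"
    proof -
      have "9.869\<^sup>2 \<le> (pi\<^sup>2)\<^sup>2" using p2 by (intro power_mono) auto
      moreover have "(pi\<^sup>2)\<^sup>2 = pi ^ 4" by (simp flip: power_mult)
      ultimately show ?thesis by (simp add: power2_eq_square)
    qed
    have p6: "pi ^ 6 \<le> 962"
    proof -
      have "(pi\<^sup>2) ^ 3 \<le> 9.8697 ^ 3" using p2 by (intro power_mono) auto
      thus ?thesis by (simp flip: power_mult add: power3_eq_cube)
    qed
    \<comment> \<open>The linear terms of the Taylor polynomial and of the right side agree and
      neither has a quadratic term, so \<open>pi * s ^ 3\<close> splits off from the difference and
      leaves \<open>Q\<close>.\<close>
    define Q where "Q = 2 - pi\<^sup>2 / 6 - s + pi ^ 4 / 120 * s\<^sup>2 - pi ^ 6 / 5040 * s ^ 4"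
    have "s\<^sup>2 * pi ^ 4 \<ge> s\<^sup>2 * 97.3" using p4 by (intro mult_left_mono) auto
    moreover have "s ^ 4 * pi ^ 6 \<le> s ^ 4 * 962" using p6 by (intro mult_left_mono) auto
    moreover have "s ^ 4 \<le> s\<^sup>2 * (1/4)"
    proof -
      have "s\<^sup>2 \<le> (1/2)\<^sup>2" using s by (intro power_mono) auto
      hence "s\<^sup>2 * s\<^sup>2 \<le> s\<^sup>2 * (1/4)" by (intro mult_left_mono) (auto simp: power2_eq_square)
      thus ?thesis by (simp flip: power_add)
    qed
    moreover have "s\<^sup>2 \<ge> s - 1 / 4" using zero_le_power2[of "s - 1/2"] by (simp add: power2_eq_square algebra_simps)
    ultimately have "Q \<ge> 0" unfolding Q_def using p2 s by (simp add: field_simps)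
    hence "pi * s ^ 3 * Q \<ge> 0" using s by simp
    moreover have "t - t ^ 3 / 6 + t ^ 5 / 120 - t ^ 7 / 5040 - pi * (s * (1 - s) + (s * (1 - s))\<^sup>2) = pi * s ^ 3 * Q"
      by (simp add: t_def Q_def field_simps eval_nat_numeral)
    ultimately show ?thesis using sin by (simp add: t_def)
  qed
  show ?thesis
  proof (cases "s \<le> 1 / 2")
    case False
    have "sin (pi * (1 - s)) = sin (pi * s)" by (simp add: right_diff_distrib sin_diff)
    thus ?thesis using *[of "1 - s"] assms False by (simp add: mult.commute)
  qed (use * assms in auto)
qed

section \<open>Covering the parameter quadrant by rectangles\<close>

definition box_ok :: "real \<Rightarrow> real \<Rightarrow> real \<Rightarrow> real \<Rightarrow> real \<Rightarrow> real \<Rightarrow> real \<Rightarrow> real \<Rightarrow> bool" where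
  "box_ok x0 x1 y0 y1 a1 k1 a2 k2 \<longleftrightarrow>
     (a1 \<le> 0.1247 \<or> 0 < x0) \<and> (a2 \<le> 0.1247 \<or> 0 < y0) \<and> 0 \<le> k2 \<and>
     (if a1 \<le> 0.1247 then (a1 - 0.1247) * (y0 + 1) / x1 else (a1 - 0.1247) * (y1 + 1) / x0)
     + (if a2 \<le> 0.1247 then (a2 - 0.1247) * (x0 + 1) / y1 else (a2 - 0.1247) * (x1 + 1) / y0)
     + a1 * a2 + k2 * (1 - (1 - a1) * (y0 + 1) / (x1 + y0 + 2))
     + (if 0 \<le> k1 then k1 * (1 - (1 - a2) * (x0 + 1) / (x0 + y1 + 2)) + k1 * k2 / 4
        else k1 * (1 - (1 - a2) * (x1 + 1) / (x1 + y0 + 2)))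
     \<le> 0.48 + 2 * 0.1247 + 1.48 * (x0 + 1) * (y0 + 1) / ((x1 + y1 + 2) * (x1 + y1 + 3))"

text \<open>\<open>weight_ineq\<close> states that \<open>weight_poly\<close> below has mean at most
  \<open>0.1247 + 1.48 * (mean of s * (1 - s) + (s * (1 - s))\<^sup>2)\<close>, divided by the mean of \<open>s * (1 - s)\<close>; \<open>box_ok\<close> is a
  sufficient condition on the rectangle of all \<open>x \<in> {x0..x1}\<close>, \<open>y \<in> {y0..y1}\<close>.\<close>

definition weight_ineq :: "real \<Rightarrow> real \<Rightarrow> real \<Rightarrow> real \<Rightarrow> real \<Rightarrow> real \<Rightarrow> bool" where
  "weight_ineq x y a1 k1 a2 k2 \<longleftrightarrow>
     (a1 - 0.1247) * ((y + 1) / x) + (a2 - 0.1247) * ((x + 1) / y) + a1 * a2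
     + k2 * ((x + 1) + a1 * (y + 1)) / (x + y + 2) + k1 * ((y + 1) + a2 * (x + 1)) / (x + y + 2)
     + k1 * k2 * ((x + 1) * (y + 1) / ((x + y + 2) * (x + y + 3)))
     \<le> 0.48 + 2 * 0.1247 + 1.48 * ((x + 1) * (y + 1) / ((x + y + 2) * (x + y + 3)))"

text \<open>Each summand is monotone in \<open>x\<close> and in \<open>y\<close> once the sign of
  its coefficient is known; \<open>box_ok\<close> branches on these signs and takes the matching
  corner. Here \<open>f\<close> increases in \<open>y\<close> and decreases in \<open>x\<close>,
  \<open>g = 1 - f\<close> does the opposite, and \<open>D\<close> lies between its corner estimate
  and \<open>1 / 4\<close>.\<close>

lemma box_ok_imp_weight_ineq:
  assumes ok: "box_ok x0 x1 y0 y1 a1 k1 a2 k2"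
    and a: "0 < a1" "a1 \<le> 1" "0 < a2" "a2 \<le> 1"
    and x: "0 \<le> x0" "x0 \<le> x" "x \<le> x1" "0 < x"
    and y: "0 \<le> y0" "y0 \<le> y" "y \<le> y1" "0 < y"
  shows "weight_ineq x y a1 k1 a2 k2"
proof -
  define f g D where "f = (y + 1) / (x + y + 2)" "g = (x + 1) / (x + y + 2)"
    "D = (x + 1) * (y + 1) / ((x + y + 2) * (x + y + 3))"
  have fg: "f + g = 1" using x y by (simp add: f_g_D_def flip: add_divide_distrib)
  have A: "(a1 - 0.1247) * ((y + 1) / x) \<le>
      (if a1 \<le> 0.1247 then (a1 - 0.1247) * (y0 + 1) / x1 else (a1 - 0.1247) * (y1 + 1) / x0)"
  proof (cases "a1 \<le> 0.1247")
    case True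
    have "(y0 + 1) / x1 \<le> (y + 1) / x" using x y by (intro frac_le) auto
    thus ?thesis using True mult_left_mono_neg[of _ _ "a1 - 0.1247"] by fastforce
  next
    case False
    hence "0 < x0" using ok by (simp add: box_ok_def)
    hence "(y + 1) / x \<le> (y1 + 1) / x0" using x y by (intro frac_le) auto
    thus ?thesis using False mult_left_mono[of _ _ "a1 - 0.1247"] by fastforce
  qed
  have B: "(a2 - 0.1247) * ((x + 1) / y) \<le>
      (if a2 \<le> 0.1247 then (a2 - 0.1247) * (x0 + 1) / y1 else (a2 - 0.1247) * (x1 + 1) / y0)"
  proof (cases "a2 \<le> 0.1247")
    case True
    have "(x0 + 1) / y1 \<le> (x + 1) / y" using x y by (intro frac_le) auto
    thus ?thesis using True mult_left_mono_neg[of _ _ "a2 - 0.1247"] by fastforce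
  next
    case False
    hence "0 < y0" using ok by (simp add: box_ok_def)
    hence "(x + 1) / y \<le> (x1 + 1) / y0" using x y by (intro frac_le) auto
    thus ?thesis using False mult_left_mono[of _ _ "a2 - 0.1247"] by fastforce
  qed
  have f0: "(y0 + 1) / (x1 + y0 + 2) \<le> f"
  proof -
    have "(y0 + 1) * (x + 1) \<le> (y + 1) * (x1 + 1)" using x y by (intro mult_mono) auto
    thus ?thesis using x y by (simp add: f_g_D_def divide_simps) (simp add: algebra_simps)
  qed
  have g0: "(x0 + 1) / (x0 + y1 + 2) \<le> g"
  proof -
    have "(x0 + 1) * (y + 1) \<le> (x + 1) * (y1 + 1)" using x y by (intro mult_mono) auto
    thus ?thesis using x y by (simp add: f_g_D_def divide_simps) (simp add: algebra_simps)
  qed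
  have g1: "g \<le> (x1 + 1) / (x1 + y0 + 2)"
  proof -
    have "(x1 + 1) / (x1 + y0 + 2) = 1 - (y0 + 1) / (x1 + y0 + 2)" using x y by (simp add: field_simps)
    thus ?thesis using f0 fg by simp
  qed
  have D0: "(x0 + 1) * (y0 + 1) / ((x1 + y1 + 2) * (x1 + y1 + 3)) \<le> D"
    unfolding f_g_D_def using x y by (intro frac_le mult_mono) auto
  have D1: "D \<le> 1 / 4"
  proof -
    have "(x + y + 2) * (x + y + 3) - 4 * ((x + 1) * (y + 1)) = (x - y)\<^sup>2 + (x + y + 2)"
      by (simp add: algebra_simps power2_eq_square)
    also have "\<dots> \<ge> 0" using x y by simp
    finally show ?thesis using x y by (simp add: f_g_D_def divide_simps)
  qed
  have k2: "0 \<le> k2" using ok by (simp add: box_ok_def)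
  have "(1 - a1) * ((y0 + 1) / (x1 + y0 + 2)) \<le> (1 - a1) * f" using f0 a by (intro mult_left_mono) auto
  hence K2: "k2 * (g + a1 * f) \<le> k2 * (1 - (1 - a1) * (y0 + 1) / (x1 + y0 + 2))"
    using k2 fg by (intro mult_left_mono) (auto simp: algebra_simps)
  have K1: "k1 * (f + a2 * g) + k1 * k2 * D \<le>
      (if 0 \<le> k1 then k1 * (1 - (1 - a2) * (x0 + 1) / (x0 + y1 + 2)) + k1 * k2 / 4
        else k1 * (1 - (1 - a2) * (x1 + 1) / (x1 + y0 + 2)))"
  proof (cases "0 \<le> k1")
    case True
    have "(1 - a2) * ((x0 + 1) / (x0 + y1 + 2)) \<le> (1 - a2) * g" using g0 a by (intro mult_left_mono) auto
    hence "k1 * (f + a2 * g) \<le> k1 * (1 - (1 - a2) * (x0 + 1) / (x0 + y1 + 2))"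
      using True fg by (intro mult_left_mono) (auto simp: algebra_simps)
    moreover have "k1 * k2 * D \<le> k1 * k2 * (1 / 4)" using True k2 D1 by (intro mult_left_mono) auto
    ultimately show ?thesis using True by simp
  next
    case False
    have "(1 - a2) * g \<le> (1 - a2) * ((x1 + 1) / (x1 + y0 + 2))" using g1 a by (intro mult_left_mono) auto
    hence "k1 * (f + a2 * g) \<le> k1 * (1 - (1 - a2) * (x1 + 1) / (x1 + y0 + 2))"
      using False fg by (intro mult_left_mono_neg) (auto simp: algebra_simps)
    moreover have "D \<ge> 0" using x y by (simp add: f_g_D_def)
    hence "k1 * k2 * D \<le> 0" using False k2 by (simp add: mult_nonpos_nonneg)
    ultimately show ?thesis unfolding if_not_P[OF False] by linarith
  qed
  have "k2 * ((x + 1) + a1 * (y + 1)) / (x + y + 2) = k2 * (g + a1 * f)"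
    "k1 * ((y + 1) + a2 * (x + 1)) / (x + y + 2) = k1 * (f + a2 * g)"
    by (simp_all add: f_g_D_def flip: add_divide_distrib)
  moreover have "1.48 * (x0 + 1) * (y0 + 1) / ((x1 + y1 + 2) * (x1 + y1 + 3)) \<le> 1.48 * D"
  proof -
    have "1.48 * ((x0 + 1) * (y0 + 1) / ((x1 + y1 + 2) * (x1 + y1 + 3))) \<le> 1.48 * D"
      using D0 by (rule mult_left_mono) simp
    thus ?thesis by (simp only: mult.assoc times_divide_eq_right)
  qed
  moreover have "(if a1 \<le> 0.1247 then (a1 - 0.1247) * (y0 + 1) / x1 else (a1 - 0.1247) * (y1 + 1) / x0)
     + (if a2 \<le> 0.1247 then (a2 - 0.1247) * (x0 + 1) / y1 else (a2 - 0.1247) * (x1 + 1) / y0)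
     + a1 * a2 + k2 * (1 - (1 - a1) * (y0 + 1) / (x1 + y0 + 2))
     + (if 0 \<le> k1 then k1 * (1 - (1 - a2) * (x0 + 1) / (x0 + y1 + 2)) + k1 * k2 / 4
        else k1 * (1 - (1 - a2) * (x1 + 1) / (x1 + y0 + 2)))
     \<le> 0.48 + 2 * 0.1247 + 1.48 * (x0 + 1) * (y0 + 1) / ((x1 + y1 + 2) * (x1 + y1 + 3))"
    using ok unfolding box_ok_def by blast
  ultimately show ?thesis unfolding weight_ineq_def f_g_D_def(3)[symmetric]
    using A B K1 K2 by linarith
qed

text \<open>The strip between \<open>y0\<close> and \<open>y1\<close> is scanned in the direction of
  \<open>x\<close>. An entry ends its rectangle at \<open>x1\<close> and carries an \<open>m\<close>
  that lies below one of the known lower bounds for \<open>m1\<close> on the whole rectangle. The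
  list may stop where everything further right has \<open>m1\<close> at least \<open>3.6\<close>.
  The conditions with \<open>3.163\<close> and \<open>3.14\<close> come in pairs because the sign of
  \<open>1 - x\<close> decides which of the two bounds is known.\<close>

fun strip_ok :: "real \<Rightarrow> real \<Rightarrow> real \<Rightarrow> real \<Rightarrow> real \<Rightarrow> (real \<times> real \<times> real \<times> real) list \<Rightarrow> bool" where
  "strip_ok y0 y1 a2 k2 x0 [] \<longleftrightarrow>
     3.6 \<le> 4.712 * y0 - 3.163 * (1 - x0) \<and> 3.6 \<le> 4.712 * y0 - 3.14 * (1 - x0)"
| "strip_ok y0 y1 a2 k2 x0 ((x1, m, a1, k1) # L) \<longleftrightarrow> x0 \<le> x1 \<and>
     (m \<le> 1.298 * y0 \<or> m \<le> 4.712 * y0 - 3.163 * (1 - x0) \<and> m \<le> 4.712 * y0 - 3.14 * (1 - x0) \<or>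
      m \<le> 1.203 * (1 - x1)) \<and>
     exp_coeffs m a1 k1 \<and> box_ok x0 x1 y0 y1 a1 k1 a2 k2 \<and> strip_ok y0 y1 a2 k2 x1 L"

fun strips_ok :: "real \<Rightarrow> (real \<times> real \<times> real \<times> real \<times> (real \<times> real \<times> real \<times> real) list) list \<Rightarrow> bool" where
  "strips_ok y0 [] \<longleftrightarrow> 3.6 \<le> 1.298 * y0"
| "strips_ok y0 ((y1, m, a2, k2, L) # S) \<longleftrightarrow> y0 \<le> y1 \<and> (m = 0 \<or> m \<le> 1.55 * (1 - y1)) \<and>
     exp_coeffs m a2 k2 \<and> strip_ok y0 y1 a2 k2 0 L \<and> strips_ok y1 S"

lemma strip_okD:
  assumes "strip_ok y0 y1 a2 k2 x0 L" "0 < a2" "a2 \<le> 1" "0 \<le> x0" "x0 \<le> x" "0 < x"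
    and y: "0 \<le> y0" "y0 \<le> y" "y \<le> y1" "0 < y"
    and m1: "1.298 * y \<le> m1" "4.712 * y - 3.163 * (1 - x) \<le> m1 \<or> 4.712 * y - 3.14 * (1 - x) \<le> m1" "1.203 * (1 - x) \<le> m1"
  shows "3.6 \<le> m1 \<or> (\<exists>m a1 k1. m \<le> m1 \<and> exp_coeffs m a1 k1 \<and> weight_ineq x y a1 k1 a2 k2)"
  using assms(1-6)
proof (induction L arbitrary: x0)
  case Nil
  hence "3.6 \<le> 4.712 * y0 - 3.163 * (1 - x0)" "3.6 \<le> 4.712 * y0 - 3.14 * (1 - x0)" by simp_all
  moreover have "4.712 * y0 - 3.163 * (1 - x0) \<le> 4.712 * y - 3.163 * (1 - x)"
      "4.712 * y0 - 3.14 * (1 - x0) \<le> 4.712 * y - 3.14 * (1 - x)"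
    using y Nil.prems by (simp_all add: field_simps)
  ultimately have "3.6 \<le> m1" using m1 by (meson order_trans)
  thus ?case by simp
next
  case (Cons b L)
  obtain x1 m a1 k1 where b: "b = (x1, m, a1, k1)" by (cases b)
  show ?case
  proof (cases "x1 \<le> x")
    case True
    thus ?thesis using Cons b by auto
  next
    case False
    have "m \<le> 1.298 * y0 \<or> m \<le> 4.712 * y0 - 3.163 * (1 - x0) \<and> m \<le> 4.712 * y0 - 3.14 * (1 - x0) \<or> m \<le> 1.203 * (1 - x1)"
      using Cons.prems unfolding b by simp
    moreover have "1.298 * y0 \<le> 1.298 * y" "4.712 * y0 - 3.163 * (1 - x0) \<le> 4.712 * y - 3.163 * (1 - x)"
      "4.712 * y0 - 3.14 * (1 - x0) \<le> 4.712 * y - 3.14 * (1 - x)" "1.203 * (1 - x1) \<le> 1.203 * (1 - x)"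
      using y Cons.prems False by (simp_all add: field_simps)
    ultimately have "m \<le> m1" using m1 by (meson order_trans)
    moreover have "weight_ineq x y a1 k1 a2 k2"
      using Cons.prems False y unfolding b
      by (intro box_ok_imp_weight_ineq[of x0 x1 y0 y1]) (auto simp: exp_coeffs_def)
    ultimately show ?thesis using Cons.prems unfolding b by auto
  qed
qed

lemma strips_okD:
  assumes "strips_ok y0 S" "0 \<le> y0" "y0 \<le> y" "0 < y" "0 < x"
    and m1: "1.298 * y \<le> m1" "4.712 * y - 3.163 * (1 - x) \<le> m1 \<or> 4.712 * y - 3.14 * (1 - x) \<le> m1" "1.203 * (1 - x) \<le> m1"
    and m2: "0 \<le> m2" "1.55 * (1 - y) \<le> m2"
  shows "3.6 \<le> m1 \<or> (\<exists>m a1 k1 m' a2 k2. m \<le> m1 \<and> m' \<le> m2 \<and>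
    exp_coeffs m a1 k1 \<and> exp_coeffs m' a2 k2 \<and> weight_ineq x y a1 k1 a2 k2)"
  using assms(1-3)
proof (induction S arbitrary: y0)
  case Nil
  thus ?case using m1 by auto
next
  case (Cons b S)
  obtain y1 m a2 k2 L where b: "b = (y1, m, a2, k2, L)" by (cases b)
  show ?case
  proof (cases "y1 \<le> y")
    case True
    thus ?thesis using Cons b by auto
  next
    case False
    have "m \<le> m2" using Cons.prems False m2 unfolding b by auto
    moreover have "3.6 \<le> m1 \<or> (\<exists>m a1 k1. m \<le> m1 \<and> exp_coeffs m a1 k1 \<and> weight_ineq x y a1 k1 a2 k2)"
      using Cons.prems False assms unfolding b
      by (intro strip_okD[of y0 y1 a2 k2 0 L]) (auto simp: exp_coeffs_def)
    ultimately show ?thesis using Cons.prems unfolding b by auto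
  qed
qed

text \<open>The list of rectangles was found by a numerical search; it leaves out only the parameters for
  which the lower bounds for \<open>m1\<close> reach \<open>3.6\<close>.\<close>

lemma strips_ok_cover:
  "strips_ok 0
   [(0.2, 1.24, 0.0838, 0,
      [(0.134, 1.041, 0.1247, 0), (0.416, 0.702, 0.246, 0.052), (0.687, 0.376, 0.507, 0.117),
       (0.882, 0.141, 0.799, 0.06), (1.496, 0, 1, 0), (3, 1.557, 0.0445, 0)]),
    (0.29, 1.1, 0.1109, 0,
      [(0.134, 1.041, 0.1247, 0), (0.375, 0.751, 0.223, 0.026), (0.593, 0.489, 0.387, 0.124),
       (0.717, 0.34, 0.548, 0.112), (0.783, 0.261, 0.643, 0.096), (1.656, 0.259, 0.646, 0.095),
       (3, 2, 93 / 5000, - 1 / 2)]),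
    (0.36, 0.992, 0.1376, 0,
      [(0.134, 1.041, 0.1247, 0), (0.346, 0.786, 0.208, 0.006), (0.529, 0.566, 0.323, 0.111),
       (0.625, 0.451, 0.426, 0.123), (0.669, 0.398, 0.483, 0.119), (0.71, 0.376, 0.507, 0.117),
       (2.328, 0.449, 0.428, 0.123)]),
    (0.42, 0.899, 0.1657, 0,
      [(0.134, 1.041, 0.1247, 0), (0.324, 0.813, 0.1968, 0), (0.476, 0.63, 0.284, 0.086),
       (0.562, 0.526, 0.35, 0.124), (0.596, 0.486, 0.39, 0.124), (0.609, 0.47, 0.406, 0.124),
       (0.653, 0.467, 0.409, 0.124), (2.203, 0.598, 0.303, 0.099)]),
    (0.48, 0.806, 0.1995, 0,
      [(0.134, 1.041, 0.1247, 0), (0.302, 0.839, 0.1868, 0), (0.427, 0.689, 0.253, 0.058),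
       (0.494, 0.608, 0.297, 0.095), (0.527, 0.569, 0.321, 0.11), (0.541, 0.552, 0.332, 0.116),
       (0.552, 0.545, 0.337, 0.118), (0.71, 0.562, 0.325, 0.113), (3, 1.061, 0.1198, 0)]),
    (0.52, 0.744, 0.226, 0.03,
      [(0.134, 1.041, 0.1247, 0), (0.287, 0.857, 0.1802, 0), (0.396, 0.726, 0.235, 0.039),
       (0.453, 0.658, 0.269, 0.073), (0.479, 0.626, 0.286, 0.088), (0.558, 0.623, 0.288, 0.089),
       (2.096, 0.863, 0.178, 0)]),
    (0.56, 0.682, 0.256, 0.062,
      [(0.134, 1.041, 0.1247, 0), (0.27, 0.878, 0.1728, 0), (0.362, 0.767, 0.216, 0.017),
       (0.408, 0.712, 0.241, 0.047), (0.428, 0.688, 0.253, 0.059), (0.436, 0.678, 0.258, 0.064),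
       (0.445, 0.674, 0.26, 0.066), (0.583, 0.694, 0.25, 0.056), (2.182, 1.131, 0.1042, 0)]),
    (0.59, 0.635, 0.281, 0.084,
      [(0.134, 1.041, 0.1247, 0), (0.26, 0.89, 0.1687, 0), (0.343, 0.79, 0.206, 0.004),
       (0.381, 0.744, 0.226, 0.03), (0.405, 0.726, 0.235, 0.039), (0.642, 0.756, 0.221, 0.023),
       (2.075, 1.506, 0.0493, 0)]),
    (0.62, 0.589, 0.308, 0.103,
      [(0.134, 1.041, 0.1247, 0), (0.248, 0.904, 0.164, 0), (0.319, 0.819, 0.1944, 0),
       (0.353, 0.778, 0.211, 0.011), (0.386, 0.765, 0.217, 0.018), (0.802, 0.837, 0.1875, 0),
       (2.572, 2, 93 / 5000, - 1 / 2)]),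
    (0.65, 0.542, 0.339, 0.119,
      [(0.134, 1.041, 0.1247, 0), (0.236, 0.919, 0.1592, 0), (0.294, 0.849, 0.1831, 0),
       (0.322, 0.815, 0.196, 0), (0.358, 0.804, 0.2003, 0), (0.772, 0.89, 0.1687, 0),
       (2.298, 2, 93 / 5000, - 1 / 2)]),
    (0.68, 0.496, 0.38, 0.124,
      [(0.134, 1.041, 0.1247, 0), (0.222, 0.935, 0.1542, 0), (0.267, 0.881, 0.1718, 0),
       (0.287, 0.857, 0.1802, 0), (0.296, 0.846, 0.1842, 0), (0.306, 0.843, 0.1853, 0),
       (0.422, 0.867, 0.1766, 0), (1.192, 1.234, 0.0848, 0)]),
    (0.7, 0.465, 0.411, 0.124,
      [(0.134, 1.041, 0.1247, 0), (0.215, 0.944, 0.1514, 0), (0.253, 0.898, 0.166, 0),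
       (0.285, 0.882, 0.1714, 0), (0.574, 0.942, 0.152, 0), (1.305, 1.856, 0.0245, 0)]),
    (0.72, 0.434, 0.444, 0.122,
      [(0.134, 1.041, 0.1247, 0), (0.206, 0.955, 0.1481, 0), (0.236, 0.919, 0.1592, 0),
       (0.266, 0.908, 0.1627, 0), (0.564, 0.976, 0.142, 0), (1.194, 1.919, 0.0216, 0)]),
    (0.74, 0.403, 0.477, 0.12,
      [(0.134, 1.041, 0.1247, 0), (0.197, 0.966, 0.1449, 0), (0.221, 0.937, 0.1536, 0),
       (0.263, 0.934, 0.1545, 0), (0.693, 1.061, 0.1198, 0), (1.626, 2, 93 / 5000, - 1 / 2)]),
    (0.77, 0.356, 0.53, 0.114,
      [(0.134, 1.041, 0.1247, 0), (0.182, 0.984, 0.1398, 0), (0.197, 0.966, 0.1449, 0),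
       (0.202, 0.96, 0.1467, 0), (0.218, 0.962, 0.1461, 0), (0.417, 1.013, 0.1319, 0),
       (0.886, 1.642, 0.0376, 0), (1.476, 2, 93 / 5000, - 1 / 2)]),
    (0.81, 0.294, 0.603, 0.103,
      [(0.134, 1.041, 0.1247, 0), (0.164, 1.005, 0.134, 0), (0.178, 0.999, 0.1357, 0),
       (0.301, 1.028, 0.128, 0), (0.666, 1.417, 0.0588, 0), (1.265, 2, 93 / 5000, - 1 / 2)]),
    (0.86, 0.217, 0.699, 0.084,
      [(0.19, 1.051, 0.1223, 0), (0.45, 1.254, 0.0815, 0), (1.072, 2, 93 / 5000, - 1 / 2)]),
    (0.94, 0.093, 0.865, 0.042,
      [(0.177, 1.116, 0.1074, 0), (0.402, 1.449, 0.0552, 0), (0.858, 2, 93 / 5000, - 1 / 2)]),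
    (1.44, 0, 1, 0,
      [(0.25, 1.266, 0.0796, 0), (0.765, 2, 93 / 5000, - 1 / 2)]),
    (2.78, 0, 1, 0,
      [])]"
  by (simp add: box_ok_def exp_coeffs_def exp_lower_def)

section \<open>Real Beta moments and the pointwise bound of the kernel\<close>

lemma has_integral_Beta_moment:
  fixes x y :: real
  assumes "0 < x" "0 < y"
  shows "((\<lambda>s. s powr (x - 1) * (1 - s) powr (y - 1) * (s ^ i * (1 - s) ^ j)) has_integral
    Beta x y * (pochhammer x i * pochhammer y j / pochhammer (x + y) (i + j))) {0..1}"
proof -
  have "((\<lambda>s. s powr (x + i - 1) * (1 - s) powr (y + j - 1)) has_integral Beta (x + i) (y + j)) {0..1}"
    using assms by (intro has_integral_Beta_real) auto
  moreover have "Beta (x + i) (y + j) = Beta x y * (pochhammer x i * pochhammer y j / pochhammer (x + y) (i + j))"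
  proof -
    have "z \<notin> \<int>\<^sub>\<le>\<^sub>0" "Gamma z \<noteq> 0" if "0 < z" for z :: real
      using that Gamma_real_pos[OF that] by (force elim!: nonpos_Ints_cases)+
    note * = this this[of x] this[of y] this[of "x + y"]
    show ?thesis
      using assms * by (simp add: pochhammer_Gamma Beta_def add_ac)
  qed
  moreover have "s powr (x + i - 1) * (1 - s) powr (y + j - 1) =
      s powr (x - 1) * (1 - s) powr (y - 1) * (s ^ i * (1 - s) ^ j)" if "s \<in> {0..1}" for s
  proof (cases "s = 0 \<or> s = 1")
    case False
    hence s: "0 < s" "s < 1" using that by auto
    have "s powr (x + i - 1) = s powr (x - 1) * s ^ i" "(1 - s) powr (y + j - 1) = (1 - s) powr (y - 1) * (1 - s) ^ j"
      using s by (simp_all add: algebra_simps flip: powr_realpow powr_add)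
    thus ?thesis by simp
  qed auto
  ultimately show ?thesis by (metis (no_types, lifting) has_integral_eq)
qed

lemma cos_ge_sin_pi:
  assumes "\<bar>\<theta>\<bar> \<le> pi" "0 \<le> s" "s \<le> 1"
  shows "sin (pi * s) \<le> cos (\<theta> * (s - 1 / 2))"
proof -
  have "\<bar>\<theta> * (s - 1 / 2)\<bar> \<le> \<bar>pi * (s - 1 / 2)\<bar>"
    using assms by (auto simp: abs_mult intro!: mult_right_mono)
  moreover have "\<bar>pi * (s - 1 / 2)\<bar> \<le> pi * (1 / 2)"
    unfolding abs_mult using assms abs_le_iff[of "s - 1 / 2" "1 / 2"] by (intro mult_mono) auto
  ultimately have "cos \<bar>pi * (s - 1 / 2)\<bar> \<le> cos \<bar>\<theta> * (s - 1 / 2)\<bar>"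
    by (intro cos_monotone_0_pi_le) (use pi_gt_zero in linarith)+
  moreover have "cos (pi * (s - 1 / 2)) = sin (pi * s)"
    by (simp add: right_diff_distrib cos_diff)
  ultimately show ?thesis by (metis cos_abs_real)
qed

text \<open>Centring at the value for \<open>s = 1 / 2\<close> makes the distance depend on \<theta>
  only through cos(\<theta>(s - 1/2)), which is smallest for |\<theta>| = \<pi> and equals
  sin(\<pi>s) there.\<close>

lemma norm_exp_diff_sq:
  assumes "\<bar>\<theta>\<bar> \<le> pi" "0 \<le> s" "s \<le> 1" "0 \<le> r"
  shows "(norm (exp (\<i> * of_real (\<theta> * s)) - of_real r * exp (\<i> * of_real (\<theta> / 2))))\<^sup>2
    \<le> 1 + r\<^sup>2 - 2 * r * (pi * (s * (1 - s) + (s * (1 - s))\<^sup>2))"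
proof -
  have "exp (\<i> * of_real (\<theta> * s)) - of_real r * exp (\<i> * of_real (\<theta> / 2))
      = exp (\<i> * of_real (\<theta> / 2)) * (exp (\<i> * of_real (\<theta> * (s - 1 / 2))) - of_real r)"
    by (simp add: algebra_simps flip: exp_add)
  hence "norm (exp (\<i> * of_real (\<theta> * s)) - of_real r * exp (\<i> * of_real (\<theta> / 2)))
    = norm (exp (\<i> * of_real (\<theta> * (s - 1 / 2))) - of_real r)"
    by (simp add: norm_mult)
  moreover have "(norm (exp (\<i> * of_real t) - of_real r))\<^sup>2 = 1 + r\<^sup>2 - 2 * r * cos t" for t
  proof -
    have "(norm (exp (\<i> * of_real t) - of_real r))\<^sup>2 = (cos t - r)\<^sup>2 + (sin t)\<^sup>2"
      by (simp add: cmod_def flip: cis_conv_exp)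
    also have "\<dots> = (cos t)\<^sup>2 + (sin t)\<^sup>2 + r\<^sup>2 - 2 * r * cos t" by (simp add: power2_eq_square algebra_simps)
    finally show ?thesis by simp
  qed
  moreover have "pi * (s * (1 - s) + (s * (1 - s))\<^sup>2) \<le> cos (\<theta> * (s - 1 / 2))"
    using sin_pi_ge cos_ge_sin_pi assms by (meson order_trans)
  hence "2 * r * (pi * (s * (1 - s) + (s * (1 - s))\<^sup>2)) \<le> 2 * r * cos (\<theta> * (s - 1 / 2))"
    using assms(4) by (intro mult_left_mono) auto
  ultimately show ?thesis by (simp del: of_real_mult of_real_diff of_real_divide)
qed

text \<open>The product of the quadratic majorants of \<open>exp_coeffs_bound\<close>, at
  \<open>u = 1 - s\<close> for \<open>m1\<close> and at \<open>u = s\<close> for \<open>m2\<close>;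
  it dominates the square of the damping factor.\<close>

definition weight_poly :: "real \<Rightarrow> real \<Rightarrow> real \<Rightarrow> real \<Rightarrow> real \<Rightarrow> real" where
  "weight_poly a1 k1 a2 k2 s = (s + a1 * (1 - s) + k1 * (1 - s) * s) * ((1 - s) + a2 * s + k2 * s * (1 - s))"

text \<open>The numbers \<open>1.2809 = 1 + 0.53 ^ 2\<close> and \<open>1.06 = 2 * 0.53\<close> come
  from \<open>norm_exp_diff_sq\<close> with \<open>r = 0.53\<close>. The slope \<open>1.48\<close>
  satisfies \<open>3 / 4 * 1.48 \<le> 1.06 * pi / 3\<close>, so the mean of
  \<open>s * (1 - s) + (s * (1 - s)) ^ 2\<close> drops out and
  \<open>1.2809 / 3 + 3 / 4 * 0.1247 < 0.5205\<close> remains.\<close>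

lemma has_integral_weight_poly:
  fixes x y :: real
  assumes xy: "0 < x" "0 < y" and w: "weight_ineq x y a1 k1 a2 k2"
  obtains I where "I \<le> 0.5205 * Beta x y"
    "((\<lambda>s. s powr (x - 1) * (1 - s) powr (y - 1) *
        ((1.2809 - 1.06 * (pi * (s * (1 - s) + (s * (1 - s))\<^sup>2))) / 3 + 3 / 4 * weight_poly a1 k1 a2 k2 s))
      has_integral I) {0..1}"
proof -
  define d where "d = (\<lambda>s. s powr (x - 1) * (1 - s) powr (y - 1))"
  define M where "M = (\<lambda>i j. pochhammer x i * pochhammer y j / pochhammer (x + y) (i + j))"
  have mom: "((\<lambda>s. d s * (s ^ i * (1 - s) ^ j)) has_integral Beta x y * M i j) {0..1}" for i j
    using has_integral_Beta_moment[OF xy, of i j] unfolding d_def M_def .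
  define J where "J = (1.2809 * M 0 0 - 1.06 * pi * (M 1 1 + M 2 2)) / 3
     + 3 / 4 * (M 1 1 * (1 + a1 * a2) + a2 * M 2 0 + a1 * M 0 2 + (k2 + k1 * a2) * M 2 1
       + (a1 * k2 + k1) * M 1 2 + k1 * k2 * M 2 2)"
  have "((\<lambda>s. (1.2809 * (d s * (s ^ 0 * (1 - s) ^ 0)) - 1.06 * pi * (d s * (s ^ 1 * (1 - s) ^ 1) + d s * (s ^ 2 * (1 - s) ^ 2))) / 3
     + 3 / 4 * (d s * (s ^ 1 * (1 - s) ^ 1) * (1 + a1 * a2) + a2 * (d s * (s ^ 2 * (1 - s) ^ 0)) + a1 * (d s * (s ^ 0 * (1 - s) ^ 2))
       + (k2 + k1 * a2) * (d s * (s ^ 2 * (1 - s) ^ 1))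
       + (a1 * k2 + k1) * (d s * (s ^ 1 * (1 - s) ^ 2)) + k1 * k2 * (d s * (s ^ 2 * (1 - s) ^ 2)))) has_integral
     ((1.2809 * (Beta x y * M 0 0) - 1.06 * pi * (Beta x y * M 1 1 + Beta x y * M 2 2)) / 3
     + 3 / 4 * (Beta x y * M 1 1 * (1 + a1 * a2) + a2 * (Beta x y * M 2 0) + a1 * (Beta x y * M 0 2)
       + (k2 + k1 * a2) * (Beta x y * M 2 1)
       + (a1 * k2 + k1) * (Beta x y * M 1 2) + k1 * k2 * (Beta x y * M 2 2)))) {0..1}"
    by (intro has_integral_add has_integral_diff has_integral_mult_right has_integral_mult_left has_integral_divide mom)
  also have "(1.2809 * (Beta x y * M 0 0) - 1.06 * pi * (Beta x y * M 1 1 + Beta x y * M 2 2)) / 3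
     + 3 / 4 * (Beta x y * M 1 1 * (1 + a1 * a2) + a2 * (Beta x y * M 2 0) + a1 * (Beta x y * M 0 2)
       + (k2 + k1 * a2) * (Beta x y * M 2 1)
       + (a1 * k2 + k1) * (Beta x y * M 1 2) + k1 * k2 * (Beta x y * M 2 2)) = Beta x y * J"
    by (simp add: J_def algebra_simps add_divide_distrib diff_divide_distrib)
  finally have 1: "((\<lambda>s. d s * ((1.2809 - 1.06 * (pi * (s * (1 - s) + (s * (1 - s))\<^sup>2))) / 3 + 3 / 4 * weight_poly a1 k1 a2 k2 s))
      has_integral Beta x y * J) {0..1}"
    by (rule has_integral_eq[rotated]) (simp add: weight_poly_def power2_eq_square algebra_simps)
  have "J \<le> 0.5205"
  proof -
    define A B D f g where "A = (y + 1) / x" "B = (x + 1) / y"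
      "D = (x + 1) * (y + 1) / ((x + y + 2) * (x + y + 3))"
      "f = (y + 1) / (x + y + 2)" "g = (x + 1) / (x + y + 2)"
    note defs = this
    have p2: "pochhammer z 1 = z" "pochhammer z 2 = z * (z + 1)" "pochhammer z 3 = z * (z + 1) * (z + 2)"
      "pochhammer z 4 = z * (z + 1) * (z + 2) * (z + 3)" for z :: real
      by (simp_all add: eval_nat_numeral pochhammer_Suc)
    have nz: "x + y \<noteq> 0" "x + y + 1 \<noteq> 0" "x + y + 2 \<noteq> 0" "x + y + 3 \<noteq> 0" "x \<noteq> 0" "y \<noteq> 0"
      using xy by linarith+
    have M: "M 0 0 = 1" "M 2 0 = M 1 1 * B" "M 0 2 = M 1 1 * A" "M 2 1 = M 1 1 * g" "M 1 2 = M 1 1 * f" "M 2 2 = M 1 1 * D"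
      using nz by (simp_all add: M_def defs p2 divide_simps flip: One_nat_def numeral_2_eq_2 numeral_3_eq_3)
    have M11_eq: "M 1 1 = x * y / ((x + y) * (x + y + 1))"
      by (simp add: M_def p2 flip: numeral_2_eq_2)
    \<comment> \<open>This is the mean of \<open>(s + (1 - s)) ^ 2 = 1\<close>. It lets the constant
      \<open>0.1247\<close> be distributed over the terms with \<open>A\<close> and
      \<open>B\<close>, as \<open>weight_ineq\<close> requires.\<close>
    have sum: "M 1 1 * (A + B + 2) = 1"
    proof -
      have "M 1 1 * (A + B + 2) = ((y + 1) * y + (x + 1) * x + 2 * x * y) / ((x + y) * (x + y + 1))"
        unfolding M11_eq using nz by (simp add: defs divide_simps)
      also have "(y + 1) * y + (x + 1) * x + 2 * x * y = (x + y) * (x + y + 1)" by (simp add: algebra_simps)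
      finally show ?thesis using nz by simp
    qed
    have M11: "M 1 1 \<ge> 0" using xy by (simp add: M_def pochhammer_nonneg)
    have D: "D \<ge> 0" using xy by (simp add: defs)
    have "k2 * ((x + 1) + a1 * (y + 1)) / (x + y + 2) = k2 * (g + a1 * f)"
      "k1 * ((y + 1) + a2 * (x + 1)) / (x + y + 2) = k1 * (f + a2 * g)"
      by (simp_all add: defs flip: add_divide_distrib)
    hence "1 + a1 * a2 + a2 * B + a1 * A + (k2 + k1 * a2) * g + (a1 * k2 + k1) * f + k1 * k2 * D
       \<le> 0.1247 * (A + B + 2) + 1.48 * (1 + D)"
      using w unfolding weight_ineq_def defs(1-3)[symmetric] by (simp add: algebra_simps add_divide_distrib)
    hence "M 1 1 * (1 + a1 * a2 + a2 * B + a1 * A + (k2 + k1 * a2) * g + (a1 * k2 + k1) * f + k1 * k2 * D)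
       \<le> M 1 1 * (0.1247 * (A + B + 2) + 1.48 * (1 + D))" using M11 by (rule mult_left_mono)
    also have "\<dots> = 0.1247 * (M 1 1 * (A + B + 2)) + 1.48 * (M 1 1 * (1 + D))" by (simp add: algebra_simps)
    finally have *: "M 1 1 * (1 + a1 * a2 + a2 * B + a1 * A + (k2 + k1 * a2) * g + (a1 * k2 + k1) * f + k1 * k2 * D)
       \<le> 0.1247 + 1.48 * (M 1 1 * (1 + D))" unfolding sum by simp
    define P Q where "P = M 1 1 * (1 + D)"
      "Q = M 1 1 * (1 + a1 * a2 + a2 * B + a1 * A + (k2 + k1 * a2) * g + (a1 * k2 + k1) * f + k1 * k2 * D)"
    have "30000 * J = 12809 - 10600 * (pi * P) + 22500 * Q"
      unfolding J_def M P_Q_def by (simp add: algebra_simps add_divide_distrib diff_divide_distrib)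
    moreover have "P \<ge> 0" using M11 D by (simp add: P_Q_def)
    moreover from this have "3.1415926 * P \<le> pi * P"
      using pi_approx by (intro mult_right_mono) auto
    hence "31415926 * P \<le> 10000000 * (pi * P)" by (simp add: mult_ac)
    moreover have "Q \<le> 0.1247 + 1.48 * P" using * unfolding P_Q_def .
    hence "10000 * Q \<le> 1247 + 14800 * P" by simp
    ultimately have "10000 * J \<le> 5205" by linarith
    thus ?thesis by simp
  qed
  moreover have "Beta x y \<ge> 0" using xy by (simp add: Beta_def)
  ultimately have "Beta x y * J \<le> 0.5205 * Beta x y" using mult_left_mono[of J "0.5205" "Beta x y"] by simp
  thus ?thesis using 1 unfolding d_def by (rule that)
qed

lemma exp_ge_082: "exp (0.82 :: real) \<ge> 2.27"
proof -
  have "2.27 \<le> exp_lower 0.82" by (simp add: exp_lower_def)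
  thus ?thesis using exp_lower_le[of "0.82"] by simp
qed

text \<open>With \<open>X = (1 - s) / (1 + s)\<close> the exponential \<open>exp (3.6 * X)\<close>
  is replaced by its tangent at \<open>3.6 * X = 0.82\<close>. What remains is a quadratic
  inequality in \<open>X\<close>; \<open>0.2136\<close> is close to the minimiser of the quadratic,
  whose minimum is positive.\<close>

lemma large_exponent_bound:
  assumes "3.6 \<le> m" "0 \<le> s" "s \<le> (1::real)"
  shows "pi * (1 - s) * exp (- m * ((1 - s) / (1 + s))) \<le> 0.5205"
proof -
  define X where "X = (1 - s) / (1 + s)"
  have X: "0 \<le> X" "X \<le> 1" using assms by (auto simp: X_def)
  have s: "1 - s = 2 * X / (1 + X)" using assms by (simp add: X_def field_simps)
  have "exp 0.82 * (1 + (3.6 * X - 0.82)) \<le> exp 0.82 * exp (3.6 * X - 0.82)"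
    by (intro mult_left_mono exp_ge_add_one_self) auto
  also have "\<dots> = exp (3.6 * X)" by (simp flip: exp_add)
  finally have "2.27 * (0.18 + 3.6 * X) \<le> exp (3.6 * X)"
    using mult_right_mono[OF exp_ge_082, of "0.18 + 3.6 * X"] X by (simp add: algebra_simps)
  hence "2.27 * (0.18 + 3.6 * X) * (1 + X) * 0.5205 \<le> exp (3.6 * X) * (1 + X) * 0.5205"
    using X by (intro mult_right_mono) auto
  moreover have "2 * 3.1416 * X \<le> 2.27 * (0.18 + 3.6 * X) * (1 + X) * 0.5205"
    using zero_le_power2[of "X - 0.2136"] X
    by (simp add: power2_eq_square algebra_simps add_divide_distrib)
  moreover have "2 * pi * X \<le> 2 * 3.1416 * X" using X pi_approx by (intro mult_right_mono) auto
  ultimately have "2 * pi * X \<le> exp (3.6 * X) * (1 + X) * 0.5205" by linarith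
  hence "pi * (1 - s) \<le> 0.5205 * exp (3.6 * X)" using X unfolding s by (simp add: field_simps)
  hence "pi * (1 - s) * exp (- (3.6 * X)) \<le> 0.5205" by (simp add: exp_minus field_simps)
  moreover have "3.6 * X \<le> m * X" using assms X by (intro mult_right_mono) auto
  hence "exp (- m * X) \<le> exp (- (3.6 * X))" by simp
  hence "pi * (1 - s) * exp (- m * X) \<le> pi * (1 - s) * exp (- (3.6 * X))"
    using assms by (intro mult_left_mono) auto
  ultimately show ?thesis unfolding X_def by linarith
qed

lemma norm_exp_diff_le:
  assumes "\<bar>\<theta>\<bar> \<le> pi" "s \<le> 1"
  shows "norm (exp (\<i> * of_real (\<theta> * s)) - exp (\<i> * of_real \<theta>)) \<le> pi * (1 - s)"
proof -
  have "norm (exp (\<i> * of_real (\<theta> * s)) - exp (\<i> * of_real \<theta>)) \<le> \<bar>\<theta> * s - \<theta>\<bar>"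
  proof -
    have "exp (\<i> * of_real (\<theta> * s)) - exp (\<i> * of_real \<theta>)
        = exp (\<i> * of_real \<theta>) * (exp (\<i> * of_real (\<theta> * s - \<theta>)) - 1)"
      by (simp add: algebra_simps flip: exp_add)
    hence "norm (exp (\<i> * of_real (\<theta> * s)) - exp (\<i> * of_real \<theta>))
        = 2 * \<bar>sin ((\<theta> * s - \<theta>) / 2)\<bar>"
      using dist_exp_i_1[of "\<theta> * s - \<theta>"] by (simp add: norm_mult)
    also have "\<dots> \<le> 2 * \<bar>(\<theta> * s - \<theta>) / 2\<bar>"
      by (intro mult_left_mono abs_sin_x_le_abs_x) auto
    finally show ?thesis by simp
  qed
  also have "\<theta> * s - \<theta> = - (\<theta> * (1 - s))" by (simp add: algebra_simps)
  also have "\<bar>- (\<theta> * (1 - s))\<bar> = \<bar>\<theta>\<bar> * (1 - s)" using assms by (simp add: abs_mult)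
  also have "\<dots> \<le> pi * (1 - s)" using assms by (intro mult_right_mono) auto
  finally show ?thesis .
qed

text \<open>For \<open>m1 \<ge> 3.6\<close> the choice \<open>\<kappa> = exp (\<i> * \<theta>)\<close> gives a pointwise bound. Otherwise
  \<open>\<kappa> = 0.53 * exp (\<i> * \<theta> / 2)\<close>, and \<open>h * W \<le> h\<^sup>2 / 3 + 3 / 4 * W\<^sup>2\<close> reduces the mean to Beta moments.\<close>

lemma kernel_majorant:
  fixes x y :: real
  assumes xy: "0 < x" "0 < y" and \<theta>: "\<bar>\<theta>\<bar> \<le> pi"
    and m1: "1.298 * y \<le> m1" "4.712 * y - 3.163 * (1 - x) \<le> m1 \<or> 4.712 * y - 3.14 * (1 - x) \<le> m1" "1.203 * (1 - x) \<le> m1"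
    and m2: "0 \<le> m2" "1.55 * (1 - y) \<le> m2"
  obtains \<kappa> G I where "I \<le> 0.5205 * Beta x y"
    "((\<lambda>s. s powr (x - 1) * (1 - s) powr (y - 1) * G s) has_integral I) {0..1}"
    "\<And>s. 0 \<le> s \<Longrightarrow> s \<le> 1 \<Longrightarrow> norm (exp (\<i> * of_real (\<theta> * s)) - \<kappa>)
        * exp (- m1 * ((1 - s) / (1 + s)) - m2 * (s / (2 - s))) \<le> G s"
proof (cases "3.6 \<le> m1")
  case True
  show ?thesis
  proof (rule that)
    show "0.5205 * Beta x y \<le> 0.5205 * Beta x y" by simp
    show "((\<lambda>s. s powr (x - 1) * (1 - s) powr (y - 1) * 0.5205) has_integral 0.5205 * Beta x y) {0..1}"
      using has_integral_mult_left[OF has_integral_Beta_moment[OF xy, of 0 0], of "0.5205"]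
      by (simp add: mult_ac)
    fix s :: real assume s: "0 \<le> s" "s \<le> 1"
    have "exp (- m1 * ((1 - s) / (1 + s)) - m2 * (s / (2 - s))) \<le> exp (- m1 * ((1 - s) / (1 + s)))"
      using s m2 by simp
    hence "norm (exp (\<i> * of_real (\<theta> * s)) - exp (\<i> * of_real \<theta>))
        * exp (- m1 * ((1 - s) / (1 + s)) - m2 * (s / (2 - s))) \<le> pi * (1 - s) * exp (- m1 * ((1 - s) / (1 + s)))"
      using norm_exp_diff_le[OF \<theta> s(2)] s by (intro mult_mono) auto
    also have "\<dots> \<le> 0.5205" using large_exponent_bound[OF True s] .
    finally show "norm (exp (\<i> * of_real (\<theta> * s)) - exp (\<i> * of_real \<theta>))
        * exp (- m1 * ((1 - s) / (1 + s)) - m2 * (s / (2 - s))) \<le> 0.5205" .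
  qed
next
  case False
  obtain m a1 k1 m' a2 k2 where w: "m \<le> m1" "m' \<le> m2" "exp_coeffs m a1 k1" "exp_coeffs m' a2 k2"
      "weight_ineq x y a1 k1 a2 k2"
    using strips_okD[OF strips_ok_cover order_refl _ xy(2,1) m1 m2] False xy by auto
  obtain I where I: "I \<le> 0.5205 * Beta x y"
    "((\<lambda>s. s powr (x - 1) * (1 - s) powr (y - 1) *
        ((1.2809 - 1.06 * (pi * (s * (1 - s) + (s * (1 - s))\<^sup>2))) / 3 + 3 / 4 * weight_poly a1 k1 a2 k2 s))
      has_integral I) {0..1}"
    using has_integral_weight_poly[OF xy w(5)] by blast
  show ?thesis
  proof (rule that[OF I])
    fix s :: real assume s: "0 \<le> s" "s \<le> 1"
    define h where "h = norm (exp (\<i> * of_real (\<theta> * s)) - of_real 0.53 * exp (\<i> * of_real (\<theta> / 2)))"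
    define W where "W = exp (- m1 * ((1 - s) / (1 + s)) - m2 * (s / (2 - s)))"
    have h: "h\<^sup>2 \<le> 1.2809 - 1.06 * (pi * (s * (1 - s) + (s * (1 - s))\<^sup>2))"
      using norm_exp_diff_sq[OF \<theta> s, of "0.53"] unfolding h_def by (simp add: power2_eq_square)
    have "W\<^sup>2 = exp (- 2 * m1 * ((1 - s) / (1 + s))) * exp (- 2 * m2 * (s / (2 - s)))"
      unfolding W_def power2_eq_square by (simp flip: exp_add add: algebra_simps)
    also have "\<dots> \<le> exp (- 2 * m * ((1 - s) / (1 + s))) * exp (- 2 * m' * (s / (2 - s)))"
      using w s by (intro mult_mono) (auto intro!: mult_right_mono divide_right_mono)
    also have "\<dots> \<le> weight_poly a1 k1 a2 k2 s"
      unfolding weight_poly_def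
    proof (rule mult_mono)
      show 1: "exp (- 2 * m * ((1 - s) / (1 + s))) \<le> s + a1 * (1 - s) + k1 * (1 - s) * s"
        using exp_coeffs_bound[OF w(3), of "1 - s"] s by simp
      show "exp (- 2 * m' * (s / (2 - s))) \<le> (1 - s) + a2 * s + k2 * s * (1 - s)"
        using exp_coeffs_bound[OF w(4), of s] s by simp
      show "0 \<le> s + a1 * (1 - s) + k1 * (1 - s) * s" using 1 order_trans[OF exp_ge_zero] by blast
    qed simp
    finally have W: "W\<^sup>2 \<le> weight_poly a1 k1 a2 k2 s" .
    have "h * W \<le> h\<^sup>2 / 3 + 3 / 4 * W\<^sup>2"
      using zero_le_power2[of "h - 3 / 2 * W"] by (simp add: power2_eq_square algebra_simps)
    also have "\<dots> \<le> (1.2809 - 1.06 * (pi * (s * (1 - s) + (s * (1 - s))\<^sup>2))) / 3 + 3 / 4 * weight_poly a1 k1 a2 k2 s"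
      using h W by (intro add_mono divide_right_mono mult_left_mono) auto
    finally show "norm (exp (\<i> * of_real (\<theta> * s)) - of_real 0.53 * exp (\<i> * of_real (\<theta> / 2)))
        * exp (- m1 * ((1 - s) / (1 + s)) - m2 * (s / (2 - s))) \<le>
        (1.2809 - 1.06 * (pi * (s * (1 - s) + (s * (1 - s))\<^sup>2))) / 3 + 3 / 4 * weight_poly a1 k1 a2 k2 s"
      unfolding h_def W_def .
  qed
qed

section \<open>Taylor remainders\<close>

text \<open>Putting \<open>P = 1 - s * \<zeta>\<close> and \<open>Q = 1 - t * cnj \<zeta>\<close>,
  one has \<open>1 - s * t * (norm \<zeta>) ^ 2 = P + Q - P * Q\<close>; division by
  \<open>P * Q\<close> gives the claim. Its use: for fixed \<open>norm \<zeta>\<close> a Hermitian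
  product of resolvents becomes affine in real parts of holomorphic functions, so its mean over a
  circle can be read off at the centre.\<close>

lemma Re_resolvent_product:
  fixes \<zeta> :: complex and s t :: real
  assumes "norm \<zeta> < 1" "\<bar>s\<bar> \<le> 1" "\<bar>t\<bar> \<le> 1"
  shows "Re (1 / (1 - of_real s * \<zeta>) * cnj (1 / (1 - of_real t * \<zeta>))) =
    (Re (1 / (1 - of_real s * \<zeta>)) + Re (1 / (1 - of_real t * \<zeta>)) - 1) / (1 - s * t * (norm \<zeta>)\<^sup>2)"
proof -
  have nz: "1 - of_real r * \<zeta> \<noteq> 0" if "\<bar>r\<bar> \<le> 1" for r
  proof
    assume "1 - of_real r * \<zeta> = 0"
    hence "norm (of_real r * \<zeta>) = 1" by simp
    moreover have "norm (of_real r * \<zeta>) \<le> 1 * norm \<zeta>"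
      unfolding norm_mult using that by (intro mult_right_mono) auto
    ultimately show False using assms by simp
  qed
  have st: "1 - s * t * (norm \<zeta>)\<^sup>2 \<noteq> 0"
  proof -
    have "\<bar>s * t * (norm \<zeta>)\<^sup>2\<bar> \<le> 1 * 1 * (norm \<zeta>)\<^sup>2"
      unfolding abs_mult using assms by (intro mult_mono) auto
    moreover have "(norm \<zeta>)\<^sup>2 < 1" using assms by (simp add: power_less_one_iff)
    ultimately show ?thesis by auto
  qed
  define p r where "p = 1 / (1 - of_real s * \<zeta>)" "r = 1 / (1 - of_real t * \<zeta>)"
  have p: "p * (1 - of_real s * \<zeta>) = 1" and r: "cnj r * (1 - of_real t * cnj \<zeta>) = 1"
  proof -
    show "p * (1 - of_real s * \<zeta>) = 1" using nz[of s] assms by (simp add: p_r_def)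
    have "r * (1 - of_real t * \<zeta>) = 1" using nz[of t] assms by (simp add: p_r_def)
    hence "cnj (r * (1 - of_real t * \<zeta>)) = cnj 1" by simp
    thus "cnj r * (1 - of_real t * cnj \<zeta>) = 1" by simp
  qed
  have "p * cnj r * of_real (1 - s * t * (norm \<zeta>)\<^sup>2) = p + cnj r - 1"
  proof -
    have "of_real ((norm \<zeta>)\<^sup>2) = \<zeta> * cnj \<zeta>" by (rule complex_norm_square)
    hence eq: "of_real (1 - s * t * (norm \<zeta>)\<^sup>2) =
        (1 - of_real s * \<zeta>) + (1 - of_real t * cnj \<zeta>) - (1 - of_real s * \<zeta>) * (1 - of_real t * cnj \<zeta>)"
      by (simp add: algebra_simps)
    have "p * cnj r * of_real (1 - s * t * (norm \<zeta>)\<^sup>2) =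
      (p * (1 - of_real s * \<zeta>)) * cnj r + p * (cnj r * (1 - of_real t * cnj \<zeta>))
      - (p * (1 - of_real s * \<zeta>)) * (cnj r * (1 - of_real t * cnj \<zeta>))"
      unfolding eq by (simp add: algebra_simps)
    thus ?thesis unfolding p r by simp
  qed
  hence "Re (p * cnj r * of_real (1 - s * t * (norm \<zeta>)\<^sup>2)) = Re (p + cnj r - 1)" by simp
  hence "Re (p * cnj r) * (1 - s * t * (norm \<zeta>)\<^sup>2) = Re p + Re r - 1"
    by (simp only: Re_complex_of_real Im_complex_of_real times_complex.sel) simp
  thus ?thesis using st unfolding p_r_def[symmetric] by (simp add: field_simps)
qed

text \<open>Expansion of \<open>((norm u) ^ 2 + (norm v) ^ 2) / 2\<close> for the factors
  \<open>u\<close> and \<open>v\<close> below by \<open>Re_resolvent_product\<close>. The modulus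
  \<open>q\<close> is kept as a separate parameter so that the expression is holomorphic in
  \<open>\<zeta>\<close>; on the circle \<open>norm \<zeta> = q\<close> its real part is the desired
  quantity, and its value at 0 is the mean.\<close>

definition resolvent_majorant :: "real \<Rightarrow> complex \<Rightarrow> complex" where
  "resolvent_majorant q \<zeta> = (let R = (\<lambda>t::real. 1 / (1 - of_real t * \<zeta>)) in
     (1 / 9 + 4 / 9 * of_real (inverse (1 - 9 / 16 * q\<^sup>2)) * (2 * R (3 / 4) - 1) + 4 / 9 * R (3 / 4)
      + 1 / 9 * of_real (inverse (1 - q\<^sup>2)) * (2 * R 1 - 1) + 4 / 9 * of_real (inverse (1 - q\<^sup>2 / 16)) * (2 * R (1 / 4) - 1)
      + 4 / 9 * of_real (inverse (1 - q\<^sup>2 / 4)) * (R 1 + R (1 / 4) - 1)) / 2)"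

text \<open>The factorisation \<open>1 / (1 - \<zeta>) = u * v\<close> into near square roots comes from the Pade approximant
  \<open>u = (1 - \<zeta> / 4) / (1 - 3 * \<zeta> / 4)\<close> of \<open>(1 - \<zeta>) powr (- 1 / 2)\<close>.\<close>

lemma resolvent_le_Re:
  assumes "norm \<zeta> < 1"
  shows "norm (1 / (1 - \<zeta>)) \<le> Re (resolvent_majorant (norm \<zeta>) \<zeta>)"
proof -
  define R where "R = (\<lambda>t::real. 1 / (1 - of_real t * \<zeta>))"
  have nz: "1 - of_real r * \<zeta> \<noteq> 0" if "\<bar>r\<bar> \<le> 1" for r
  proof
    assume "1 - of_real r * \<zeta> = 0"
    hence "norm (of_real r * \<zeta>) = 1" by simp
    moreover have "norm (of_real r * \<zeta>) \<le> 1 * norm \<zeta>"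
      unfolding norm_mult using that by (intro mult_right_mono) auto
    ultimately show False using assms by simp
  qed
  have prod: "Re (R s * cnj (R t)) = (Re (R s) + Re (R t) - 1) / (1 - s * t * (norm \<zeta>)\<^sup>2)"
    if "\<bar>s\<bar> \<le> 1" "\<bar>t\<bar> \<le> 1" for s t
    using Re_resolvent_product[OF assms that] by (simp add: R_def)
  have lin: "(norm (of_real a * w + of_real b * z))\<^sup>2 =
      a\<^sup>2 * Re (w * cnj w) + b\<^sup>2 * Re (z * cnj z) + 2 * a * b * Re (w * cnj z)" for a b w z
    unfolding cmod_power2 by (simp add: power2_eq_square algebra_simps)
  define u v where "u = of_real (1 / 3) * R 0 + of_real (2 / 3) * R (3 / 4)"
    "v = of_real (1 / 3) * R 1 + of_real (2 / 3) * R (1 / 4)"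
  have "u * v = 1 / (1 - \<zeta>)"
  proof -
    have n: "1 - \<zeta> \<noteq> 0" "4 - \<zeta> \<noteq> 0" "4 - 3 * \<zeta> \<noteq> 0" using nz[of 1] nz[of "1/4"] nz[of "3/4"] by auto
    have "u = (4 - \<zeta>) / (4 - 3 * \<zeta>)" "v = (4 - 3 * \<zeta>) / ((1 - \<zeta>) * (4 - \<zeta>))"
      using n nz[of "1/4"] nz[of "3/4"] by (simp_all add: u_v_def R_def divide_simps) (simp_all add: algebra_simps)
    thus ?thesis using n by simp
  qed
  hence "norm (1 / (1 - \<zeta>)) = norm u * norm v" by (metis norm_mult)
  also have "\<dots> \<le> ((norm u)\<^sup>2 + (norm v)\<^sup>2) / 2"
    using sum_squares_bound[of "norm u" "norm v"] by simp
  also have "\<dots> = Re (resolvent_majorant (norm \<zeta>) \<zeta>)"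
  proof -
    define q A B C D where "q = norm \<zeta>" "A = inverse (1 - 9 / 16 * q\<^sup>2)" "B = inverse (1 - q\<^sup>2)"
      "C = inverse (1 - q\<^sup>2 / 16)" "D = inverse (1 - q\<^sup>2 / 4)"
    have R: "Re (R 0 * cnj (R 0)) = 1" "Re (R 0 * cnj (R (3 / 4))) = Re (R (3 / 4))"
    proof -
      have "R 0 = 1" by (simp add: R_def)
      thus "Re (R 0 * cnj (R 0)) = 1" "Re (R 0 * cnj (R (3 / 4))) = Re (R (3 / 4))" by simp_all
    qed
    have R': "Re (R (3 / 4) * cnj (R (3 / 4))) = (2 * Re (R (3 / 4)) - 1) * A"
      "Re (R 1 * cnj (R 1)) = (2 * Re (R 1) - 1) * B"
      "Re (R (1 / 4) * cnj (R (1 / 4))) = (2 * Re (R (1 / 4)) - 1) * C"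
      "Re (R 1 * cnj (R (1 / 4))) = (Re (R 1) + Re (R (1 / 4)) - 1) * D"
    proof -
      have ABCD: "A = inverse (1 - 3 / 4 * (3 / 4) * q\<^sup>2)" "B = inverse (1 - 1 * 1 * q\<^sup>2)"
        "C = inverse (1 - 1 / 4 * (1 / 4) * q\<^sup>2)" "D = inverse (1 - 1 * (1 / 4) * q\<^sup>2)"
        by (simp_all add: q_A_B_C_D_def)
      have "Re (R s * cnj (R t)) = (Re (R s) + Re (R t) - 1) * inverse (1 - s * t * q\<^sup>2)"
        if "\<bar>s\<bar> \<le> 1" "\<bar>t\<bar> \<le> 1" for s t
        using prod[OF that] unfolding q_A_B_C_D_def(1) divide_inverse .
      note prod' = this
      show "Re (R (3 / 4) * cnj (R (3 / 4))) = (2 * Re (R (3 / 4)) - 1) * A"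
        unfolding ABCD mult_2 by (rule prod') simp_all
      show "Re (R 1 * cnj (R 1)) = (2 * Re (R 1) - 1) * B"
        unfolding ABCD mult_2 by (rule prod') simp_all
      show "Re (R (1 / 4) * cnj (R (1 / 4))) = (2 * Re (R (1 / 4)) - 1) * C"
        unfolding ABCD mult_2 by (rule prod') simp_all
      show "Re (R 1 * cnj (R (1 / 4))) = (Re (R 1) + Re (R (1 / 4)) - 1) * D"
        unfolding ABCD by (rule prod') simp_all
    qed
    have "Re (resolvent_majorant q \<zeta>) = (1 / 9 + 4 / 9 * A * (2 * Re (R (3 / 4)) - 1) + 4 / 9 * Re (R (3 / 4))
      + 1 / 9 * B * (2 * Re (R 1) - 1) + 4 / 9 * C * (2 * Re (R (1 / 4)) - 1)
      + 4 / 9 * D * (Re (R 1) + Re (R (1 / 4)) - 1)) / 2"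
    proof -
      have [simp]: "Re (4 / 9 * of_real a * z) = 4 / 9 * a * Re z" "Re (1 / 9 * of_real a * z) = 1 / 9 * a * Re z" for a z
        by simp_all
      have [simp]: "Re (4 / 9 * z) = 4 / 9 * Re z" "Re (2 * z) = 2 * Re z" "Re (z / 2) = Re z / 2" for z
        by simp_all
      show ?thesis
        unfolding resolvent_majorant_def Let_def q_A_B_C_D_def(2-5)[symmetric] R_def[symmetric]
        by simp
    qed
    thus ?thesis unfolding u_v_def lin R R' q_A_B_C_D_def(1)[symmetric]
      by (simp add: power2_eq_square algebra_simps)
  qed
  finally show ?thesis .
qed

text \<open>On the circle the integrand is dominated by the real part of a holomorphic function,
  whose mean is its value at the centre. This replaces the maximum \<open>1 / (1 - q)\<close> of the
  resolvent by an average.\<close>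

lemma contour_mean_le:
  assumes w: "0 < r" "norm w < r"
    and F: "(F has_contour_integral I) (circlepath 0 r)"
    and le: "\<And>u. norm u = r \<Longrightarrow> norm (F u * u) \<le> B * norm (1 / (1 - w / u))" and B: "0 \<le> B"
  shows "norm I \<le> 2 * pi * B * Re (resolvent_majorant (norm w / r) 0)"
proof -
  define q where "q = norm w / r"
  have q: "0 \<le> q" "q < 1" using assms by (auto simp: q_def)
  \<comment> \<open>The quotient \<open>w / u\<close> has a pole inside the disc, but on the circle
    its conjugate is the linear function \<open>\<zeta>\<close>, and conjugation leaves the modulus
    of the resolvent unchanged.\<close>
  define \<zeta> where "\<zeta> = (\<lambda>z. cnj w * z / of_real (r\<^sup>2))"
  define \<Phi> where "\<Phi> = (\<lambda>z. resolvent_majorant q (\<zeta> z))"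
  have n\<zeta>: "norm (\<zeta> z) = q * (norm z / r)" for z
    using w by (simp add: \<zeta>_def q_def norm_mult norm_divide power2_eq_square)
  have nz: "1 - of_real t * \<zeta> z \<noteq> 0" if "norm z \<le> r" "\<bar>t\<bar> \<le> 1" for t z
  proof
    assume "1 - of_real t * \<zeta> z = 0"
    hence "norm (of_real t * \<zeta> z) = 1" by simp
    moreover have "norm (of_real t * \<zeta> z) \<le> 1 * (q * 1)"
      unfolding norm_mult n\<zeta> using that w q by (intro mult_mono) auto
    ultimately show False using q by simp
  qed
  define R where "R = (\<lambda>(t::real) z. 1 / (1 - of_real t * \<zeta> z))"
  have R: "R t holomorphic_on cball 0 r" if "\<bar>t\<bar> \<le> 1" for t
  proof -
    have "\<zeta> holomorphic_on cball 0 r" unfolding \<zeta>_def using w by (intro holomorphic_intros) auto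
    thus ?thesis unfolding R_def using nz[OF _ that] by (intro holomorphic_intros) auto
  qed
  define A B' C D :: complex where "A = of_real (inverse (1 - 9 / 16 * q\<^sup>2))" "B' = of_real (inverse (1 - q\<^sup>2))"
    "C = of_real (inverse (1 - q\<^sup>2 / 16))" "D = of_real (inverse (1 - q\<^sup>2 / 4))"
  have "(\<lambda>z. (1 / 9 + 4 / 9 * A * (2 * R (3 / 4) z - 1) + 4 / 9 * R (3 / 4) z
      + 1 / 9 * B' * (2 * R 1 z - 1) + 4 / 9 * C * (2 * R (1 / 4) z - 1)
      + 4 / 9 * D * (R 1 z + R (1 / 4) z - 1)) / 2) holomorphic_on cball 0 r"
    using R[of "3 / 4"] R[of 1] R[of "1 / 4"] by (intro holomorphic_intros) auto
  hence "\<Phi> holomorphic_on cball 0 r"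
    unfolding \<Phi>_def resolvent_majorant_def Let_def R_def A_B'_C_D_def .
  hence "((\<lambda>u. \<Phi> u / (u - 0)) has_contour_integral 2 * of_real pi * \<i> * \<Phi> 0) (circlepath 0 r)"
    using w by (intro Cauchy_integral_circlepath)
      (auto intro: holomorphic_on_imp_continuous_on elim: holomorphic_on_subset)
  hence "((\<lambda>t. \<Phi> (circlepath 0 r t) / circlepath 0 r t * (2 * pi * \<i> * circlepath 0 r t))
      has_integral 2 * of_real pi * \<i> * \<Phi> 0) {0..1}"
    unfolding has_contour_integral_def
    by (rule has_integral_eq[rotated]) (simp add: vector_derivative_circlepath01, simp add: circlepath)
  from has_integral_mult_right[OF this, of "of_real B / \<i>"]
  have "((\<lambda>t. of_real B / \<i> * (\<Phi> (circlepath 0 r t) / circlepath 0 r t * (2 * pi * \<i> * circlepath 0 r t)))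
      has_integral of_real (2 * pi * B) * \<Phi> 0) {0..1}"
    by (simp add: mult_ac)
  hence "((\<lambda>t. of_real (2 * pi * B) * \<Phi> (circlepath 0 r t)) has_integral of_real (2 * pi * B) * \<Phi> 0) {0..1}"
  proof (rule has_integral_eq[rotated])
    fix t :: real
    have "of_real B / \<i> * (X / c * (2 * pi * \<i> * c)) = of_real (2 * pi * B) * X" if "c \<noteq> 0" for X c :: complex
      using that by simp
    moreover have "circlepath 0 r t \<noteq> 0" using w by (simp add: circlepath)
    ultimately show "of_real B / \<i> * (\<Phi> (circlepath 0 r t) / circlepath 0 r t * (2 * pi * \<i> * circlepath 0 r t))
      = of_real (2 * pi * B) * \<Phi> (circlepath 0 r t)" by blast
  qed
  from has_integral_Re[OF this] have G: "((\<lambda>t. 2 * pi * B * Re (\<Phi> (circlepath 0 r t))) has_integral 2 * pi * B * Re (\<Phi> 0)) {0..1}"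
    by (simp only: Re_complex_of_real Im_complex_of_real times_complex.sel) simp
  have F': "((\<lambda>t. F (circlepath 0 r t) * (2 * pi * \<i> * circlepath 0 r t)) has_integral I) {0..1}"
    using F unfolding has_contour_integral_def
    by (rule has_integral_eq[rotated]) (simp add: vector_derivative_circlepath01, simp add: circlepath)
  have "norm I \<le> 2 * pi * B * Re (\<Phi> 0)"
  proof -
    have "norm (integral {0..1} (\<lambda>t. F (circlepath 0 r t) * (2 * pi * \<i> * circlepath 0 r t)))
      \<le> integral {0..1} (\<lambda>t. 2 * pi * B * Re (\<Phi> (circlepath 0 r t)))"
    proof (rule integral_norm_bound_integral)
      fix t :: real
      define u where "u = circlepath 0 r t"
      have u: "norm u = r" using w by (simp add: u_def circlepath norm_mult)
      have "\<zeta> u = cnj (w / u)"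
      proof -
        have "of_real (r\<^sup>2) = u * cnj u" using u by (metis complex_norm_square)
        moreover have "u \<noteq> 0" using u w by auto
        ultimately show ?thesis by (simp add: \<zeta>_def)
      qed
      hence "norm (1 / (1 - w / u)) = norm (1 / (1 - \<zeta> u))"
        unfolding norm_divide by (metis complex_cnj_diff complex_cnj_one complex_mod_cnj)
      also have "\<dots> \<le> Re (\<Phi> u)"
        using resolvent_le_Re[of "\<zeta> u"] u q w by (simp add: n\<zeta> \<Phi>_def)
      finally have "B * norm (1 / (1 - w / u)) \<le> B * Re (\<Phi> u)" using B by (rule mult_left_mono)
      hence "2 * pi * norm (F u * u) \<le> 2 * pi * (B * Re (\<Phi> u))" using le[OF u] by (intro mult_left_mono) auto
      thus "norm (F u * (2 * pi * \<i> * u)) \<le> 2 * pi * B * Re (\<Phi> u)" by (simp add: norm_mult mult_ac)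
    qed (use F' G in \<open>blast intro: has_integral_integrable\<close>)+
    thus ?thesis unfolding integral_unique[OF F'] integral_unique[OF G] .
  qed
  thus ?thesis by (simp add: \<Phi>_def \<zeta>_def q_def)
qed

text \<open>At \<open>\<zeta> = 0\<close> every resolvent is 1 and the four inverses increase with
  \<open>q\<close>; \<open>1.15265\<close> is the value at \<open>q = 2 / 3\<close>, rounded
  up.\<close>

lemma resolvent_majorant_0_le:
  assumes "0 \<le> q" "q \<le> 2 / 3"
  shows "Re (resolvent_majorant q 0) \<le> 1.15265"
proof -
  have q: "q\<^sup>2 \<le> 4 / 9" using power_mono[OF assms(2,1), of 2] by (simp add: power2_eq_square)
  have "inverse (1 - 9 / 16 * q\<^sup>2) \<le> inverse (3 / 4)" "inverse (1 - q\<^sup>2) \<le> inverse (5 / 9)"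
    "inverse (1 - q\<^sup>2 / 16) \<le> inverse (35 / 36)" "inverse (1 - q\<^sup>2 / 4) \<le> inverse (8 / 9)"
    using q by (intro le_imp_inverse_le; simp)+
  moreover have "Re (resolvent_majorant q 0) = (5 / 9 + 4 / 9 * inverse (1 - 9 / 16 * q\<^sup>2)
      + 1 / 9 * inverse (1 - q\<^sup>2) + 4 / 9 * inverse (1 - q\<^sup>2 / 16) + 4 / 9 * inverse (1 - q\<^sup>2 / 4)) / 2"
  proof -
    define A B C D where "A = inverse (1 - 9 / 16 * q\<^sup>2)" "B = inverse (1 - q\<^sup>2)"
      "C = inverse (1 - q\<^sup>2 / 16)" "D = inverse (1 - q\<^sup>2 / 4)"
    show ?thesis
      unfolding resolvent_majorant_def Let_def A_B_C_D_def[symmetric] by simp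
  qed
  ultimately show ?thesis by (simp only:) simp
qed

text \<open>The Cauchy kernel of the remainder is
  \<open>f u / u * (w / u) ^ Suc k / (1 - w / u)\<close>. On the circle the modulus of
  \<open>w / u\<close> is constant, so after bounding \<open>f\<close> by \<open>M\<close> only the
  resolvent \<open>1 / (1 - w / u)\<close> has to be averaged.\<close>

lemma Taylor_remainder_bound:
  assumes f: "f holomorphic_on ball 0 R" and r: "0 < r" "r < R"
    and M: "\<And>z. norm z = r \<Longrightarrow> norm (f z) \<le> M"
    and w: "norm w = q * r" "0 \<le> q" "q \<le> 2 / 3"
  shows "norm (f w - (\<Sum>j\<le>k. (deriv ^^ j) f 0 / fact j * w ^ j)) \<le> 1.15265 * M * q ^ Suc k"
proof -
  have wr: "norm w < r" using w r mult_right_mono[OF w(3), of r] by simp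
  have M0: "0 \<le> M" using order_trans[OF norm_ge_zero M[of "of_real r"]] r by simp
  have cont: "continuous_on (cball 0 r) f" and hol: "f holomorphic_on ball 0 r"
    using f r by (auto intro!: holomorphic_on_imp_continuous_on intro: holomorphic_on_subset)
  have "((\<lambda>u. f u / (u - w)) has_contour_integral 2 * of_real pi * \<i> * f w) (circlepath 0 r)"
    using cont hol wr by (intro Cauchy_integral_circlepath) auto
  moreover have "((\<lambda>u. w ^ j * (f u / (u - 0) ^ Suc j)) has_contour_integral
      w ^ j * ((2 * pi * \<i>) / (fact j) * (deriv ^^ j) f 0)) (circlepath 0 r)" for j
    using cont hol r
    by (intro has_contour_integral_lmul Cauchy_has_contour_integral_higher_derivative_circlepath) auto
  ultimately have "((\<lambda>u. f u / (u - w) - (\<Sum>j\<le>k. w ^ j * (f u / (u - 0) ^ Suc j))) has_contour_integral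
      2 * of_real pi * \<i> * f w - (\<Sum>j\<le>k. w ^ j * ((2 * pi * \<i>) / (fact j) * (deriv ^^ j) f 0))) (circlepath 0 r)"
    by (intro has_contour_integral_diff has_contour_integral_sum) auto
  hence "norm (2 * of_real pi * \<i> * f w - (\<Sum>j\<le>k. w ^ j * ((2 * pi * \<i>) / (fact j) * (deriv ^^ j) f 0)))
     \<le> 2 * pi * (M * q ^ Suc k) * Re (resolvent_majorant (norm w / r) 0)"
  proof (rule contour_mean_le[OF r(1) wr])
    fix u :: complex assume u: "norm u = r"
    hence nz: "u \<noteq> 0" "u \<noteq> w" using r wr by auto
    have "f u / (u - w) - (\<Sum>j\<le>k. w ^ j * (f u / (u - 0) ^ Suc j))
        = f u / u * (1 / (1 - w / u) - (\<Sum>j\<le>k. (w / u) ^ j))"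
      using nz by (simp add: right_diff_distrib sum_distrib_left power_divide field_simps)
    also have "(\<Sum>j\<le>k. (w / u) ^ j) = (1 - (w / u) ^ Suc k) / (1 - w / u)"
      using nz sum_gp0[of "w / u" k] by simp
    also have "1 / (1 - w / u) - \<dots> = (w / u) ^ Suc k * (1 / (1 - w / u))"
      by (simp flip: diff_divide_distrib)
    finally have "norm ((f u / (u - w) - (\<Sum>j\<le>k. w ^ j * (f u / (u - 0) ^ Suc j))) * u)
      = norm (f u) * q ^ Suc k * norm (1 / (1 - w / u))"
      using nz u w r by (simp add: norm_mult norm_divide norm_power)
    also have "\<dots> \<le> M * q ^ Suc k * norm (1 / (1 - w / u))"
      using M[OF u] w by (intro mult_right_mono) auto
    finally show "norm ((f u / (u - w) - (\<Sum>j\<le>k. w ^ j * (f u / (u - 0) ^ Suc j))) * u)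
      \<le> M * q ^ Suc k * norm (1 / (1 - w / u))" .
  qed (use M0 w in auto)
  also have "2 * of_real pi * \<i> * f w - (\<Sum>j\<le>k. w ^ j * ((2 * pi * \<i>) / (fact j) * (deriv ^^ j) f 0))
     = 2 * of_real pi * \<i> * (f w - (\<Sum>j\<le>k. (deriv ^^ j) f 0 / fact j * w ^ j))"
    by (simp add: sum_distrib_left right_diff_distrib mult_ac)
  also have "norm \<dots> = 2 * pi * norm (f w - (\<Sum>j\<le>k. (deriv ^^ j) f 0 / fact j * w ^ j))"
    by (simp add: norm_mult)
  also have "norm w / r = q" using w r by simp
  finally have "norm (f w - (\<Sum>j\<le>k. (deriv ^^ j) f 0 / fact j * w ^ j)) \<le> M * q ^ Suc k * Re (resolvent_majorant q 0)"
    using pi_gt_zero by (simp add: mult.assoc)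
  also have "\<dots> \<le> M * q ^ Suc k * 1.15265"
    using resolvent_majorant_0_le[OF w(2,3)] M0 w by (intro mult_left_mono) auto
  finally show ?thesis by (simp add: mult_ac)
qed

section \<open>The logarithm of \<open>z / (exp z - 1)\<close>\<close>

text \<open>Up to \<open>2.9\<close> the exponential is bounded by its tangent at
  \<open>1.9\<close>, which vanishes at \<open>2.9\<close>, and completing the square at
  \<open>1.8362824375\<close> settles the quadratic. Beyond that point the quadratic term alone
  exceeds \<open>x\<close>.\<close>

lemma exp_neg_quadratic:
  fixes x :: real
  shows "x < 0.4 * x\<^sup>2 + 3.1415 * exp (- x)"
proof -
  have "exp (1.9::real) \<le> 6.696"
  proof -
    have 2: "exp (2::real) \<le> 7.3984"
      using mult_mono[OF less_imp_le[OF e_less_272] less_imp_le[OF e_less_272]] by (simp flip: exp_add)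
    have "1 + 0.1 + 0.1\<^sup>2 / 2 \<le> exp (0.1 :: real)"
      by (rule exp_lower_Taylor_quadratic) simp
    hence "exp (1.9::real) * 1.105 \<le> exp 1.9 * exp 0.1"
      by (intro mult_left_mono) (simp_all add: power2_eq_square)
    also have "\<dots> = exp 2" by (simp flip: exp_add)
    finally show ?thesis using 2 by simp
  qed
  hence "inverse 6.696 \<le> inverse (exp (1.9::real))" by (intro le_imp_inverse_le) auto
  hence e: "0.1493 \<le> exp (- 1.9::real)" by (simp add: exp_minus)
  show ?thesis
  proof (cases "x \<le> 2.9")
    case True
    have "0.1493 * (2.9 - x) \<le> exp (- 1.9) * (1 + (1.9 - x))"
      using e True by (intro mult_mono) auto
    also have "\<dots> \<le> exp (- 1.9) * exp (1.9 - x)" by (intro mult_left_mono exp_ge_add_one_self) auto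
    also have "\<dots> = exp (- x)" by (simp flip: exp_add)
    finally have "3.1415 * (0.1493 * (2.9 - x)) \<le> 3.1415 * exp (- x)" by (intro mult_left_mono) auto
    moreover have "x < 0.4 * x\<^sup>2 + 3.1415 * (0.1493 * (2.9 - x))"
      using zero_le_power2[of "x - 1.8362824375"] by (simp add: power2_eq_square algebra_simps add_divide_distrib diff_divide_distrib)
    ultimately show ?thesis by linarith
  next
    case False
    have "x * 2.5 \<le> x * x" using False by (intro mult_left_mono) auto
    hence "x \<le> 0.4 * x\<^sup>2" by (simp add: power2_eq_square)
    moreover have "0 < 3.1415 * exp (- x)" by simp
    ultimately show ?thesis by linarith
  qed
qed

text \<open>With \<open>Im z = 3 * pi / 2 - u\<close> a negative real value would force \<open>x * cos u = y * (sin u + exp (- x))\<close>,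
  which is impossible because \<open>tan u \<ge> u\<close>.\<close>

lemma exp_quotient_not_neg:
  fixes z :: complex
  assumes z: "norm z \<le> 3 * pi / 2" "z \<noteq> 0"
  shows "z / (exp z - 1) \<notin> \<real>\<^sub>\<le>\<^sub>0"
proof
  assume neg: "z / (exp z - 1) \<in> \<real>\<^sub>\<le>\<^sub>0"
  have nz: "exp z \<noteq> 1" using exp_neq_1_disc[of z] z pi_gt_zero by simp
  have main: False if r: "0 < r" and ez: "exp z - 1 = - of_real r * z" and z: "norm z \<le> 3 * pi / 2" "z \<noteq> 0"
    and im: "Im z \<ge> 0" for z :: complex and r
  proof -
    define x y where "x = Re z" "y = Im z"
    have re: "exp x * cos y - 1 = - r * x" and ims: "exp x * sin y = - r * y"
      using arg_cong[OF ez, of Re] arg_cong[OF ez, of Im] by (simp_all add: x_y_def Re_exp Im_exp)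
    have "y \<noteq> 0"
    proof
      assume y: "y = 0"
      hence "exp x - 1 = - r * x" using re by simp
      moreover have "x \<noteq> 0" using y z by (auto simp: x_y_def complex_eq_iff)
      hence "x > 0 \<and> exp x > 1 \<and> r * x > 0 \<or> x < 0 \<and> exp x < 1 \<and> r * x < 0"
        using r by (cases "x > 0") (auto simp: mult_pos_neg)
      moreover have "exp x - 1 = - (r * x)" using \<open>exp x - 1 = - r * x\<close> by simp
      ultimately show False by argo
    qed
    hence y0: "y > 0" using im by (simp add: x_y_def)
    have n: "x\<^sup>2 + y\<^sup>2 \<le> (3 * pi / 2)\<^sup>2"
      using power_mono[OF z(1) norm_ge_zero, of 2] unfolding cmod_power2 x_y_def .
    hence "y\<^sup>2 \<le> (3 * pi / 2)\<^sup>2" using zero_le_power2[of x] by linarith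
    hence y1: "y \<le> 3 * pi / 2" by (rule power2_le_imp_le) simp
    have "sin y < 0"
    proof -
      have "exp x * sin y < 0" using ims r y0 by (simp add: mult_pos_pos)
      thus ?thesis by (simp add: mult_less_0_iff)
    qed
    hence y2: "y > pi" using sin_ge_zero[of y] y0 by linarith
    define u where "u = 3 * pi / 2 - y"
    have u: "0 \<le> u" "u < pi / 2" using y1 y2 by (simp_all add: u_def)
    have y: "y = 3 * pi / 2 - u" by (simp add: u_def)
    have "3 * pi / 2 = 3 / 2 * pi" by simp
    hence y32: "y = 3 / 2 * pi - u" using y by simp
    have sy: "sin y = - cos u" unfolding y32 by (simp only: sin_diff sin_3over2_pi cos_3over2_pi, simp?)
    have cy: "cos y = - sin u" unfolding y32 by (simp only: cos_diff sin_3over2_pi cos_3over2_pi, simp?)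
    have cu: "cos u > 0" using u by (intro cos_gt_zero_pi) auto
    have "r * y = exp x * cos u" using ims sy by simp
    moreover have "r * x = exp x * sin u + 1" using re cy by simp
    ultimately have "exp x * (x * cos u) = y * (exp x * sin u + 1)" by (metis mult.commute mult.left_commute)
    also have "\<dots> = exp x * (y * (sin u + exp (- x)))" by (simp add: exp_minus field_simps)
    finally have eq: "x * cos u = y * (sin u + exp (- x))" by simp
    have su: "sin u \<ge> u * cos u"
      using abs_tan_ge[of u] u cu tan_gt_zero[of u] by (cases "u = 0") (auto simp: tan_def field_simps)
    have ec: "exp (- x) * cos u \<le> exp (- x)" by (intro mult_left_le) auto
    have "y * (u * cos u + exp (- x) * cos u) \<le> y * (sin u + exp (- x))"
      using mult_left_mono[OF add_mono[OF su ec], of y] y0 by simp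
    hence "(y * u + y * exp (- x)) * cos u \<le> x * cos u" unfolding eq by (simp add: algebra_simps)
    hence xle: "y * u + y * exp (- x) \<le> x" using cu by simp
    \<comment> \<open>The disc condition bounds \<open>x ^ 2\<close> by
      \<open>u * (3 * pi - u)\<close>, and \<open>u < pi / 2\<close> bounds this by
      \<open>5 / 2 * (y * u)\<close>. So \<open>xle\<close> gives
      \<open>0.4 * x ^ 2 + pi * exp (- x) \<le> x\<close>, against
      \<open>exp_neg_quadratic\<close>.\<close>
    have "x\<^sup>2 \<le> u * (3 * pi - u)" using n unfolding y by (simp add: power2_eq_square algebra_simps)
    moreover have "2 * (u * (3 * pi - u)) \<le> 5 * (y * u)"
    proof -
      have "u * (2 * (3 * pi - u)) \<le> u * (5 * y)" using u unfolding y by (intro mult_left_mono) auto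
      thus ?thesis by (simp add: algebra_simps)
    qed
    moreover have "3.1415 * exp (- x) \<le> y * exp (- x)"
      using y2 pi_approx by (intro mult_right_mono) auto
    ultimately show False using xle exp_neg_quadratic[of x] by simp
  qed
  from neg obtain t where t: "t \<le> 0" "z / (exp z - 1) = of_real t" by (auto simp: complex_nonpos_Reals_iff complex_eq_iff)
  have "t \<noteq> 0" using t z nz by auto
  hence t0: "t < 0" using t by simp
  have ez: "exp z - 1 = - of_real (- 1 / t) * z" using t(2) nz t0 by (simp add: field_simps)
  show False
  proof (cases "Im z \<ge> 0")
    case True
    thus ?thesis using main[OF _ ez z] t0 by (simp add: divide_less_0_iff zero_less_divide_iff)
  next
    case False
    have "exp (cnj z) - 1 = - of_real (- 1 / t) * cnj z"
      using arg_cong[OF ez, of cnj] by (simp add: exp_cnj)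
    thus ?thesis using main[of "- 1 / t" "cnj z"] t0 z False by (simp add: zero_less_divide_iff)
  qed
qed

text \<open>For \<open>m' > m\<close> the map \<open>G = F / (2 * m' - F)\<close> sends the half
  plane Re < m' into the unit disc, so the Schwarz lemma gives \<open>norm g \<le> s\<close> for its
  value \<open>g\<close> at \<open>s\<close>. Solving for \<open>F\<close> leaves
  \<open>Re (1 / (1 + g))\<close>, which is smallest at \<open>g = s\<close>. The slack
  \<open>m' - m\<close> keeps the modulus strictly below 1 even if \<open>m = 0\<close>; it is
  removed at the end.\<close>

lemma Borel_Caratheodory_radial:
  assumes F: "F holomorphic_on ball 0 R" "F 0 = 0" and r: "0 < r" "r < R"
    and m: "\<And>z. norm z = r \<Longrightarrow> Re (F z) \<le> m" and z: "norm z = r" and s: "0 \<le> s" "s \<le> 1"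
  shows "Re (F (of_real s * z)) \<le> 2 * s / (1 + s) * m"
proof (cases "s = 1")
  case True
  thus ?thesis using m[OF z] by simp
next
  case False
  hence s1: "s < 1" using s by simp
  have le: "Re (F z) \<le> m" if "norm z \<le> r" for z
  proof (rule maximum_real_frontier[of F "cball 0 r"])
    show "continuous_on (closure (cball 0 r)) F"
      using F r by (auto intro!: holomorphic_on_imp_continuous_on elim: holomorphic_on_subset)
  qed (use F r m that in \<open>auto elim: holomorphic_on_subset\<close>)
  have m0: "0 \<le> m" using le[of 0] F r by simp
  have *: "Re (F (of_real s * z)) \<le> 2 * s / (1 + s) * m'" if m': "m < m'" for m'
  proof -
    have m'0: "m' > 0" using m0 m' by simp
    define G where "G = (\<lambda>\<zeta>. F (\<zeta> * z) / (of_real (2 * m') - F (\<zeta> * z)))"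
    have small: "norm (\<zeta> * z) \<le> r" if "norm \<zeta> < 1" for \<zeta>
      using that z r by (simp add: norm_mult mult_left_le_one_le)
    have nz: "of_real (2 * m') - F (\<zeta> * z) \<noteq> 0" if "norm \<zeta> < 1" for \<zeta>
    proof
      assume "of_real (2 * m') - F (\<zeta> * z) = 0"
      hence "Re (F (\<zeta> * z)) = 2 * m'" by (metis Re_complex_of_real eq_iff_diff_eq_0)
      thus False using le[OF small[OF that]] m' m'0 by simp
    qed
    have "(\<lambda>\<zeta>. F (\<zeta> * z)) holomorphic_on ball 0 1"
    proof -
      have "(F \<circ> (\<lambda>\<zeta>. \<zeta> * z)) holomorphic_on ball 0 1"
        using small r by (intro holomorphic_on_compose_gen[OF _ F(1)] holomorphic_intros) force+
      thus ?thesis by (simp add: o_def)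
    qed
    hence "G holomorphic_on ball 0 1" unfolding G_def using nz by (intro holomorphic_intros) auto
    moreover have "G 0 = 0" using F by (simp add: G_def)
    moreover have "norm (G \<zeta>) < 1" if "norm \<zeta> < 1" for \<zeta>
    proof -
      define v where "v = F (\<zeta> * z)"
      have "Re v < m'" using le[OF small[OF that]] m' by (simp add: v_def)
      hence "0 < 4 * m' * (m' - Re v)" using m'0 by simp
      hence "(norm v)\<^sup>2 < (norm (of_real (2 * m') - v))\<^sup>2"
        unfolding cmod_power2 by (simp add: power2_eq_square algebra_simps)
      hence "norm v < norm (of_real (2 * m') - v)" by (rule power2_less_imp_less) simp
      moreover from this have "0 < norm (of_real (2 * m') - v)" using norm_ge_zero[of v] by linarith
      ultimately show ?thesis by (simp add: G_def norm_divide flip: v_def)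
    qed
    ultimately have "norm (G (of_real s)) \<le> norm (of_real s :: complex)"
      using s s1 by (intro Schwarz_Lemma(1)) auto
    hence g: "norm (G (of_real s)) \<le> s" using s by simp
    define g where "g = G (of_real s)"
    define v where "v = F (of_real s * z)"
    have "norm (of_real s :: complex) < 1" using s s1 by simp
    from nz[OF this] have vn: "of_real (2 * m') - v \<noteq> 0" by (simp add: v_def)
    have g1: "1 + g \<noteq> 0"
    proof
      assume "1 + g = 0"
      hence "norm g = 1" by (metis add_eq_0_iff norm_minus_cancel norm_one)
      thus False using g s1 by (simp add: g_def)
    qed
    have "g * (of_real (2 * m') - v) = v" using vn by (simp add: g_def G_def v_def)
    hence "v * (1 + g) = of_real (2 * m') * g" by (simp add: algebra_simps)
    hence v: "v = of_real (2 * m') * (1 - 1 / (1 + g))" using g1 by (simp add: field_simps)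
    have "1 / (1 + s) \<le> Re (1 / (1 + g))"
    proof -
      have "(Re g)\<^sup>2 + (Im g)\<^sup>2 \<le> s\<^sup>2" using power_mono[OF g norm_ge_zero, of 2] by (simp add: cmod_power2 g_def)
      moreover have "Re g \<le> s" using complex_Re_le_cmod[of g] g by (simp add: g_def)
      hence "0 \<le> (1 - s) * (s - Re g)" using s by simp
      ultimately have "(norm (1 + g))\<^sup>2 \<le> (1 + Re g) * (1 + s)"
        unfolding cmod_power2 by (simp add: power2_eq_square algebra_simps)
      moreover have "0 < (norm (1 + g))\<^sup>2" using g1 by simp
      moreover have "Re (1 / (1 + g)) = (1 + Re g) / (norm (1 + g))\<^sup>2"
        by (simp add: Re_divide cmod_power2)
      moreover have "1 / (1 + s) \<le> a / N" if "N \<le> a * (1 + s)" "0 < N" for a N :: real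
        using that s by (simp add: divide_simps)
      ultimately show ?thesis by simp
    qed
    hence "2 * m' * (1 - Re (1 / (1 + g))) \<le> 2 * m' * (1 - 1 / (1 + s))"
      using m'0 by (intro mult_left_mono) auto
    also have "\<dots> = 2 * s / (1 + s) * m'" using s by (simp add: field_simps)
    finally show ?thesis unfolding v_def[symmetric] v by simp
  qed
  show ?thesis
  proof (rule field_le_epsilon)
    fix e :: real assume e: "e > 0"
    have "Re (F (of_real s * z)) \<le> 2 * s / (1 + s) * (m + e)" using *[of "m + e"] e by simp
    also have "\<dots> \<le> 2 * s / (1 + s) * m + 1 * e"
      unfolding distrib_left using s e by (intro add_left_mono mult_right_mono) auto
    finally show "Re (F (of_real s * z)) \<le> 2 * s / (1 + s) * m + e" by simp
  qed
qed

section \<open>The holomorphic branch and its maxima on the circle of radius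
  \<open>3 * pi / 2\<close>\<close>

lemma cball_subset_ball_2pi: "cball 0 (3 * pi / 2) \<subseteq> ball (0::complex) (2 * pi)"
proof
  fix z :: complex assume "z \<in> cball 0 (3 * pi / 2)"
  hence "norm z \<le> 3 * pi / 2" by simp
  also have "\<dots> < 2 * pi" using pi_gt_zero by linarith
  finally show "z \<in> ball 0 (2 * pi)" by simp
qed

locale log_branch =
  fixes H :: "complex \<Rightarrow> complex"
  assumes H_hol: "H holomorphic_on ball 0 (2 * pi)" and H_0: "H 0 = 0"
    and exp_H: "z \<in> ball 0 (2 * pi) \<Longrightarrow> z \<noteq> 0 \<Longrightarrow> exp (H z) = z / (exp z - 1)"
begin

text \<open>The absolute value of the imaginary part of \<open>H\<close> starts at 0 and cannot pass
  \<pi> on the connected disc, since the value \<pi> would make \<open>z / (exp z - 1)\<close> a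
  negative real number. Thus the principal powers in \<open>C_const\<close> agree with the continued
  ones.\<close>

lemma Ln_eq_H:
  assumes z: "norm z \<le> 3 * pi / 2" "z \<noteq> 0"
  shows "Ln (z / (exp z - 1)) = H z"
proof -
  note sub = cball_subset_ball_2pi
  have no: "exp (H w) \<notin> \<real>\<^sub>\<le>\<^sub>0" if "norm w \<le> 3 * pi / 2" for w
    using exp_H[of w] exp_quotient_not_neg[of w] that sub H_0 by (cases "w = 0") auto
  have ne: "\<bar>Im (H w)\<bar> \<noteq> pi" if "norm w \<le> 3 * pi / 2" for w
  proof
    assume "\<bar>Im (H w)\<bar> = pi"
    hence c: "cos (Im (H w)) = - 1" by (metis cos_abs_real cos_pi)
    moreover have "sin (Im (H w)) = 0" using sin_cos_squared_add[of "Im (H w)"] c by simp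
    ultimately have "exp (H w) = - of_real (exp (Re (H w)))"
      by (simp add: complex_eq_iff Re_exp Im_exp)
    hence "exp (H w) \<in> \<real>\<^sub>\<le>\<^sub>0" by (simp add: complex_nonpos_Reals_iff)
    thus False using no[OF that] by simp
  qed
  have "continuous_on (cball 0 (3 * pi / 2)) (\<lambda>w. \<bar>Im (H w)\<bar>)"
    using holomorphic_on_imp_continuous_on[OF holomorphic_on_subset[OF H_hol sub]]
    by (intro continuous_intros)
  hence "connected ((\<lambda>w. \<bar>Im (H w)\<bar>) ` cball 0 (3 * pi / 2))"
    by (intro connected_continuous_image convex_connected convex_cball)
  moreover have "0 \<in> (\<lambda>w. \<bar>Im (H w)\<bar>) ` cball 0 (3 * pi / 2)"
    using H_0 pi_gt_zero by (intro image_eqI[of _ _ 0]) auto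
  moreover have "\<bar>Im (H z)\<bar> \<in> (\<lambda>w. \<bar>Im (H w)\<bar>) ` cball 0 (3 * pi / 2)"
    using z by (intro image_eqI[of _ _ z]) auto
  ultimately have "pi \<in> (\<lambda>w. \<bar>Im (H w)\<bar>) ` cball 0 (3 * pi / 2)" if "pi \<le> \<bar>Im (H z)\<bar>"
    using pi_ge_zero that by (rule connectedD_interval)
  hence "\<not> pi < \<bar>Im (H z)\<bar>" using ne by fastforce
  hence "\<bar>Im (H z)\<bar> < pi" using ne[OF z(1)] by linarith
  hence "Ln (exp (H z)) = H z" by (intro Ln_exp) auto
  thus ?thesis using exp_H[of z] z sub by auto
qed

lemma powr_eq_exp_H:
  assumes z: "norm z \<le> 3 * pi / 2" "z \<noteq> 0"
  shows "(z / (exp z - 1)) powr c = exp (c * H z)"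
proof -
  have "z / (exp z - 1) \<noteq> 0" using exp_neq_1_disc[of z] z pi_gt_zero by auto
  thus ?thesis by (simp add: powr_def Ln_eq_H[OF z])
qed

text \<open>The exponent of the generating function: \<open>exp (E b c z)\<close> is the analytic
  continuation of \<open>bernoulli_gf c b z\<close> to the disc of radius
  \<open>2 * pi\<close>.\<close>

definition E :: "complex \<Rightarrow> complex \<Rightarrow> complex \<Rightarrow> complex" where
  "E b c z = b * z + c * H z"

definition S :: "complex \<Rightarrow> complex \<Rightarrow> real" where
  "S b c = (SUP z\<in>sphere 0 (3 * pi / 2). norm (exp (E b c z)))"

lemma E_holomorphic: "E b c holomorphic_on ball 0 (2 * pi)"
  unfolding E_def by (intro holomorphic_intros H_hol)

lemma E_0 [simp]: "E b c 0 = 0"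
  by (simp add: E_def H_0)

lemma norm_exp_E_le:
  assumes "norm z = 3 * pi / 2"
  shows "norm (exp (E b c z)) \<le> S b c"
  unfolding S_def
proof (rule cSUP_upper)
  have "sphere 0 (3 * pi / 2) \<subseteq> ball (0::complex) (2 * pi)"
    using sphere_cball cball_subset_ball_2pi by blast
  hence "continuous_on (sphere 0 (3 * pi / 2)) (\<lambda>z. norm (exp (E b c z)))"
    using holomorphic_on_imp_continuous_on[OF holomorphic_on_subset[OF E_holomorphic]]
    by (intro continuous_intros) auto
  hence "compact ((\<lambda>z. norm (exp (E b c z))) ` sphere 0 (3 * pi / 2))"
    by (intro compact_continuous_image) auto
  thus "bdd_above ((\<lambda>z. norm (exp (E b c z))) ` sphere 0 (3 * pi / 2))"
    by (intro bounded_imp_bdd_above compact_imp_bounded)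
qed (use assms in simp)

lemma S_pos: "0 < S b c"
proof -
  have "0 < norm (exp (E b c (of_real (3 * pi / 2))))" unfolding zero_less_norm_iff by (rule exp_not_eq_zero)
  also have "\<dots> \<le> S b c" by (rule norm_exp_E_le) (simp add: norm_mult)
  finally show ?thesis .
qed

lemma Re_E_le:
  assumes "norm z = 3 * pi / 2"
  shows "Re (E b c z) \<le> ln (S b c)"
  using norm_exp_E_le[OF assms, of b c] S_pos by (simp add: ln_ge_iff)

lemma Re_E_radial_le:
  assumes "norm z = 3 * pi / 2" "0 \<le> s" "s \<le> 1"
  shows "Re (E b c (of_real s * z)) \<le> 2 * s / (1 + s) * ln (S b c)"
proof (rule Borel_Caratheodory_radial[OF E_holomorphic])
  show "3 * pi / 2 < 2 * pi" using pi_gt_zero by linarith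
qed (use assms Re_E_le in simp_all)

text \<open>The exponent vanishes at the centre, so by the maximum principle its real part cannot be
  negative on the whole circle.\<close>

lemma ln_S_nonneg: "0 \<le> ln (S b c)"
proof -
  have "Re (E b c 0) \<le> ln (S b c)"
  proof (rule maximum_real_frontier[of "E b c" "cball 0 (3 * pi / 2)"])
    note sub = cball_subset_ball_2pi
    show "continuous_on (closure (cball 0 (3 * pi / 2))) (E b c)"
      using holomorphic_on_imp_continuous_on[OF holomorphic_on_subset[OF E_holomorphic sub]] by simp
    show "E b c holomorphic_on interior (cball 0 (3 * pi / 2))"
      using sub by (intro holomorphic_on_subset[OF E_holomorphic]) auto
  qed (use Re_E_le in auto)
  thus ?thesis by simp
qed

lemma C_const_eq:
  "C_const \<alpha> \<beta> = S (\<alpha> - \<beta>) (- \<alpha> - \<beta>) * S 0 (- \<alpha> + \<beta> + 1) * S 0 (2 * \<alpha>)"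
proof -
  have "norm (exp (z * b) * (z / (exp z - 1)) powr c) = norm (exp (E b c z))"
    if "z \<in> sphere 0 (3 * pi / 2)" for z b c
  proof -
    have "z \<noteq> 0" using that by auto
    moreover have "norm z \<le> 3 * pi / 2" using that by simp
    ultimately show ?thesis by (simp only: E_def powr_eq_exp_H exp_add mult.commute[of z b] not_False_eq_True)
  qed
  note 1 = this and 2 = this[of _ 0, unfolded mult_zero_right exp_zero mult_1_left]
  show ?thesis unfolding C_const_def S_def
    by (intro arg_cong2[of _ _ _ _ "(*)"] SUP_cong refl 1 2) auto
qed

definition f :: "complex \<Rightarrow> complex \<Rightarrow> real \<Rightarrow> complex \<Rightarrow> complex" where
  "f a b s z = exp (E b (1 - a) (of_real s * z)) * exp (E 0 (1 - b) (of_real (1 - s) * z)) * exp (E 0 (a + b - 1) z)"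

text \<open>The first two factors of \<open>f\<close> are evaluated at the interior points
  \<open>s * z\<close> and \<open>(1 - s) * z\<close>, where \<open>Re_E_radial_le\<close> improves
  on the maximum; the third is evaluated on the circle itself. The identity
  \<open>2 * s / (1 + s) = 1 - (1 - s) / (1 + s)\<close> isolates the improvement.\<close>

lemma norm_f_le:
  assumes "norm z = 3 * pi / 2" "0 \<le> s" "s \<le> 1"
  shows "norm (f a b s z) \<le> S b (1 - a) * S 0 (1 - b) * S 0 (a + b - 1) *
    exp (- ln (S b (1 - a)) * ((1 - s) / (1 + s)) - ln (S 0 (1 - b)) * (s / (2 - s)))"
proof -
  define m1 m2 where "m1 = ln (S b (1 - a))" "m2 = ln (S 0 (1 - b))"
  have m: "S b (1 - a) = exp m1" "S 0 (1 - b) = exp m2" using S_pos by (simp_all add: m1_m2_def)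
  have "norm (f a b s z) = exp (Re (E b (1 - a) (of_real s * z))) * exp (Re (E 0 (1 - b) (of_real (1 - s) * z))) * norm (exp (E 0 (a + b - 1) z))"
    by (simp add: f_def norm_mult)
  also have "\<dots> \<le> exp (2 * s / (1 + s) * m1) * exp (2 * (1 - s) / (1 + (1 - s)) * m2) * S 0 (a + b - 1)"
    unfolding m1_m2_def using assms
    by (intro mult_mono norm_exp_E_le exp_le_cancel_iff[THEN iffD2] Re_E_radial_le) auto
  also have "\<dots> = exp (m1 + (- m1 * ((1 - s) / (1 + s)))) * exp (m2 - m2 * (s / (2 - s))) * S 0 (a + b - 1)"
  proof -
    have "2 * s / (1 + s) * m1 = m1 + (- m1 * ((1 - s) / (1 + s)))" "2 * (1 - s) / (1 + (1 - s)) * m2 = m2 - m2 * (s / (2 - s))"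
      using assms by (simp_all add: field_simps)
    thus ?thesis by simp
  qed
  finally show ?thesis unfolding m1_m2_def[symmetric] m by (simp add: exp_add exp_diff exp_minus field_simps)
qed

end

section \<open>Lower bounds for the logarithms of the maxima\<close>

lemma three_half_pi_bounds: "4.712 \<le> 3 * pi / 2" "3 * pi / 2 \<le> 4.7124"
proof -
  have "4.712 \<le> 3 * 3.1415 / (2::real)" by simp
  also have "\<dots> \<le> 3 * pi / 2" using pi_approx by (intro divide_right_mono mult_left_mono) auto
  finally show "4.712 \<le> 3 * pi / 2" .
  have "3 * pi / 2 \<le> 3 * 3.1416 / 2" using pi_approx by (intro divide_right_mono mult_left_mono) auto
  also have "\<dots> \<le> 4.7124" by simp
  finally show "3 * pi / 2 \<le> 4.7124" .
qed

lemma exp_one_bounds: "2.718281 \<le> exp (1::real)" "exp (1::real) \<le> 2.718282"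
proof -
  have "\<bar>exp 1 - 5837465777 / 2147483648\<bar> \<le> (1 / 10 ^ 9 :: real)"
    by (rule order_trans[OF e_approx_32]) simp
  thus "2.718281 \<le> exp (1::real)" "exp (1::real) \<le> 2.718282"
    unfolding abs_le_iff by simp_all
qed

text \<open>The Taylor polynomial bounds \<open>exp\<close> only from below, so the upper bound
  comes from \<open>exp 1.55 * exp 0.45 = exp 1 * exp 1\<close>. The next estimate uses
  \<open>2.406 + 0.594 = 3\<close> in the same way.\<close>

lemma exp_155_le: "exp 1.55 \<le> (4.712 :: real)"
proof -
  have "1.5683 \<le> exp_lower 0.45" by (simp add: exp_lower_def)
  hence "1.5683 \<le> exp (0.45 :: real)" using exp_lower_le[of "0.45"] by simp
  hence "exp 1.55 * 1.5683 \<le> exp 1.55 * exp (0.45 :: real)" by (intro mult_left_mono) auto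
  also have "\<dots> = exp 1 * exp 1" by (simp flip: exp_add)
  also have "\<dots> \<le> 2.718282 * 2.718282" by (intro mult_mono exp_one_bounds) auto
  finally show ?thesis by simp
qed

lemma exp_2406_le: "exp 2.406 \<le> (4.712\<^sup>2 / 2 :: real)"
proof -
  have "1.811 \<le> exp_lower 0.594" by (simp add: exp_lower_def)
  hence "1.811 \<le> exp (0.594 :: real)" using exp_lower_le[of "0.594"] by simp
  hence "exp 2.406 * 1.811 \<le> exp 2.406 * exp (0.594 :: real)" by (intro mult_left_mono) auto
  also have "\<dots> = exp 1 * exp 1 * exp 1" by (simp flip: exp_add)
  also have "\<dots> \<le> 2.718282 * 2.718282 * 2.718282" by (intro mult_mono exp_one_bounds) auto
  finally show ?thesis by (simp add: power2_eq_square)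
qed

lemma ln_rho_ge: "1.55 \<le> ln (3 * pi / 2)"
proof -
  have "exp 1.55 \<le> 3 * pi / 2" using exp_155_le three_half_pi_bounds by linarith
  thus ?thesis by (subst ln_ge_iff) auto
qed

lemma ln_rho_sqrt2_ge: "1.203 \<le> ln (3 * pi / 2 / sqrt 2)"
proof -
  have "(exp 1.203)\<^sup>2 \<le> exp (2.406 :: real)" by (simp add: power2_eq_square flip: exp_add)
  also have "\<dots> \<le> 4.712\<^sup>2 / 2" by (rule exp_2406_le)
  also have "\<dots> \<le> (3 * pi / 2)\<^sup>2 / 2" by (intro divide_right_mono power_mono three_half_pi_bounds) auto
  also have "\<dots> = (3 * pi / 2 / sqrt 2)\<^sup>2" by (simp add: power_divide)
  finally have "exp 1.203 \<le> 3 * pi / 2 / sqrt 2" by (rule power2_le_imp_le) simp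
  thus ?thesis by (subst ln_ge_iff) auto
qed

lemma ln_real_point_bounds:
  "- 3.163 \<le> ln (3 * pi / 2 / (exp (3 * pi / 2) - 1))" "ln (3 * pi / 2 / (exp (3 * pi / 2) - 1)) \<le> - 3.14"
proof -
  define r where "r = 3 * pi / 2"
  have r: "4.712 \<le> r" "r \<le> 4.7124" "0 < r" using three_half_pi_bounds by (simp_all add: r_def)
  have e1: "1 < exp r" using r by simp
  have ln: "ln (r / (exp r - 1)) = ln r - ln (exp r - 1)" using r e1 by (simp add: ln_div)
  have "ln (exp r - 1) \<le> ln (exp r)" using e1 by (subst ln_le_cancel_iff) auto
  thus "- 3.163 \<le> ln (3 * pi / 2 / (exp (3 * pi / 2) - 1))"
    using ln ln_rho_ge r by (simp add: r_def)
  \<comment> \<open>Since \<open>r\<close> exceeds \<open>1.57 + 3.14\<close>, and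
    \<open>exp 1.57\<close> exceeds \<open>r\<close> by enough that the excess times
    \<open>exp 3.14\<close> covers the summand 1.\<close>
  have "r * exp 3.14 + 1 \<le> exp r"
  proof -
    have "4.8 \<le> exp_lower 1.57" "20 \<le> exp_lower 3" by (simp_all add: exp_lower_def)
    hence 1: "4.8 \<le> exp (1.57::real)" "20 \<le> exp (3::real)"
      using exp_lower_le[of "1.57"] exp_lower_le[of 3] by simp_all
    have "20 \<le> exp (3.14::real)" using order_trans[OF 1(2), of "exp 3.14"] by simp
    moreover have "10000 * (r * exp 3.14) \<le> 47124 * exp 3.14" using r by (simp add: field_simps)
    moreover have "48 * exp (3.14::real) \<le> 10 * (exp 1.57 * exp 3.14)" using 1 by simp
    moreover have "exp 1.57 * exp 3.14 \<le> exp r" using r by (simp flip: exp_add)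
    ultimately show ?thesis by linarith
  qed
  hence "r / (exp r - 1) \<le> exp (- 3.14)" using e1 by (simp add: exp_minus field_simps)
  hence "ln (r / (exp r - 1)) \<le> ln (exp (- 3.14))" using r e1 by (subst ln_le_cancel_iff) auto
  thus "ln (3 * pi / 2 / (exp (3 * pi / 2) - 1)) \<le> - 3.14" by (simp add: r_def)
qed

context log_branch
begin

lemma H_of_real:
  assumes "r \<noteq> 0" "\<bar>r\<bar> \<le> 3 * pi / 2"
  shows "H (of_real r) = of_real (ln (r / (exp r - 1)))"
proof -
  have p: "r / (exp r - 1) > 0"
    using assms by (cases "r > 0") (auto simp: zero_less_divide_iff)
  have "Ln (of_real (r / (exp r - 1))) = of_real (ln (r / (exp r - 1)))"
    using p by (rule Ln_of_real)
  thus ?thesis using Ln_eq_H[of "of_real r"] assms by (simp add: exp_of_real)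
qed

lemma H_cnj:
  assumes "norm z \<le> 3 * pi / 2" "z \<noteq> 0"
  shows "H (cnj z) = cnj (H z)"
proof -
  have "z / (exp z - 1) \<noteq> 0" using exp_neq_1_disc[of z] assms cball_subset_ball_2pi by auto
  hence "cnj (Ln (z / (exp z - 1))) = Ln (cnj (z / (exp z - 1)))"
    using exp_quotient_not_neg[OF assms] by (intro cnj_Ln) auto
  thus ?thesis using Ln_eq_H[OF assms] Ln_eq_H[of "cnj z"] assms by (simp add: exp_cnj)
qed

lemma Re_H_imaginary_point: "Re (H (\<i> * of_real (3 * pi / 2))) = ln (3 * pi / 2 / sqrt 2)"
proof -
  define z where "z = \<i> * of_real (3 * pi / 2)"
  have z: "norm z = 3 * pi / 2" "z \<noteq> 0" by (simp_all add: z_def norm_mult)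
  have "cos (3 * pi / 2) = 0" "sin (3 * pi / 2) = - 1"
    using cos_3over2_pi sin_3over2_pi by (simp_all add: field_simps)
  hence e: "exp z = - \<i>" unfolding z_def by (simp add: complex_eq_iff Re_exp Im_exp)
  have "norm (- \<i> - 1) = sqrt 2" by (simp add: cmod_def)
  hence n: "norm (z / (exp z - 1)) = 3 * pi / 2 / sqrt 2" by (simp only: norm_divide z e)
  have "exp z \<noteq> 1" unfolding e by (simp add: complex_eq_iff)
  hence "z / (exp z - 1) \<noteq> 0" using z by simp
  hence "Re (Ln (z / (exp z - 1))) = ln (3 * pi / 2 / sqrt 2)" unfolding n[symmetric] by (rule Re_Ln)
  moreover have "Ln (z / (exp z - 1)) = H z" using z by (intro Ln_eq_H) auto
  ultimately show ?thesis unfolding z_def by simp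
qed

text \<open>Each bound evaluates the exponent at points of the circle. At the two imaginary points,
  where \<open>norm (exp z - 1) = sqrt 2\<close>, averaging cancels the contributions of the
  imaginary parts of the parameters. The positive real point gives the linear bound in Re b, with a
  constant depending on the sign of 1 - Re a, and the negative real point gives the bound for the
  factor without \<open>b\<close>.\<close>

lemma ln_S_ge:
  assumes y: "0 \<le> Re b"
  shows "1.203 * (1 - Re a) \<le> ln (S b (1 - a))"
    and "4.712 * Re b - 3.163 * (1 - Re a) \<le> ln (S b (1 - a)) \<or> 4.712 * Re b - 3.14 * (1 - Re a) \<le> ln (S b (1 - a))"
    and "1.298 * Re b \<le> ln (S b (1 - a))"
    and "1.55 * (1 - Re a) \<le> ln (S 0 (1 - a))"
proof -
  define m where "m = ln (S b (1 - a))"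
  define x y where "x = Re a" "y = Re b"
  define r where "r = 3 * pi / 2"
  have r: "4.712 \<le> r" "0 < r" using three_half_pi_bounds by (simp_all add: r_def)
  have m0: "0 \<le> m" unfolding m_def by (rule ln_S_nonneg)
  have "Re (E b (1 - a) (\<i> * of_real r)) \<le> m" "Re (E b (1 - a) (cnj (\<i> * of_real r))) \<le> m"
    unfolding m_def by (intro Re_E_le; simp add: r_def norm_mult)+
  moreover have "H (cnj (\<i> * of_real r)) = cnj (H (\<i> * of_real r))"
    using r by (intro H_cnj) (simp_all add: r_def norm_mult)
  ultimately have "Re (H (\<i> * of_real r)) * (1 - x) \<le> m"
    unfolding E_def x_y_def by (simp add: algebra_simps)
  hence p: "ln (3 * pi / 2 / sqrt 2) * (1 - x) \<le> m" unfolding r_def Re_H_imaginary_point .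
  show A: "1.203 * (1 - Re a) \<le> ln (S b (1 - a))"
  proof (cases "x \<le> 1")
    case True
    thus ?thesis using p mult_right_mono[OF ln_rho_sqrt2_ge, of "1 - x"] by (simp add: x_y_def m_def)
  next
    case False
    thus ?thesis using m0 by (simp add: x_y_def m_def)
  qed
  have "Re (E b (1 - a) (of_real r)) \<le> m"
    unfolding m_def by (intro Re_E_le) (simp add: r_def)
  moreover have "H (of_real r) = of_real (ln (3 * pi / 2 / (exp (3 * pi / 2) - 1)))"
    unfolding r_def by (rule H_of_real) auto
  ultimately have q: "r * y + ln (3 * pi / 2 / (exp (3 * pi / 2) - 1)) * (1 - x) \<le> m"
    unfolding E_def x_y_def by (simp add: algebra_simps)
  have B: "4.712 * Re b - 3.163 * (1 - Re a) \<le> m \<and> x \<le> 1 \<or> 4.712 * Re b - 3.14 * (1 - Re a) \<le> m \<and> x > 1"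
  proof (cases "x \<le> 1")
    case True
    have "- 3.163 * (1 - x) \<le> ln (3 * pi / 2 / (exp (3 * pi / 2) - 1)) * (1 - x)"
      using True ln_real_point_bounds by (intro mult_right_mono) auto
    moreover have "4.712 * y \<le> r * y" using r y by (intro mult_right_mono) (auto simp: x_y_def)
    ultimately have "4.712 * y - 3.163 * (1 - x) \<le> m" using q by linarith
    thus ?thesis using True by (simp add: x_y_def)
  next
    case False
    have "- 3.14 * (1 - x) \<le> ln (3 * pi / 2 / (exp (3 * pi / 2) - 1)) * (1 - x)"
      using False ln_real_point_bounds by (intro mult_right_mono_neg) auto
    moreover have "4.712 * y \<le> r * y" using r y by (intro mult_right_mono) (auto simp: x_y_def)
    ultimately have "4.712 * y - 3.14 * (1 - x) \<le> m" using q by linarith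
    thus ?thesis using False by (simp add: x_y_def)
  qed
  show "4.712 * Re b - 3.163 * (1 - Re a) \<le> ln (S b (1 - a)) \<or> 4.712 * Re b - 3.14 * (1 - Re a) \<le> ln (S b (1 - a))"
    using B by (auto simp: m_def)
  show "1.298 * Re b \<le> ln (S b (1 - a))"
  proof (cases "x \<le> 1")
    case True
    \<comment> \<open>Eliminating \<open>1 - x\<close> from these two inequalities yields the slope
      \<open>1.203 * 4.712 / (1.203 + 3.163)\<close>, which is slightly above
      \<open>1.298\<close>.\<close>
    have "1203 * (1 - x) \<le> 1000 * m" "4712 * y - 3163 * (1 - x) \<le> 1000 * m"
      using A B True by (auto simp: m_def x_y_def field_simps)
    hence "1298 * y \<le> 1000 * m" using y x_y_def by argo
    thus ?thesis by (simp add: m_def x_y_def)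
  next
    case False
    hence "3.14 * (1 - x) \<le> 0" by simp
    moreover have "4.712 * y - 3.14 * (1 - x) \<le> m" using B False by (auto simp: x_y_def)
    ultimately have "4.712 * y \<le> m" by linarith
    moreover have "1.298 * y \<le> 4.712 * y" using y by (simp add: x_y_def)
    ultimately show ?thesis by (simp add: m_def x_y_def)
  qed
  show "1.55 * (1 - Re a) \<le> ln (S 0 (1 - a))"
  proof (cases "x \<le> 1")
    case True
    have "Re (E 0 (1 - a) (of_real (- r))) \<le> ln (S 0 (1 - a))"
      by (intro Re_E_le) (simp add: r_def)
    moreover have "H (of_real (- r)) = of_real (ln (- r / (exp (- r) - 1)))"
      using r by (intro H_of_real) (auto simp: r_def)
    moreover have "ln r \<le> ln (- r / (exp (- r) - 1))"
    proof -
      have e: "exp (- r) < 1" using r by simp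
      have "- r / (exp (- r) - 1) = r / (1 - exp (- r))" by (metis minus_diff_eq minus_divide_divide)
      moreover have "r \<le> r / (1 - exp (- r))" using e r by (simp add: le_divide_eq mult_left_le)
      ultimately show ?thesis using r by (subst ln_le_cancel_iff) auto
    qed
    hence "1.55 \<le> ln (- r / (exp (- r) - 1))" using ln_rho_ge by (simp add: r_def)
    hence "1.55 * (1 - x) \<le> ln (- r / (exp (- r) - 1)) * (1 - x)" using True by (intro mult_right_mono) auto
    moreover have "ln (- r / (exp (- r) - 1)) * (1 - x) \<le> ln (S 0 (1 - a))"
      using calculation unfolding E_def x_y_def by (simp add: algebra_simps)
    ultimately show ?thesis unfolding x_y_def by linarith
  next
    case False
    hence "1.55 * (1 - Re a) \<le> 0" by (simp add: x_y_def)
    thus ?thesis using ln_S_nonneg order_trans by blast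
  qed
qed

end

section \<open>Complex Beta integrals\<close>

definition beta_density :: "complex \<Rightarrow> complex \<Rightarrow> real \<Rightarrow> complex" where
  "beta_density a b s = of_real s powr (a - 1) * of_real (1 - s) powr (b - 1)"

definition beta_functional :: "complex \<Rightarrow> complex \<Rightarrow> (real \<Rightarrow> complex) \<Rightarrow> complex" where
  "beta_functional a b g = integral {0..1} (\<lambda>s. beta_density a b s * g s)"

lemma norm_beta_density:
  assumes "0 \<le> s" "s \<le> 1"
  shows "norm (beta_density a b s) = s powr (Re a - 1) * (1 - s) powr (Re b - 1)"
proof -
  have *: "norm (of_real r powr c) = r powr Re c" if "0 \<le> r" for r and c :: complex
    using that norm_powr_real_powr[of "of_real r" c] by simp
  show ?thesis unfolding beta_density_def norm_mult using assms by (simp only: * diff_ge_0_iff_ge) simp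
qed

lemma continuous_on_beta_density: "continuous_on {0<..<1} (beta_density a b)"
  unfolding beta_density_def
  by (intro continuous_on_mult continuous_on_powr_complex continuous_on_const continuous_on_of_real
      continuous_on_diff continuous_on_id) auto

lemma beta_integrable:
  assumes ab: "0 < Re a" "0 < Re b" and g: "continuous_on {0..1} g"
  shows "(\<lambda>s. beta_density a b s * g s) integrable_on {0..1}"
proof -
  have "compact (g ` {0..1})" using g by (intro compact_continuous_image) auto
  then obtain B where B: "\<And>s. s \<in> {0..1} \<Longrightarrow> norm (g s) \<le> B"
    using compact_imp_bounded[of "g ` {0..1}"] unfolding bounded_iff by blast
  have "(\<lambda>s. beta_density a b s * g s) integrable_on {0<..<1}"
  proof (rule measurable_bounded_by_integrable_imp_integrable)
    have "continuous_on {0<..<1} (\<lambda>s. beta_density a b s * g s)"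
      by (intro continuous_on_mult continuous_on_beta_density continuous_on_subset[OF g]) auto
    thus "(\<lambda>s. beta_density a b s * g s) \<in> borel_measurable (lebesgue_on {0<..<1})"
      by (rule continuous_imp_measurable_on_sets_lebesgue) auto
    have "(\<lambda>s. s powr (Re a - 1) * (1 - s) powr (Re b - 1) * B) integrable_on {0..1}"
      using has_integral_Beta_real[OF ab] by (intro integrable_on_mult_left) auto
    thus "(\<lambda>s. s powr (Re a - 1) * (1 - s) powr (Re b - 1) * B) integrable_on {0<..<1}"
      by (simp add: integrable_on_Icc_iff_Ioo)
    fix s :: real assume "s \<in> {0<..<1}"
    thus "norm (beta_density a b s * g s) \<le> s powr (Re a - 1) * (1 - s) powr (Re b - 1) * B"
      unfolding norm_mult by (subst norm_beta_density) (auto intro!: mult_left_mono B)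
  qed auto
  thus ?thesis by (simp add: integrable_on_Icc_iff_Ioo)
qed

lemma beta_functional_diff:
  assumes "0 < Re a" "0 < Re b" "continuous_on {0..1} g" "continuous_on {0..1} h"
  shows "beta_functional a b (\<lambda>s. g s - h s) = beta_functional a b g - beta_functional a b h"
  unfolding beta_functional_def right_diff_distrib
  by (intro integral_diff beta_integrable assms)

lemma beta_functional_cmult: "beta_functional a b (\<lambda>s. c * g s) = c * beta_functional a b g"
proof -
  have "beta_functional a b (\<lambda>s. c * g s) = integral {0..1} (\<lambda>s. c * (beta_density a b s * g s))"
    unfolding beta_functional_def by (simp add: mult_ac)
  thus ?thesis by (simp add: beta_functional_def)
qed

lemma beta_functional_sum:
  assumes "0 < Re a" "0 < Re b" "finite A" "\<And>i. i \<in> A \<Longrightarrow> continuous_on {0..1} (g i)"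
  shows "beta_functional a b (\<lambda>s. \<Sum>i\<in>A. g i s) = (\<Sum>i\<in>A. beta_functional a b (g i))"
  unfolding beta_functional_def sum_distrib_left
  by (intro integral_sum beta_integrable assms)

lemma norm_beta_functional_le:
  assumes ab: "0 < Re a" "0 < Re b" and g: "continuous_on {0..1} g"
    and G: "((\<lambda>s. s powr (Re a - 1) * (1 - s) powr (Re b - 1) * G s) has_integral I) {0..1}"
    and le: "\<And>s. 0 \<le> s \<Longrightarrow> s \<le> 1 \<Longrightarrow> norm (g s) \<le> G s"
  shows "norm (beta_functional a b g) \<le> I"
proof -
  have "norm (beta_functional a b g) \<le> integral {0..1} (\<lambda>s. s powr (Re a - 1) * (1 - s) powr (Re b - 1) * G s)"
    unfolding beta_functional_def
  proof (rule integral_norm_bound_integral)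
    show "(\<lambda>s. s powr (Re a - 1) * (1 - s) powr (Re b - 1) * G s) integrable_on {0..1}"
      using G by blast
    fix s :: real assume "s \<in> {0..1}"
    thus "norm (beta_density a b s * g s) \<le> s powr (Re a - 1) * (1 - s) powr (Re b - 1) * G s"
      unfolding norm_mult by (subst norm_beta_density) (auto intro!: mult_left_mono le)
  qed (rule beta_integrable[OF ab g])
  thus ?thesis using G by (simp add: integral_unique)
qed

text \<open>Uniform convergence suffices: the tails are at most \<open>T N\<close> for every
  \<open>s\<close>, and the modulus of the density has the finite integral
  \<open>Beta (Re a) (Re b)\<close>.\<close>

lemma beta_functional_sums:
  assumes ab: "0 < Re a" "0 < Re b"
    and g: "\<And>m. continuous_on {0..1} (g m)" and h: "continuous_on {0..1} h"
    and M: "\<And>m s. 0 \<le> s \<Longrightarrow> s \<le> 1 \<Longrightarrow> norm (g m s) \<le> M m" "summable M"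
    and s: "\<And>s. 0 \<le> s \<Longrightarrow> s \<le> 1 \<Longrightarrow> (\<lambda>m. g m s) sums h s"
  shows "(\<lambda>m. beta_functional a b (g m)) sums beta_functional a b h"
proof -
  define T where "T = (\<lambda>N. \<Sum>m. M (m + N))"
  have tail: "norm (h s - (\<Sum>m<N. g m s)) \<le> T N" if "0 \<le> s" "s \<le> 1" for s N
  proof -
    have sM: "summable (\<lambda>m. M (m + N))" by (rule summable_ignore_initial_segment[OF M(2)])
    have le: "norm (g (m + N) s) \<le> M (m + N)" for m using M(1)[OF that] .
    have sm: "summable (\<lambda>m. norm (g (m + N) s))"
      by (rule summable_comparison_test'[OF sM, of 0]) (simp add: le)
    have "(\<lambda>m. g (m + N) s) sums (h s - (\<Sum>m<N. g m s))"
      using sums_split_initial_segment[OF s[OF that]] by simp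
    hence "h s - (\<Sum>m<N. g m s) = (\<Sum>m. g (m + N) s)" by (simp add: sums_iff)
    also have "norm \<dots> \<le> (\<Sum>m. norm (g (m + N) s))" by (rule summable_norm[OF sm])
    also have "\<dots> \<le> T N" unfolding T_def by (rule suminf_le[OF le sm sM])
    finally show ?thesis .
  qed
  have le: "norm (beta_functional a b h - (\<Sum>m<N. beta_functional a b (g m))) \<le> Beta (Re a) (Re b) * T N" for N
  proof -
    have "beta_functional a b h - (\<Sum>m<N. beta_functional a b (g m)) = beta_functional a b (\<lambda>s. h s - (\<Sum>m<N. g m s))"
    proof -
      have "continuous_on {0..1} (\<lambda>s. \<Sum>m<N. g m s)" by (intro continuous_on_sum g)
      thus ?thesis using beta_functional_diff[OF ab h] beta_functional_sum[OF ab, of "{..<N}" g] g by simp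
    qed
    also have "norm \<dots> \<le> Beta (Re a) (Re b) * T N"
    proof (rule norm_beta_functional_le[OF ab])
      show "((\<lambda>s. s powr (Re a - 1) * (1 - s) powr (Re b - 1) * T N) has_integral Beta (Re a) (Re b) * T N) {0..1}"
        using has_integral_Beta_real[OF ab] by (intro has_integral_mult_left) simp
      show "continuous_on {0..1} (\<lambda>s. h s - (\<Sum>m<N. g m s))"
        by (intro continuous_on_diff continuous_on_sum g h)
    qed (rule tail)
    finally show ?thesis .
  qed
  have lim: "(\<lambda>N. Beta (Re a) (Re b) * T N) \<longlonglongrightarrow> 0"
    unfolding T_def by (rule tendsto_mult_right_zero[OF suminf_exist_split2[OF M(2)]])
  have "(\<lambda>N. beta_functional a b h - (\<Sum>m<N. beta_functional a b (g m))) \<longlonglongrightarrow> 0"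
    by (rule Lim_null_comparison[OF always_eventually[OF allI[OF le]] lim])
  from tendsto_diff[OF tendsto_const[of "beta_functional a b h"] this]
  show ?thesis unfolding sums_def by simp
qed

text \<open>Integration of the derivative of \<open>t powr a * (1 - t) powr b\<close> along a curve \<open>t\<close> from 0 to 1. The
  logarithms \<open>h\<close> and \<open>k\<close> of \<open>t / z\<close> and \<open>(1 - t) / (1 - z)\<close> fix the branches.\<close>

lemma beta_curve_integral_0:
  assumes ab: "0 < Re a" "0 < Re b"
    and S: "open S" "of_real ` {0..1} \<subseteq> S"
    and h: "h holomorphic_on S" and k: "k holomorphic_on S"
    and t': "\<And>z. z \<in> S \<Longrightarrow> (t has_field_derivative t' z) (at z)"
    and th: "\<And>z. z \<in> S \<Longrightarrow> z * exp (h z) = t z"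
    and tk: "\<And>z. z \<in> S \<Longrightarrow> (1 - z) * exp (k z) = 1 - t z"
  shows "beta_functional a b (\<lambda>s. exp ((a - 1) * h (of_real s) + (b - 1) * k (of_real s)) * t' (of_real s)
    * (a - (a + b) * t (of_real s))) = 0"
proof -
  define G where "G = (\<lambda>z. z powr a * (1 - z) powr b * exp (a * h z + b * k z))"
  have dh: "(h has_field_derivative deriv h z) (at z)" and dk: "(k has_field_derivative deriv k z) (at z)" if "z \<in> S" for z
    using h k S(1) that by (auto intro: holomorphic_derivI)
  \<comment> \<open>Differentiating \<open>th\<close> and \<open>tk\<close> expresses
    \<open>t'\<close> in two ways. The derivative of \<open>G\<close> contains one part from the
    zero at 0 and one from the zero at 1; \<open>eh\<close> and \<open>ek\<close> turn both into
    multiples of the same \<open>t'\<close>.\<close>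
  have eh: "exp (h z) * (1 + z * deriv h z) = t' z" if z: "z \<in> S" for z
  proof (rule DERIV_unique)
    show "(t has_field_derivative exp (h z) * (1 + z * deriv h z)) (at z)"
      by (rule has_field_derivative_transform_within_open[OF _ S(1) z th])
         (auto intro!: derivative_eq_intros dh[OF z] simp: algebra_simps)
  qed (rule t'[OF z])
  have ek: "exp (k z) * (1 - (1 - z) * deriv k z) = t' z" if z: "z \<in> S" for z
  proof (rule DERIV_unique)
    have t: "1 - (1 - z) * exp (k z) = t z" if "z \<in> S" for z using tk[OF that] by simp
    show "(t has_field_derivative exp (k z) * (1 - (1 - z) * deriv k z)) (at z)"
      by (rule has_field_derivative_transform_within_open[OF _ S(1) z t])
         (auto intro!: derivative_eq_intros dk[OF z] simp: algebra_simps)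
  qed (rule t'[OF z])
  have "((\<lambda>s. beta_density a b s * (exp ((a - 1) * h (of_real s) + (b - 1) * k (of_real s)) * t' (of_real s)
      * (a - (a + b) * t (of_real s)))) has_integral (G (of_real 1) - G (of_real 0))) {0..1}"
  proof (rule fundamental_theorem_of_calculus_interior)
    have "continuous_on {0..1} (\<lambda>s. h (of_real s))" "continuous_on {0..1} (\<lambda>s. k (of_real s))"
      using h k S(2) by (auto intro!: continuous_on_compose2[of S _ "{0..1}" of_real]
        holomorphic_on_imp_continuous_on continuous_on_of_real continuous_on_id)
    moreover have "continuous_on {0..1} (\<lambda>s. of_real s powr a)" "continuous_on {0..1} (\<lambda>s. (1 - of_real s :: complex) powr b)"
      using ab by (auto intro!: continuous_on_powr_complex continuous_on_const continuous_on_of_real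
        continuous_on_diff continuous_on_id)
    ultimately show "continuous_on {0..1} (\<lambda>s. G (of_real s))"
      unfolding G_def
      by (intro continuous_on_mult continuous_on_exp continuous_on_add continuous_on_const)
    fix s :: real assume s: "s \<in> {0<..<1}"
    define z where "z = complex_of_real s"
    have zS: "z \<in> S" using S(2) s by (auto simp: z_def)
    have nz: "z \<noteq> 0" "1 - z \<noteq> 0" "z \<notin> \<real>\<^sub>\<le>\<^sub>0" "1 - z \<notin> \<real>\<^sub>\<le>\<^sub>0"
      using s by (auto simp: z_def complex_nonpos_Reals_iff complex_eq_iff)
    define P Q where "P = z powr (a - 1)" "Q = (1 - z) powr (b - 1)"
    have PQ: "z powr a = z * P" "(1 - z) powr b = (1 - z) * Q"
      using nz by (simp_all add: P_Q_def powr_diff)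
    have "(G has_field_derivative (a * P * ((1 - z) * Q) - z * P * (b * Q)
        + z * P * ((1 - z) * Q) * (a * deriv h z + b * deriv k z)) * exp (a * h z + b * k z)) (at z)"
    proof -
      have "((\<lambda>z. z powr a) has_field_derivative a * P) (at z)"
        unfolding P_Q_def by (rule has_field_derivative_powr[OF nz(3)])
      moreover have "((\<lambda>z. (1 - z) powr b) has_field_derivative b * Q * (- 1)) (at z)"
        unfolding P_Q_def by (rule DERIV_chain2[where f = "\<lambda>z. z powr b" and g = "\<lambda>z. 1 - z", OF has_field_derivative_powr[OF nz(4)]])
          (auto intro!: derivative_eq_intros)
      moreover have "((\<lambda>z. exp (a * h z + b * k z)) has_field_derivative
          exp (a * h z + b * k z) * (a * deriv h z + b * deriv k z)) (at z)"
        by (auto intro!: derivative_eq_intros dh[OF zS] dk[OF zS])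
      ultimately have "(G has_field_derivative
         ((a * P) * (1 - z) powr b + (b * Q * (- 1)) * z powr a) * exp (a * h z + b * k z) +
         (exp (a * h z + b * k z) * (a * deriv h z + b * deriv k z)) * (z powr a * (1 - z) powr b)) (at z)"
        unfolding G_def by (intro DERIV_mult)
      thus ?thesis unfolding PQ by (simp add: algebra_simps)
    qed
    also have "(a * P * ((1 - z) * Q) - z * P * (b * Q)
        + z * P * ((1 - z) * Q) * (a * deriv h z + b * deriv k z))
        = P * Q * (a * (1 - z) * (1 + z * deriv h z) - b * z * (1 - (1 - z) * deriv k z))"
      by (simp add: algebra_simps)
    also have "exp (a * h z + b * k z) = exp ((a - 1) * h z + (b - 1) * k z) * (exp (h z) * exp (k z))"
      by (simp add: algebra_simps flip: exp_add)
    also have "P * Q * (a * (1 - z) * (1 + z * deriv h z) - b * z * (1 - (1 - z) * deriv k z)) *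
        (exp ((a - 1) * h z + (b - 1) * k z) * (exp (h z) * exp (k z)))
      = P * Q * (exp ((a - 1) * h z + (b - 1) * k z) *
          (a * ((1 - z) * exp (k z)) * (exp (h z) * (1 + z * deriv h z))
            - b * (z * exp (h z)) * (exp (k z) * (1 - (1 - z) * deriv k z))))"
      by (simp add: algebra_simps)
    also have "\<dots> = P * Q * (exp ((a - 1) * h z + (b - 1) * k z) * t' z * (a - (a + b) * t z))"
      unfolding eh[OF zS] ek[OF zS] th[OF zS] tk[OF zS] by (simp add: algebra_simps)
    finally show "((\<lambda>s. G (of_real s)) has_vector_derivative beta_density a b s *
        (exp ((a - 1) * h (of_real s) + (b - 1) * k (of_real s)) * t' (of_real s) * (a - (a + b) * t (of_real s)))) (at s)"
      unfolding P_Q_def z_def beta_density_def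
      by (intro has_vector_derivative_real_field) simp
  qed simp
  moreover have "G (of_real 1) = 0" "G (of_real 0) = 0" by (simp_all add: G_def)
  ultimately show ?thesis by (simp add: beta_functional_def integral_unique)
qed

section \<open>Moments and total mass of the complex Beta density\<close>

lemma beta_functional_shift:
  "beta_functional a b (\<lambda>s. of_real s ^ i * of_real (1 - s) ^ j * g s) = beta_functional (a + of_nat i) (b + of_nat j) g"
proof -
  have "beta_density a b s * (of_real s ^ i * of_real (1 - s) ^ j * g s) =
      beta_density (a + of_nat i) (b + of_nat j) s * g s" if "s \<in> {0..1}" for s
  proof (cases "s = 0 \<or> s = 1")
    case False
    have "z powr (c - 1) * z ^ n = z powr (c + of_nat n - 1)" if "z \<noteq> 0" for z c :: complex and n
      using that by (simp add: powr_add powr_diff powr_nat)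
    from this[of "of_real s" a i] this[of "of_real (1 - s)" b j] False
    show ?thesis by (simp add: beta_density_def mult_ac)
  qed (auto simp: beta_density_def)
  thus ?thesis unfolding beta_functional_def by (intro integral_cong) auto
qed

lemma beta_functional_shift_one:
  "beta_functional (a + 1) b g = beta_functional a b (\<lambda>s. of_real s * g s)"
  "beta_functional a (b + 1) g = beta_functional a b (\<lambda>s. of_real (1 - s) * g s)"
  using beta_functional_shift[of a b 1 0 g] beta_functional_shift[of a b 0 1 g] by simp_all

text \<open>The case of the straight curve \<open>t z = z\<close>, with both logarithms equal to
  0.\<close>

lemma beta_integral_plus1_left:
  assumes "0 < Re a" "0 < Re b"
  shows "(a + b) * beta_functional (a + 1) b (\<lambda>_. 1) = a * beta_functional a b (\<lambda>_. 1)"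
proof -
  have "beta_functional a b (\<lambda>s. exp ((a - 1) * 0 + (b - 1) * 0) * 1 * (a - (a + b) * of_real s)) = 0"
    by (rule beta_curve_integral_0[where S = UNIV and h = "\<lambda>_. 0" and k = "\<lambda>_. 0" and t' = "\<lambda>_. 1" and t = "\<lambda>z. z"])
       (use assms in auto)
  hence "beta_functional a b (\<lambda>s. a * 1 - (a + b) * (of_real s * 1)) = 0" by simp
  also have "beta_functional a b (\<lambda>s. a * 1 - (a + b) * (of_real s * 1)) =
      beta_functional a b (\<lambda>s. a * 1) - beta_functional a b (\<lambda>s. (a + b) * (of_real s * 1))"
    using assms by (intro beta_functional_diff continuous_intros)
  finally show ?thesis unfolding beta_functional_cmult beta_functional_shift_one by simp
qed

lemma beta_integral_plus1_right:
  assumes "0 < Re a" "0 < Re b"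
  shows "(a + b) * beta_functional a (b + 1) (\<lambda>_. 1) = b * beta_functional a b (\<lambda>_. 1)"
proof -
  have "beta_functional a (b + 1) (\<lambda>_. 1) = beta_functional a b (\<lambda>s. 1 - of_real s * 1)"
    by (simp add: beta_functional_shift_one)
  also have "\<dots> = beta_functional a b (\<lambda>_. 1) - beta_functional (a + 1) b (\<lambda>_. 1)"
    unfolding beta_functional_shift_one using assms by (intro beta_functional_diff continuous_intros)
  finally have "(a + b) * beta_functional a (b + 1) (\<lambda>_. 1) =
      (a + b) * beta_functional a b (\<lambda>_. 1) - a * beta_functional a b (\<lambda>_. 1)"
    by (simp only: right_diff_distrib beta_integral_plus1_left[OF assms])
  thus ?thesis by (simp add: distrib_right)
qed

lemma pochhammer_nonzero:
  assumes "0 < Re a"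
  shows "pochhammer a n \<noteq> (0::complex)"
proof
  assume "pochhammer a n = 0"
  then obtain k where "a = - of_nat k" by (auto simp: pochhammer_eq_0_iff)
  thus False using assms by simp
qed

lemma beta_integral_plus_left:
  assumes "0 < Re a" "0 < Re b"
  shows "pochhammer (a + b) n * beta_functional (a + of_nat n) b (\<lambda>_. 1) = pochhammer a n * beta_functional a b (\<lambda>_. 1)"
proof (induction n)
  case (Suc n)
  have "(a + b + of_nat n) * beta_functional (a + of_nat (Suc n)) b (\<lambda>_. 1)
     = (a + of_nat n) * beta_functional (a + of_nat n) b (\<lambda>_. 1)"
    using beta_integral_plus1_left[of "a + of_nat n" b] assms by (simp add: add_ac)
  hence "pochhammer (a + b) (Suc n) * beta_functional (a + of_nat (Suc n)) b (\<lambda>_. 1)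
     = (a + of_nat n) * (pochhammer (a + b) n * beta_functional (a + of_nat n) b (\<lambda>_. 1))"
    unfolding pochhammer_Suc by (metis (no_types, lifting) mult.assoc mult.commute)
  thus ?case unfolding Suc.IH by (simp add: pochhammer_Suc mult_ac)
qed simp

lemma beta_integral_plus_right:
  assumes "0 < Re a" "0 < Re b"
  shows "pochhammer (a + b) n * beta_functional a (b + of_nat n) (\<lambda>_. 1) = pochhammer b n * beta_functional a b (\<lambda>_. 1)"
proof (induction n)
  case (Suc n)
  have "(a + b + of_nat n) * beta_functional a (b + of_nat (Suc n)) (\<lambda>_. 1)
     = (b + of_nat n) * beta_functional a (b + of_nat n) (\<lambda>_. 1)"
    using beta_integral_plus1_right[of a "b + of_nat n"] assms by (simp add: add_ac)
  hence "pochhammer (a + b) (Suc n) * beta_functional a (b + of_nat (Suc n)) (\<lambda>_. 1)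
     = (b + of_nat n) * (pochhammer (a + b) n * beta_functional a (b + of_nat n) (\<lambda>_. 1))"
    unfolding pochhammer_Suc by (metis (no_types, lifting) mult.assoc mult.commute)
  thus ?case unfolding Suc.IH by (simp add: pochhammer_Suc mult_ac)
qed simp

lemma beta_moment:
  assumes "0 < Re a" "0 < Re b"
  shows "beta_functional a b (\<lambda>s. of_real s ^ i * of_real (1 - s) ^ j) =
    pochhammer a i * pochhammer b j / pochhammer (a + b) (i + j) * beta_functional a b (\<lambda>_. 1)"
proof -
  have "pochhammer (a + of_nat i + b) j * beta_functional (a + of_nat i) (b + of_nat j) (\<lambda>_. 1)
      = pochhammer b j * beta_functional (a + of_nat i) b (\<lambda>_. 1)"
    using assms by (intro beta_integral_plus_right) auto
  moreover have "pochhammer (a + b) (i + j) = pochhammer (a + b) i * pochhammer (a + of_nat i + b) j"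
    using pochhammer_product'[of "a + b" i j] by (simp add: add_ac)
  ultimately have "pochhammer (a + b) (i + j) * beta_functional (a + of_nat i) (b + of_nat j) (\<lambda>_. 1)
      = pochhammer b j * (pochhammer (a + b) i * beta_functional (a + of_nat i) b (\<lambda>_. 1))"
    by (simp add: mult_ac)
  also have "\<dots> = pochhammer b j * (pochhammer a i * beta_functional a b (\<lambda>_. 1))"
    by (simp add: beta_integral_plus_left assms)
  finally have "pochhammer (a + b) (i + j) * beta_functional (a + of_nat i) (b + of_nat j) (\<lambda>_. 1)
      = pochhammer b j * (pochhammer a i * beta_functional a b (\<lambda>_. 1))" .
  moreover have "pochhammer (a + b) (i + j) \<noteq> 0" using assms by (intro pochhammer_nonzero) simp
  ultimately show ?thesis
    using beta_functional_shift[of a b i j "\<lambda>_. 1"] by (simp add: field_simps)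
qed

lemma beta_integral_1:
  assumes "0 < Re a"
  shows "a * beta_functional a 1 (\<lambda>_. 1) = 1"
proof -
  have "((\<lambda>s. a * of_real s powr (a - 1)) has_integral (of_real 1 powr a - of_real 0 powr a)) {0..1}"
  proof (rule fundamental_theorem_of_calculus_interior)
    show "continuous_on {0..1} (\<lambda>s. complex_of_real s powr a)"
      using assms by (auto intro!: continuous_on_powr_complex continuous_on_const continuous_on_of_real continuous_on_id)
    fix s :: real assume "s \<in> {0<..<1}"
    thus "((\<lambda>s. complex_of_real s powr a) has_vector_derivative a * of_real s powr (a - 1)) (at s)"
      by (intro has_vector_derivative_real_field has_field_derivative_powr) (auto simp: complex_nonpos_Reals_iff)
  qed simp
  hence i: "((\<lambda>s. a * of_real s powr (a - 1)) has_integral 1) {0..1}" by simp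
  have "((\<lambda>s. a * (beta_density a 1 s * 1)) has_integral 1) {0..1}"
    by (rule has_integral_spike[OF negligible_sing[of 1] _ i]) (simp add: beta_density_def)
  from integral_unique[OF this] show ?thesis by (simp add: beta_functional_def)
qed

lemma beta_integral_nat:
  assumes "0 < Re a"
  shows "beta_functional a (of_nat n + 1) (\<lambda>_. 1) = fact n / pochhammer a (Suc n)"
proof -
  have "pochhammer (a + 1) n * beta_functional a (1 + of_nat n) (\<lambda>_. 1) = fact n * beta_functional a 1 (\<lambda>_. 1)"
    using beta_integral_plus_right[of a 1 n] assms by (simp add: pochhammer_fact)
  hence "(a * pochhammer (a + 1) n) * beta_functional a (1 + of_nat n) (\<lambda>_. 1) = fact n"
    using beta_integral_1[OF assms] by (metis (no_types, lifting) mult.assoc mult.left_commute mult.right_neutral)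
  thus ?thesis using pochhammer_nonzero[OF assms, of "Suc n"]
    by (simp add: pochhammer_rec field_simps add.commute)
qed

lemma norm_powr_minus_one_le:
  assumes b: "1 \<le> Re b" and s: "0 \<le> s" "s \<le> 1"
  shows "norm (of_real (1 - s) powr b - 1) \<le> norm b * s"
proof (cases "s = 1 \<or> s = 0")
  case True
  thus ?thesis using b complex_Re_le_cmod[of b] by auto
next
  case False
  hence s': "0 < s" "s < 1" using s by auto
  have "norm (of_real (1 - s) powr b - 1 powr b) \<le> norm b * norm (complex_of_real (1 - s) - 1)"
  proof (rule field_differentiable_bound[where S = "of_real ` {1 - s..1}" and f' = "\<lambda>z. b * z powr (b - 1)"])
    show "convex (complex_of_real ` {1 - s..1})"
      by (intro convex_linear_image) (auto simp: linear_of_real)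
    fix z assume "z \<in> complex_of_real ` {1 - s..1}"
    then obtain u where u: "z = of_real u" "1 - s \<le> u" "u \<le> 1" by auto
    have "z \<notin> \<real>\<^sub>\<le>\<^sub>0" using u s' by (auto simp: complex_nonpos_Reals_iff)
    thus "((\<lambda>z. z powr b) has_field_derivative b * z powr (b - 1)) (at z within complex_of_real ` {1 - s..1})"
      by (rule has_field_derivative_at_within[OF has_field_derivative_powr])
    have "norm (z powr (b - 1)) = u powr (Re b - 1)"
      using u s' norm_powr_real_powr[of z "b - 1"] by simp
    also have "\<dots> \<le> 1" using u s' b by (intro powr_le1) auto
    finally show "norm (b * z powr (b - 1)) \<le> norm b" by (simp add: norm_mult mult_left_le)
  qed (use s' imageI[of 1 "{1 - s..1}" complex_of_real] in \<open>auto simp del: of_real_diff\<close>)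
  thus ?thesis using s' by (simp add: norm_minus_commute)
qed

text \<open>With \<open>of_nat n + 1\<close> as second parameter the sequence is exactly
  \<open>Gamma_series a n\<close>. Inserting the extra factor \<open>(1 - s) powr b\<close> changes
  the integral by at most \<open>norm b * Beta (Re a + 1) (real n + 1)\<close>, which is smaller by
  a factor of order \<open>1 / n\<close>; \<open>norm_powr_minus_one_le\<close> supplies this
  estimate when Re b \<ge> 1.\<close>

lemma beta_integral_tendsto:
  assumes a: "0 < Re a" and b: "1 \<le> Re b"
  shows "(\<lambda>n. exp (a * of_real (ln (real n))) * beta_functional a (b + of_nat n + 1) (\<lambda>_. 1)) \<longlonglongrightarrow> Gamma a"
proof -
  have diff: "norm (beta_functional a (b + of_nat n + 1) (\<lambda>_. 1) - beta_functional a (of_nat n + 1) (\<lambda>_. 1))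
     \<le> norm b * Beta (Re a + 1) (real n + 1)" for n
  proof -
    have cont: "continuous_on {0..1} (\<lambda>s. (1 - complex_of_real s) powr b)"
      using b by (auto intro!: continuous_on_powr_complex continuous_on_const continuous_on_of_real
        continuous_on_diff continuous_on_id)
    have "beta_functional a (b + of_nat n + 1) (\<lambda>_. 1) = beta_functional a (of_nat n + 1) (\<lambda>s. of_real (1 - s) powr b)"
      unfolding beta_functional_def beta_density_def
      by (intro integral_cong) (auto simp: powr_add algebra_simps)
    hence "beta_functional a (b + of_nat n + 1) (\<lambda>_. 1) - beta_functional a (of_nat n + 1) (\<lambda>_. 1)
        = beta_functional a (of_nat n + 1) (\<lambda>s. of_real (1 - s) powr b - 1)"
      using a cont by (subst beta_functional_diff) (auto intro!: continuous_intros)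
    also have "norm \<dots> \<le> norm b * Beta (Re a + 1) (real n + 1)"
    proof (rule norm_beta_functional_le)
      have "((\<lambda>s. norm b * (s powr (Re a + 1 - 1) * (1 - s) powr (real n + 1 - 1))) has_integral norm b * Beta (Re a + 1) (real n + 1)) {0..1}"
        using a by (intro has_integral_mult_right has_integral_Beta_real) auto
      thus "((\<lambda>s. s powr (Re a - 1) * (1 - s) powr (Re (of_nat n + 1) - 1) * (norm b * s)) has_integral norm b * Beta (Re a + 1) (real n + 1)) {0..1}"
        by (rule has_integral_eq[rotated]) (auto simp: powr_diff field_simps)
      show "continuous_on {0..1} (\<lambda>s. of_real (1 - s) powr b - 1)"
        using cont by (auto intro!: continuous_on_diff)
    qed (use a norm_powr_minus_one_le[OF b] in auto)
    finally show ?thesis .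
  qed
  have x1: "0 < Re a + 1" using a by simp
  have "(\<lambda>n. norm b * (Gamma_series (Re a + 1) n * inverse (real n))) \<longlonglongrightarrow> norm b * (Gamma (Re a + 1) * 0)"
    by (intro tendsto_intros Gamma_series_LIMSEQ lim_inverse_n)
  hence lim0: "(\<lambda>n. norm b * (Gamma_series (Re a + 1) n * inverse (real n))) \<longlonglongrightarrow> 0" by simp
  have "(\<lambda>n. exp (a * of_real (ln (real n))) * (beta_functional a (b + of_nat n + 1) (\<lambda>_. 1) - beta_functional a (of_nat n + 1) (\<lambda>_. 1))) \<longlonglongrightarrow> 0"
  proof (rule Lim_null_comparison[OF _ lim0])
    show "\<forall>\<^sub>F n in sequentially. norm (exp (a * of_real (ln (real n))) * (beta_functional a (b + of_nat n + 1) (\<lambda>_. 1) - beta_functional a (of_nat n + 1) (\<lambda>_. 1)))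
      \<le> norm b * (Gamma_series (Re a + 1) n * inverse (real n))"
    proof (rule eventually_sequentiallyI[of 1])
      fix n :: nat assume n: "1 \<le> n"
      have "Beta (Re a + 1) (real n + 1) = fact n / pochhammer (Re a + 1) (Suc n)"
      proof -
        have "Gamma (real n + 1) = fact n" using Gamma_fact[of n, where 'a = real] by (simp add: add.commute)
        moreover have "pochhammer (Re a + 1) (Suc n) = Gamma (Re a + 1 + Suc n) / Gamma (Re a + 1)"
          using a by (intro pochhammer_Gamma) (auto elim!: nonpos_Ints_cases)
        moreover have "Gamma (Re a + 1) \<noteq> 0" using Gamma_real_pos[of "Re a + 1"] a by linarith
        ultimately show ?thesis by (simp add: Beta_def add_ac)
      qed
      hence "exp (Re a * ln (real n)) * Beta (Re a + 1) (real n + 1) = Gamma_series (Re a + 1) n * inverse (real n)"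
        using n by (simp add: Gamma_series_def exp_add algebra_simps)
      thus "norm (exp (a * of_real (ln (real n))) * (beta_functional a (b + of_nat n + 1) (\<lambda>_. 1) - beta_functional a (of_nat n + 1) (\<lambda>_. 1)))
        \<le> norm b * (Gamma_series (Re a + 1) n * inverse (real n))"
        unfolding norm_mult using mult_left_mono[OF diff[of n], of "exp (Re a * ln (real n))"] by (simp add: mult_ac)
    qed
  qed
  moreover have "(\<lambda>n. exp (a * of_real (ln (real n))) * beta_functional a (of_nat n + 1) (\<lambda>_. 1)) \<longlonglongrightarrow> Gamma a"
  proof -
    have "exp (a * of_real (ln (real n))) * beta_functional a (of_nat n + 1) (\<lambda>_. 1) = Gamma_series a n" for n
      by (simp add: beta_integral_nat[OF a] Gamma_series_def mult_ac)
    thus ?thesis using Gamma_series_LIMSEQ[of a] by simp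
  qed
  ultimately have "(\<lambda>n. exp (a * of_real (ln (real n))) * (beta_functional a (b + of_nat n + 1) (\<lambda>_. 1) - beta_functional a (of_nat n + 1) (\<lambda>_. 1))
      + exp (a * of_real (ln (real n))) * beta_functional a (of_nat n + 1) (\<lambda>_. 1)) \<longlonglongrightarrow> 0 + Gamma a"
    by (rule tendsto_add)
  thus ?thesis by (simp add: algebra_simps)
qed

lemma not_nonpos_Int: "0 < Re a \<Longrightarrow> a \<notin> \<int>\<^sub>\<le>\<^sub>0"
  by (auto elim!: nonpos_Ints_cases)

text \<open>As in Gauss's product, the recurrence moves the second parameter to
  \<open>b + n + 1\<close>, and the powers of \<open>n\<close> turn the Pochhammer quotient into a
  quotient of Gamma series, whose limit is known. Small Re b is reduced to Re b \<ge> 1 by one more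
  step of the recurrence.\<close>

lemma beta_integral_complex:
  assumes a: "0 < Re a" and b: "0 < Re b"
  shows "beta_functional a b (\<lambda>_. 1) = Beta a b"
proof -
  have *: "beta_functional a b (\<lambda>_. 1) = Beta a b" if b: "1 \<le> Re b" for b
  proof -
    have ab: "0 < Re (a + b)" "0 < Re b" using a b by auto
    have nz: "Gamma b \<noteq> 0" "Gamma (a + b) \<noteq> 0"
      using not_nonpos_Int ab by (auto simp: Gamma_eq_zero_iff)
    have eq: "exp (a * of_real (ln (real n))) * beta_functional a (b + of_nat n + 1) (\<lambda>_. 1) * Gamma_series b n
      = beta_functional a b (\<lambda>_. 1) * Gamma_series (a + b) n" for n
    proof -
      define B0 B1 p q where "B0 = beta_functional a b (\<lambda>_. 1)" "B1 = beta_functional a (b + of_nat n + 1) (\<lambda>_. 1)"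
        "p = pochhammer b (Suc n)" "q = pochhammer (a + b) (Suc n)"
      have pq: "p \<noteq> 0" "q \<noteq> 0" unfolding B0_B1_p_q_def by (intro pochhammer_nonzero ab)+
      have "q * B1 = p * B0"
        using beta_integral_plus_right[OF a ab(2), of "Suc n"] unfolding B0_B1_p_q_def by (simp add: add_ac)
      hence "B1 = p * B0 / q" using pq by (simp add: field_simps)
      thus ?thesis unfolding Gamma_series_def B0_B1_p_q_def(1,2)[symmetric]
        unfolding add_Suc_right add_0_right One_nat_def B0_B1_p_q_def(3,4)[symmetric]
        using pq by (simp add: distrib_right exp_add)
    qed
    have "(\<lambda>n. exp (a * of_real (ln (real n))) * beta_functional a (b + of_nat n + 1) (\<lambda>_. 1) * Gamma_series b n) \<longlonglongrightarrow> Gamma a * Gamma b"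
      by (intro tendsto_mult beta_integral_tendsto a b Gamma_series_LIMSEQ)
    moreover have "(\<lambda>n. beta_functional a b (\<lambda>_. 1) * Gamma_series (a + b) n) \<longlonglongrightarrow> beta_functional a b (\<lambda>_. 1) * Gamma (a + b)"
      by (intro tendsto_intros Gamma_series_LIMSEQ)
    ultimately have "Gamma a * Gamma b = beta_functional a b (\<lambda>_. 1) * Gamma (a + b)"
      unfolding eq by (rule LIMSEQ_unique)
    thus ?thesis using nz by (simp add: Beta_def)
  qed
  have "b \<noteq> 0" "a + b \<notin> \<int>\<^sub>\<le>\<^sub>0" "b \<notin> \<int>\<^sub>\<le>\<^sub>0" using not_nonpos_Int[of "a + b"] not_nonpos_Int[OF b] a b by auto
  have "(a + b) * Beta a (b + 1) = b * Beta a b" by (rule Beta_plus1_right[OF \<open>b \<notin> \<int>\<^sub>\<le>\<^sub>0\<close>])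
  moreover have "(a + b) * Beta a (b + 1) = b * beta_functional a b (\<lambda>_. 1)"
    using beta_integral_plus1_right[OF a b] *[of "b + 1"] b by simp
  ultimately show ?thesis using \<open>b \<noteq> 0\<close> by simp
qed

lemma norm_Gamma_le:
  assumes "0 < Re a"
  shows "norm (Gamma a) \<le> Gamma (Re a)"
proof -
  have r: "((\<lambda>t. t powr (Re a - 1) / exp t) has_integral Gamma (Re a)) {0..}"
    using assms by (rule Gamma_integral_real)
  have c: "((\<lambda>t. complex_of_real t powr (a - 1) / of_real (exp t)) has_integral Gamma a) {0..}"
    using assms by (rule Gamma_integral_complex)
  have "norm (integral {0..} (\<lambda>t. complex_of_real t powr (a - 1) / of_real (exp t)))
      \<le> integral {0..} (\<lambda>t. t powr (Re a - 1) / exp t)"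
  proof (rule integral_norm_bound_integral)
    fix t :: real assume "t \<in> {0..}"
    thus "norm (complex_of_real t powr (a - 1) / of_real (exp t)) \<le> t powr (Re a - 1) / exp t"
      using norm_powr_real_powr[of "of_real t" "a - 1"] by (simp add: norm_divide)
  qed (use r c in blast)+
  thus ?thesis unfolding integral_unique[OF r] integral_unique[OF c] .
qed

section \<open>Integral representations\<close>

lemma beta_functional_exp:
  assumes ab: "0 < Re a" "0 < Re b"
  shows "beta_functional a b (\<lambda>s. exp (\<zeta> * of_real s)) = hyp1f1 a (a + b) \<zeta> * Beta a b"
proof -
  have "(\<lambda>m. beta_functional a b (\<lambda>s. \<zeta> ^ m / fact m * of_real s ^ m)) sums beta_functional a b (\<lambda>s. exp (\<zeta> * of_real s))"
  proof (rule beta_functional_sums[OF ab])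
    show "summable (\<lambda>m. norm \<zeta> ^ m / fact m)"
      using summable_exp[of "norm \<zeta>"] by (simp add: field_simps)
    fix m :: nat and s :: real assume s: "0 \<le> s" "s \<le> 1"
    have "norm (\<zeta> ^ m / fact m * of_real s ^ m) = norm \<zeta> ^ m / fact m * s ^ m"
      using s by (simp add: norm_mult norm_divide norm_power)
    also have "\<dots> \<le> norm \<zeta> ^ m / fact m" using s by (intro mult_left_le power_le_one) auto
    finally show "norm (\<zeta> ^ m / fact m * of_real s ^ m) \<le> norm \<zeta> ^ m / fact m" .
  next
    fix s :: real
    show "(\<lambda>m. \<zeta> ^ m / fact m * of_real s ^ m) sums exp (\<zeta> * of_real s)"
      using exp_converges[of "\<zeta> * of_real s"] by (simp add: scaleR_conv_of_real field_simps power_mult_distrib)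
  qed (intro continuous_intros)+
  moreover have "beta_functional a b (\<lambda>s. \<zeta> ^ m / fact m * of_real s ^ m) =
      pochhammer a m / pochhammer (a + b) m * \<zeta> ^ m / fact m * Beta a b" for m
  proof -
    have "beta_functional a b (\<lambda>s. \<zeta> ^ m / fact m * of_real s ^ m) = \<zeta> ^ m / fact m * beta_functional a b (\<lambda>s. of_real s ^ m)"
      by (rule beta_functional_cmult)
    thus ?thesis using beta_moment[OF ab, of m 0] beta_integral_complex[OF ab] by (simp add: mult_ac)
  qed
  ultimately have "(\<lambda>m. pochhammer a m / pochhammer (a + b) m * \<zeta> ^ m / fact m * Beta a b) sums
      beta_functional a b (\<lambda>s. exp (\<zeta> * of_real s))" by simp
  moreover have nz: "Beta a b \<noteq> 0"
    unfolding Beta_def using ab not_nonpos_Int[of a] not_nonpos_Int[of b] not_nonpos_Int[of "a + b"]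
    by (simp add: Gamma_eq_zero_iff)
  ultimately have "(\<lambda>m. pochhammer a m / pochhammer (a + b) m * \<zeta> ^ m / fact m) sums
      (beta_functional a b (\<lambda>s. exp (\<zeta> * of_real s)) / Beta a b)"
    by (drule_tac sums_divide[of _ _ "Beta a b"]) simp
  thus ?thesis using nz by (simp add: hyp1f1_series sums_iff)
qed

text \<open>Monomials in \<open>s\<close> and \<open>1 - s\<close> only shift the two Beta
  parameters; this is the source of the shifted parameters in the confluent functions of the
  expansion.\<close>

lemma beta_functional_exp_moment:
  assumes ab: "0 < Re a" "0 < Re b"
  shows "beta_functional a b (\<lambda>s. of_real s ^ i * of_real (1 - s) ^ j * exp (\<zeta> * of_real s)) =
    pochhammer a i * pochhammer b j / pochhammer (a + b) (i + j)
    * hyp1f1 (a + of_nat i) (a + b + of_nat i + of_nat j) \<zeta> * Beta a b"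
proof -
  have "beta_functional a b (\<lambda>s. of_real s ^ i * of_real (1 - s) ^ j * exp (\<zeta> * of_real s)) =
    hyp1f1 (a + of_nat i) (a + of_nat i + (b + of_nat j)) \<zeta> * Beta (a + of_nat i) (b + of_nat j)"
    unfolding beta_functional_shift using ab by (intro beta_functional_exp) auto
  also have "Beta (a + of_nat i) (b + of_nat j) = beta_functional (a + of_nat i) (b + of_nat j) (\<lambda>_. 1)"
    using ab by (intro beta_integral_complex[symmetric]) auto
  also have "\<dots> = pochhammer a i * pochhammer b j / pochhammer (a + b) (i + j) * Beta a b"
    using beta_moment[OF ab, of i j] beta_functional_shift[of a b i j "\<lambda>_. 1"] beta_integral_complex[OF ab] by simp
  finally show ?thesis by (simp add: add_ac mult_ac)
qed

lemma P_poly_eq_sum: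
  "hyp2f1 (- of_nat n) a c (1 - z) =
    (\<Sum>m\<le>n. of_nat (n choose m) * (pochhammer a m / pochhammer c m) * (z - 1) ^ m)"
proof -
  have "hyp2f1 (- of_nat n) a c (1 - z) =
      (\<Sum>m\<le>n. pochhammer (- of_nat n) m * pochhammer a m / pochhammer c m * (1 - z) ^ m / fact m)"
    unfolding hyp2f1_series
    by (rule suminf_finite) (auto simp: pochhammer_of_nat_eq_0_iff)
  also have "\<dots> = (\<Sum>m\<le>n. of_nat (n choose m) * (pochhammer a m / pochhammer c m) * (z - 1) ^ m)"
  proof (rule sum.cong)
    fix m
    have "of_nat (n choose m) = (- 1) ^ m * pochhammer (- of_nat n) m / (fact m :: complex)"
      by (simp add: binomial_gbinomial gbinomial_pochhammer)
    moreover have "(z - 1) ^ m = (- 1) ^ m * (1 - z) ^ m" by (simp flip: power_mult_distrib)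
    moreover have "(- 1) ^ m * (- 1) ^ m = (1::complex)" by (simp flip: power_mult_distrib)
    moreover have "P * A / c * Q / F = (X * P / F) * (A / c) * (X * Q)" if "X * X = 1" for P A c Q F X :: complex
    proof -
      have "(X * P / F) * (A / c) * (X * Q) = (X * X) * (P * A / c * Q / F)" by (simp add: mult_ac)
      thus ?thesis unfolding that by simp
    qed
    ultimately show "pochhammer (- of_nat n) m * pochhammer a m / pochhammer c m * (1 - z) ^ m / fact m =
        of_nat (n choose m) * (pochhammer a m / pochhammer c m) * (z - 1) ^ m"
      by (simp only:)
  qed simp
  finally show ?thesis .
qed

section \<open>Moments along the curve \<open>(exp (w * z) - 1) / (exp w - 1)\<close>\<close>

context log_branch
begin

definition curve :: "complex \<Rightarrow> complex \<Rightarrow> complex" where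
  "curve w z = (exp (w * z) - 1) / (exp w - 1)"

text \<open>This is \<open>beta_curve_integral_0\<close> with \<open>a + of_nat m\<close> for
  \<open>a\<close>: the additional power \<open>s ^ m * exp (h s) ^ m\<close> is the
  \<open>m\<close>-th power of the curve, and the remaining exponentials combine to
  \<open>f\<close>.\<close>

lemma curve_integral:
  assumes ab: "0 < Re a" "0 < Re b" and w: "norm w < 2 * pi" "w \<noteq> 0"
  shows "beta_functional a b (\<lambda>s. f a b s w * curve w (of_real s) ^ m * (a + of_nat m - (a + b + of_nat m) * curve w (of_real s))) = 0"
proof -
  \<comment> \<open>An open neighbourhood of the unit interval on which both
    \<open>H (w * z)\<close> and \<open>H (w * (1 - z))\<close> are defined; they supply the
    logarithms of \<open>t / z\<close> and of \<open>(1 - t) / (1 - z)\<close>.\<close>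
  define Z where "Z = {z. w * z \<in> ball 0 (2 * pi)} \<inter> {z. w * (1 - z) \<in> ball 0 (2 * pi)}"
  define h where "h = (\<lambda>z. H w - H (w * z))"
  define k where "k = (\<lambda>z. w * z + H w - H (w * (1 - z)))"
  define t' where "t' = (\<lambda>z. exp (H w + w * z))"
  have ew: "exp w \<noteq> 1" using exp_neq_1_disc w by blast
  have Hw: "exp (H w) = w / (exp w - 1)" using exp_H[of w] w by simp
  have Z: "open Z" unfolding Z_def
    by (intro open_Int open_vimage[unfolded vimage_def] open_ball continuous_intros)
  have sub: "of_real ` {0..1} \<subseteq> Z"
  proof safe
    fix s :: real assume s: "s \<in> {0..1}"
    have *: "norm (w * of_real r) < 2 * pi" if "0 \<le> r" "r \<le> 1" for r
    proof -
      have "norm (w * of_real r) \<le> norm w" using that by (simp add: norm_mult mult_left_le)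
      thus ?thesis using w by simp
    qed
    show "of_real s \<in> Z" using *[of s] *[of "1 - s"] s by (auto simp: Z_def)
  qed
  have holh: "h holomorphic_on Z"
  proof -
    have "(H \<circ> (\<lambda>z. w * z)) holomorphic_on Z"
      by (rule holomorphic_on_compose_gen[OF _ H_hol]) (auto simp: Z_def intro!: holomorphic_intros)
    thus ?thesis unfolding h_def by (intro holomorphic_intros) (simp_all add: o_def)
  qed
  have holk: "k holomorphic_on Z"
  proof -
    have "(H \<circ> (\<lambda>z. w * (1 - z))) holomorphic_on Z"
      by (rule holomorphic_on_compose_gen[OF _ H_hol]) (auto simp: Z_def intro!: holomorphic_intros)
    thus ?thesis unfolding k_def by (intro holomorphic_intros) (simp_all add: o_def)
  qed
  have th: "z * exp (h z) = curve w z" if z: "z \<in> Z" for z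
  proof (cases "z = 0")
    case False
    hence "exp (H (w * z)) = w * z / (exp (w * z) - 1)" using z w by (intro exp_H) (auto simp: Z_def)
    moreover have "exp (w * z) \<noteq> 1" using z w False by (intro exp_neq_1_disc) (auto simp: Z_def)
    ultimately show ?thesis using ew w False by (simp add: h_def exp_diff Hw curve_def)
  qed (simp add: curve_def)
  have "beta_functional (a + of_nat m) b (\<lambda>s. exp ((a + of_nat m - 1) * h (of_real s) + (b - 1) * k (of_real s))
     * t' (of_real s) * (a + of_nat m - (a + of_nat m + b) * curve w (of_real s))) = 0"
  proof (rule beta_curve_integral_0[OF _ _ Z sub holh holk])
    fix z assume z: "z \<in> Z"
    have "(curve w has_field_derivative (exp (w * z) * w) / (exp w - 1)) (at z)"
      unfolding curve_def using ew by (auto intro!: derivative_eq_intros)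
    thus "(curve w has_field_derivative t' z) (at z)"
      by (simp add: t'_def exp_add Hw mult_ac)
    show "z * exp (h z) = curve w z" by (rule th[OF z])
    show "(1 - z) * exp (k z) = 1 - curve w z"
    proof (cases "z = 1")
      case False
      hence 1: "exp (H (w * (1 - z))) = w * (1 - z) / (exp (w * (1 - z)) - 1)"
        using z w by (intro exp_H) (auto simp: Z_def)
      have "exp (w * (1 - z)) \<noteq> 1" using z w False by (intro exp_neq_1_disc) (auto simp: Z_def)
      hence "(1 - z) * exp (k z) = (exp (w * z) * exp (w * (1 - z)) - exp (w * z)) / (exp w - 1)"
      proof -
        have "u * (X * (w / D) / (w * u / (V - 1))) = (X * V - X) / D" if "u \<noteq> 0" "V \<noteq> 1" for u X D V :: complex
          using w that by (cases "D = 0") (simp_all add: divide_simps, simp_all add: algebra_simps)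
        from this[of "1 - z" "exp (w * (1 - z))"] show ?thesis
          using False \<open>exp (w * (1 - z)) \<noteq> 1\<close> unfolding k_def exp_diff exp_add Hw 1 by simp
      qed
      also have "exp (w * z) * exp (w * (1 - z)) = exp w" by (simp add: algebra_simps flip: exp_add)
      also have "(exp w - exp (w * z)) / (exp w - 1) = 1 - curve w z"
        using ew by (simp add: curve_def field_simps)
      finally show ?thesis .
    qed (use ew in \<open>simp add: curve_def\<close>)
  qed (use ab in auto)
  also have "beta_functional (a + of_nat m) b (\<lambda>s. exp ((a + of_nat m - 1) * h (of_real s) + (b - 1) * k (of_real s))
     * t' (of_real s) * (a + of_nat m - (a + of_nat m + b) * curve w (of_real s)))
    = beta_functional a b (\<lambda>s. of_real s ^ m * of_real (1 - s) ^ 0 * (exp ((a + of_nat m - 1) * h (of_real s) + (b - 1) * k (of_real s))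
     * t' (of_real s) * (a + of_nat m - (a + of_nat m + b) * curve w (of_real s))))"
    unfolding beta_functional_shift by simp
  also have "\<dots> = beta_functional a b (\<lambda>s. f a b s w * curve w (of_real s) ^ m * (a + of_nat m - (a + b + of_nat m) * curve w (of_real s)))"
  proof -
    have "of_real s ^ m * of_real (1 - s) ^ 0 * (exp ((a + of_nat m - 1) * h (of_real s) + (b - 1) * k (of_real s))
       * t' (of_real s) * (a + of_nat m - (a + of_nat m + b) * curve w (of_real s)))
     = f a b s w * curve w (of_real s) ^ m * (a + of_nat m - (a + b + of_nat m) * curve w (of_real s))"
      if s: "s \<in> {0..1}" for s
    proof -
      define z where "z = complex_of_real s"
      have "z \<in> Z" using sub s by (auto simp: z_def)
      note th = th[OF this]
      have "exp ((a + of_nat m - 1) * h z + (b - 1) * k z) * t' z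
          = exp (h z) ^ m * exp ((a - 1) * h z + (b - 1) * k z + (H w + w * z))"
        by (simp add: t'_def algebra_simps flip: exp_add exp_of_nat_mult)
      also have "(a - 1) * h z + (b - 1) * k z + (H w + w * z)
          = E b (1 - a) (of_real s * w) + E 0 (1 - b) (of_real (1 - s) * w) + E 0 (a + b - 1) w"
        by (simp add: h_def k_def E_def z_def algebra_simps)
      also have "exp \<dots> = f a b s w" by (simp add: f_def exp_add)
      finally show ?thesis unfolding z_def[symmetric] th[symmetric] by (simp add: power_mult_distrib algebra_simps)
    qed
    thus ?thesis unfolding beta_functional_def by (intro integral_cong) simp
  qed
  finally show ?thesis .
qed

end

text \<open>The density may be unbounded at the end points, so the chain rule is applied only in the
  interior, to the indefinite integral of the density, which is continuous up to the
  boundary.\<close>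

lemma beta_integral_substitution:
  assumes ab: "0 < Re a" "0 < Re b"
    and t: "continuous_on {0..1} t" "t 0 = 0" "t 1 = 1" "\<And>s. 0 < s \<Longrightarrow> s < 1 \<Longrightarrow> 0 < t s \<and> t s < 1"
    and t': "\<And>s. 0 < s \<Longrightarrow> s < 1 \<Longrightarrow> (t has_real_derivative t' s) (at s)"
  shows "((\<lambda>s. of_real (t' s) * beta_density a b (t s)) has_integral Beta a b) {0..1}"
proof -
  define G where "G = (\<lambda>u. integral {0..u} (beta_density a b))"
  have int: "beta_density a b integrable_on {0..1}"
    using beta_integrable[OF ab, of "\<lambda>_. 1"] by simp
  have "((\<lambda>s. of_real (t' s) * beta_density a b (t s)) has_integral (G \<circ> t) 1 - (G \<circ> t) 0) {0..1}"
  proof (rule fundamental_theorem_of_calculus_interior)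
    have t01: "0 \<le> t s \<and> t s \<le> 1" if "0 \<le> s" "s \<le> 1" for s
      using t(2,3) that by (cases "s = 0 \<or> s = 1") (auto, (use t(4)[of s] in force)+)
    show "continuous_on {0..1} (G \<circ> t)"
    proof (rule continuous_on_compose[OF t(1)])
      show "continuous_on (t ` {0..1}) G"
        unfolding G_def using t01 by (intro continuous_on_subset[OF indefinite_integral_continuous_1[OF int]]) auto
    qed
    fix s :: real assume "s \<in> {0<..<1}"
    hence s: "0 < s" "s < 1" by auto
    have ts: "t s \<in> {0<..<1}" using t(4)[OF s] by simp
    have "continuous (at (t s)) (beta_density a b)"
      using continuous_on_beta_density[of a b] ts by (simp add: continuous_on_eq_continuous_at)
    hence "(G has_vector_derivative beta_density a b (t s)) (at (t s) within {0..1})"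
      unfolding G_def using integral_has_vector_derivative_continuous_at[OF int, where x = "t s" and S = "{}"] ts
      by (auto intro: continuous_at_imp_continuous_at_within)
    hence "(G has_vector_derivative beta_density a b (t s)) (at (t s))"
      using ts at_within_interior[where x = "t s" and S = "{0..1}"] by simp
    hence "((G \<circ> t) has_vector_derivative t' s *\<^sub>R beta_density a b (t s)) (at s)"
      using t'[OF s] by (intro vector_diff_chain_at) (simp_all add: has_real_derivative_iff_has_vector_derivative)
    thus "((G \<circ> t) has_vector_derivative of_real (t' s) * beta_density a b (t s)) (at s)"
      by (simp add: scaleR_conv_of_real)
  qed simp
  moreover have "(G \<circ> t) 1 = Beta a b" "(G \<circ> t) 0 = 0"
    using t beta_integral_complex[OF ab] by (simp_all add: G_def beta_functional_def)
  ultimately show ?thesis by simp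
qed

context log_branch
begin

lemma continuous_on_f:
  assumes "norm w < 2 * pi"
  shows "continuous_on {0..1} (\<lambda>s. f a b s w)"
proof -
  have E: "continuous_on {0..1} (\<lambda>s. E b c (of_real (g s) * w))" if "continuous_on {0..1} g" "\<And>s. s \<in> {0..1} \<Longrightarrow> \<bar>g s\<bar> \<le> 1" for b c and g :: "real \<Rightarrow> real"
  proof -
    have "(\<lambda>s. of_real (g s) * w) ` {0..1} \<subseteq> ball 0 (2 * pi)"
    proof (rule image_subsetI)
      fix s :: real assume "s \<in> {0..1}"
      hence "\<bar>g s\<bar> * norm w \<le> 1 * norm w" using that by (intro mult_right_mono) auto
      thus "of_real (g s) * w \<in> ball 0 (2 * pi)" using assms by (simp add: norm_mult)
    qed
    moreover have "continuous_on {0..1} (\<lambda>s. of_real (g s) * w)" by (intro continuous_intros that)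
    ultimately show ?thesis
      by (intro continuous_on_compose2[OF holomorphic_on_imp_continuous_on[OF E_holomorphic]])
  qed
  show ?thesis unfolding f_def
    by (intro continuous_intros E) auto
qed

lemma f_holomorphic:
  assumes "0 \<le> s" "s \<le> 1"
  shows "f a b s holomorphic_on ball 0 (2 * pi)"
proof -
  have E: "(\<lambda>z. E b c (of_real r * z)) holomorphic_on ball 0 (2 * pi)" if "0 \<le> r" "r \<le> 1" for r b c
  proof -
    have "(\<lambda>z::complex. of_real r * z) ` ball 0 (2 * pi) \<subseteq> ball 0 (2 * pi)"
    proof (rule image_subsetI)
      fix z :: complex assume "z \<in> ball 0 (2 * pi)"
      moreover have "\<bar>r\<bar> * norm z \<le> 1 * norm z" using that by (intro mult_right_mono) auto
      ultimately show "of_real r * z \<in> ball 0 (2 * pi)" by (simp add: norm_mult)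
    qed
    hence "(E b c \<circ> (\<lambda>z. of_real r * z)) holomorphic_on ball 0 (2 * pi)"
      by (intro holomorphic_on_compose_gen[OF _ E_holomorphic] holomorphic_intros)
    thus ?thesis by (simp add: o_def)
  qed
  have "(\<lambda>z. exp (E b (1 - a) (of_real s * z)) * exp (E 0 (1 - b) (of_real (1 - s) * z)) * exp (E 0 (a + b - 1) z))
      holomorphic_on ball 0 (2 * pi)"
    using assms by (intro holomorphic_intros E E_holomorphic) auto
  thus ?thesis by (simp add: f_def[abs_def])
qed

text \<open>\<open>curve_integral\<close> is the recurrence satisfied by the moments of a Beta
  distribution. It fixes all ratios, so only the moment of order 0 is left to determine.\<close>

lemma curve_moment:
  assumes ab: "0 < Re a" "0 < Re b" and w: "norm w < 2 * pi" "w \<noteq> 0"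
  shows "beta_functional a b (\<lambda>s. f a b s w * curve w (of_real s) ^ m) =
    pochhammer a m / pochhammer (a + b) m * beta_functional a b (\<lambda>s. f a b s w)"
proof (induction m)
  case (Suc m)
  define A where "A = (\<lambda>m. beta_functional a b (\<lambda>s. f a b s w * curve w (of_real s) ^ m))"
  have cont: "continuous_on {0..1} (\<lambda>s. f a b s w * curve w (of_real s) ^ m)" for m
    unfolding curve_def using exp_neq_1_disc[OF w] by (intro continuous_intros continuous_on_f w) auto
  have "0 = beta_functional a b (\<lambda>s. (a + of_nat m) * (f a b s w * curve w (of_real s) ^ m)
      - (a + b + of_nat m) * (f a b s w * curve w (of_real s) ^ Suc m))"
    using curve_integral[OF ab w, of m] by (simp add: algebra_simps)
  also have "\<dots> = (a + of_nat m) * A m - (a + b + of_nat m) * A (Suc m)"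
    unfolding A_def by (subst beta_functional_diff[OF ab])
      (intro continuous_on_mult continuous_on_const cont, intro continuous_on_mult continuous_on_const cont,
       simp only: beta_functional_cmult)
  finally have 1: "(a + b + of_nat m) * A (Suc m) = (a + of_nat m) * A m" by simp
  have nz: "a + b + of_nat m \<noteq> 0" using ab by (auto simp: complex_eq_iff)
  hence "A (Suc m) = (a + of_nat m) / (a + b + of_nat m) * A m" using 1 by (simp add: field_simps)
  thus ?case using Suc.IH by (simp add: A_def pochhammer_Suc mult_ac)
qed simp

section \<open>Taylor coefficients in \<open>w\<close> and the total mass along the curve\<close>

definition coeff :: "complex \<Rightarrow> complex \<Rightarrow> nat \<Rightarrow> real \<Rightarrow> complex" where
  "coeff a b j s = (\<Sum>(i1, i2, i3)\<in>{(i1, i2, i3). i1 + i2 + i3 = j}.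
     gen_bernoulli i1 (1 - a) b / fact i1 * (gen_bernoulli i2 (1 - b) 0 / fact i2)
     * (gen_bernoulli i3 (a + b - 1) 0 / fact i3) * (of_real s ^ i1 * of_real (1 - s) ^ i2))"

lemma finite_triples: "finite {(i1, i2, i3). i1 + i2 + i3 = (j::nat)}"
  by (rule finite_subset[of _ "{..j} \<times> {..j} \<times> {..j}"]) auto

lemma sum_triples:
  "(\<Sum>(i1, i2, i3)\<in>{(i1, i2, i3). i1 + i2 + i3 = (j::nat)}. g i1 i2 i3) = (\<Sum>i=0..j. \<Sum>l=0..i. g l (i - l) (j - i))"
proof -
  have "(\<Sum>i=0..j. \<Sum>l=0..i. g l (i - l) (j - i)) = (\<Sum>(i, l)\<in>Sigma {0..j} (\<lambda>i. {0..i}). g l (i - l) (j - i))"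
    by (rule sum.Sigma) auto
  also have "\<dots> = (\<Sum>(i1, i2, i3)\<in>{(i1, i2, i3). i1 + i2 + i3 = (j::nat)}. g i1 i2 i3)"
    by (rule sum.reindex_bij_witness[where i = "\<lambda>(i1, i2, i3). (i1 + i2, i1)" and j = "\<lambda>(i, l). (l, i - l, j - i)"]) auto
  finally show ?thesis by simp
qed

lemma exp_E_fps:
  assumes "0 \<le> s" "s \<le> 1"
  shows "(\<lambda>z. exp (E b c (of_real s * z))) has_fps_expansion Abs_fps (\<lambda>i. gen_bernoulli i c b / fact i * of_real s ^ i)"
proof (rule has_fps_expansionI)
  have "\<forall>\<^sub>F z in nhds 0. z \<in> ball (0::complex) (2 * pi)"
    by (intro eventually_nhds_in_open) auto
  thus "\<forall>\<^sub>F z in nhds 0. (\<lambda>i. fps_nth (Abs_fps (\<lambda>i. gen_bernoulli i c b / fact i * of_real s ^ i)) i * z ^ i)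
      sums exp (E b c (of_real s * z))"
  proof eventually_elim
    case (elim z)
    have "s * norm z \<le> norm z" using assms by (simp add: mult_left_le_one_le)
    hence "norm (of_real s * z) < 2 * pi" using elim assms by (simp add: norm_mult)
    from gen_bernoulli_sums[OF H_hol H_0 exp_H this, of c b]
    show ?case by (simp add: E_def exp_add power_mult_distrib mult_ac)
  qed
qed

text \<open>\<open>f\<close> is a product of three Bernoulli generating functions in
  \<open>s * z\<close>, \<open>(1 - s) * z\<close> and \<open>z\<close>, and \<open>coeff\<close> is
  the coefficient of their Cauchy product. Its polynomial form in \<open>s\<close> allows
  integration against \<open>exp (\<zeta> * s)\<close> term by term.\<close>

lemma coeff_eq_deriv:
  assumes "0 \<le> s" "s \<le> 1"
  shows "coeff a b j s = (deriv ^^ j) (f a b s) 0 / fact j"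
proof -
  have 1: "(\<lambda>z. exp (E 0 (a + b - 1) z)) has_fps_expansion Abs_fps (\<lambda>i. gen_bernoulli i (a + b - 1) 0 / fact i)"
    using exp_E_fps[of 1 0 "a + b - 1"] by simp
  have "f a b s has_fps_expansion Abs_fps (\<lambda>i. gen_bernoulli i (1 - a) b / fact i * of_real s ^ i)
     * Abs_fps (\<lambda>i. gen_bernoulli i (1 - b) 0 / fact i * of_real (1 - s) ^ i) * Abs_fps (\<lambda>i. gen_bernoulli i (a + b - 1) 0 / fact i)"
    unfolding f_def[abs_def] using assms
    by (intro has_fps_expansion_mult exp_E_fps 1) auto
  from fps_nth_fps_expansion[OF this, of j, unfolded fps_mult_nth]
  show ?thesis unfolding coeff_def sum_triples
    by (simp add: sum_distrib_left sum_distrib_right mult_ac)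
qed

lemma continuous_on_coeff: "continuous_on {0..1} (coeff a b j)"
  unfolding coeff_def[abs_def] case_prod_unfold by (intro continuous_intros)

lemma coeff_sums:
  assumes "0 \<le> s" "s \<le> 1" "norm w < 2 * pi"
  shows "(\<lambda>j. coeff a b j s * w ^ j) sums f a b s w"
  using holomorphic_power_series[OF f_holomorphic[OF assms(1,2)], of w] assms by (simp add: coeff_eq_deriv)

lemma coeff_0: "0 \<le> s \<Longrightarrow> s \<le> 1 \<Longrightarrow> coeff a b 0 s = 1"
  by (simp add: coeff_eq_deriv f_def)

text \<open>Cauchy's inequality on the circle, with a constant independent of \<open>s\<close>; this
  uniformity justifies integrating the power series in \<open>w\<close> termwise.\<close>

lemma norm_coeff_le:
  obtains K where "\<And>j s. 0 \<le> s \<Longrightarrow> s \<le> 1 \<Longrightarrow> norm (coeff a b j s) \<le> K / (3 * pi / 2) ^ j"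
proof
  define K where "K = S b (1 - a) * S 0 (1 - b) * S 0 (a + b - 1)"
  fix j and s :: real assume s: "0 \<le> s" "s \<le> 1"
  have sub: "cball 0 (3 * pi / 2) \<subseteq> ball (0::complex) (2 * pi)" by (rule cball_subset_ball_2pi)
  have "norm ((deriv ^^ j) (f a b s) 0) \<le> fact j * K / (3 * pi / 2) ^ j"
  proof (rule Cauchy_inequality)
    show "f a b s holomorphic_on ball 0 (3 * pi / 2)"
      by (rule holomorphic_on_subset[OF f_holomorphic[OF s] order_trans[OF ball_subset_cball sub]])
    show "continuous_on (cball 0 (3 * pi / 2)) (f a b s)"
      by (rule holomorphic_on_imp_continuous_on[OF holomorphic_on_subset[OF f_holomorphic[OF s] sub]])
    fix z :: complex assume "norm (0 - z) = 3 * pi / 2"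
    hence z: "norm z = 3 * pi / 2" by simp
    have "exp (- ln (S b (1 - a)) * ((1 - s) / (1 + s)) - ln (S 0 (1 - b)) * (s / (2 - s))) \<le> 1"
    proof -
      have "0 \<le> ln (S b (1 - a)) * ((1 - s) / (1 + s))" "0 \<le> ln (S 0 (1 - b)) * (s / (2 - s))"
        using s by (intro mult_nonneg_nonneg ln_S_nonneg; simp)+
      thus ?thesis unfolding exp_le_one_iff by linarith
    qed
    hence "K * exp (- ln (S b (1 - a)) * ((1 - s) / (1 + s)) - ln (S 0 (1 - b)) * (s / (2 - s))) \<le> K"
      unfolding K_def using S_pos by (intro mult_left_le) (auto intro!: mult_nonneg_nonneg less_imp_le)
    thus "norm (f a b s z) \<le> K" using norm_f_le[OF z s, of a b] unfolding K_def by linarith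
  qed auto
  thus "norm (coeff a b j s) \<le> K / (3 * pi / 2) ^ j"
    using s by (simp add: coeff_eq_deriv norm_divide field_simps)
qed

text \<open>For real \<open>r\<close> the curve runs monotonically along the unit interval, so
  \<open>f a b s r\<close> times the density is the transformed Beta density. All logarithms are
  real here, and the identity is checked by adding exponents.\<close>

lemma beta_functional_f_real:
  assumes ab: "0 < Re a" "0 < Re b" and r: "0 < r" "r < 1"
  shows "beta_functional a b (\<lambda>s. f a b s (of_real r)) = Beta a b"
proof -
  define t where "t = (\<lambda>s. (exp (r * s) - 1) / (exp r - 1))"
  define t' where "t' = (\<lambda>s. r * exp (r * s) / (exp r - 1))"
  have er: "exp r - 1 > 0" using r by simp
  have "((\<lambda>s. of_real (t' s) * beta_density a b (t s)) has_integral Beta a b) {0..1}"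
  proof (rule beta_integral_substitution[OF ab])
    show "continuous_on {0..1} t" unfolding t_def using er by (intro continuous_intros) auto
    show "0 < t s \<and> t s < 1" if "0 < s" "s < 1" for s
      using er r that by (simp add: t_def)
    show "(t has_real_derivative t' s) (at s)" for s
      unfolding t_def t'_def using er by (auto intro!: derivative_eq_intros)
  qed (use er in \<open>simp_all add: t_def\<close>)
  note int = this
  have eq: "of_real (t' s) * beta_density a b (t s) = beta_density a b s * f a b s (of_real r)"
    if s: "s \<in> {0..1} - {0, 1}" for s
  proof -
    have s': "0 < s" "s < 1" using s by auto
    have r3: "\<bar>u\<bar> \<le> 3 * pi / 2" if "0 < u" "u < 1" for u :: real
      using that pi_gt3 by simp
    have rs: "0 < r * s" "r * s < 1" "0 < r * (1 - s)" "r * (1 - s) < 1"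
      using r s' mult_strict_mono[of r 1 s 1] mult_strict_mono[of r 1 "1 - s" 1] by auto
    define L where "L = (\<lambda>u::real. ln (u / (exp u - 1)))"
    have H: "H (of_real u) = of_real (L u)" if "0 < u" "u < 1" for u
      unfolding L_def using that r3[OF that] by (intro H_of_real) auto
    have g: "u / (exp u - 1) > 0" "exp u - 1 > 0" if "0 < u" for u :: real using that by simp_all
    have ln3: "ln (x * y / z) = ln x + ln y - ln z" and ln4: "ln (x * exp e * y / z) = ln x + e + ln y - ln z"
      if "0 < x" "0 < y" "0 < z" for x y z e :: real
      using that by (simp_all add: ln_mult ln_div)
    have Lt: "ln (t s) = ln s + L r - L (r * s)"
    proof -
      have "t s = s * (r / (exp r - 1)) / (r * s / (exp (r * s) - 1))"
        using r s' rs er g(2)[OF rs(1)] by (simp add: t_def field_simps)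
      thus ?thesis using ln3[OF s'(1) g(1)[OF r(1)] g(1)[OF rs(1)]] unfolding L_def by simp
    qed
    have Lu: "ln (1 - t s) = ln (1 - s) + r * s + L r - L (r * (1 - s))"
    proof -
      have "1 - t s = (exp r - exp (r * s)) / (exp r - 1)" using er by (simp add: t_def field_simps)
      also have "exp r - exp (r * s) = exp (r * s) * (exp (r * (1 - s)) - 1)"
        by (simp add: algebra_simps flip: exp_add)
      finally have "1 - t s = exp (r * s) * (exp (r * (1 - s)) - 1) / (exp r - 1)" .
      hence "1 - t s = (1 - s) * exp (r * s) * (r / (exp r - 1)) / (r * (1 - s) / (exp (r * (1 - s)) - 1))"
      proof (rule trans)
        have "u * X * (r / D) / (r * u / V) = X * V / D" if "u \<noteq> 0" "V \<noteq> 0" for u X D V :: real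
          using r that by simp
        from this[of "1 - s" "exp (r * (1 - s)) - 1" "exp (r * s)" "exp r - 1"]
        show "exp (r * s) * (exp (r * (1 - s)) - 1) / (exp r - 1) =
            (1 - s) * exp (r * s) * (r / (exp r - 1)) / (r * (1 - s) / (exp (r * (1 - s)) - 1))"
          using s' g(2)[OF rs(3)] by simp
      qed
      thus ?thesis using ln4[OF _ g(1)[OF r(1)] g(1)[OF rs(3)], of "1 - s" "r * s"] s' unfolding L_def by simp
    qed
    have Lt': "t' s = exp (L r + r * s)" using g(1)[OF r(1)] by (simp add: t'_def L_def exp_add)
    have t01: "0 < t s" "t s < 1" using er r s' by (simp_all add: t_def)
    have pw: "of_real u powr c = exp (c * of_real (ln u))" if "0 < u" for u :: real and c :: complex
      using that by (simp add: powr_def Ln_of_real)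
    have "of_real (t' s) * beta_density a b (t s) =
       exp (of_real (L r + r * s) + (a - 1) * of_real (ln (t s)) + (b - 1) * of_real (ln (1 - t s)))"
      unfolding beta_density_def Lt' using t01 by (simp only: pw diff_gt_0_iff_gt exp_add exp_of_real mult.assoc)
    also have "of_real (L r + r * s) + (a - 1) * of_real (ln (t s)) + (b - 1) * of_real (ln (1 - t s)) =
       (a - 1) * of_real (ln s) + (b - 1) * of_real (ln (1 - s))
        + (E b (1 - a) (of_real (r * s)) + E 0 (1 - b) (of_real (r * (1 - s))) + E 0 (a + b - 1) (of_real r))"
      unfolding Lt Lu E_def H[OF r] H[OF rs(1,2)] H[OF rs(3,4)] by (simp add: algebra_simps)
    also have "exp \<dots> = beta_density a b s * f a b s (of_real r)"
    proof -
      have "beta_density a b s = exp ((a - 1) * of_real (ln s)) * exp ((b - 1) * of_real (ln (1 - s)))"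
        unfolding beta_density_def using s' pw[of s] pw[of "1 - s"] by (simp only: diff_gt_0_iff_gt)
      moreover have "complex_of_real (r * s) = of_real s * of_real r" "complex_of_real (r * (1 - s)) = of_real (1 - s) * of_real r"
        by simp_all
      ultimately show ?thesis unfolding f_def by (simp only: exp_add mult.assoc)
    qed
    finally show ?thesis .
  qed
  have "negligible {0, 1 :: real}" by simp
  from has_integral_spike[OF this eq[symmetric] int]
  have "((\<lambda>s. beta_density a b s * f a b s (of_real r)) has_integral Beta a b) {0..1}" .
  thus ?thesis by (simp add: beta_functional_def integral_unique)
qed

text \<open>The mean \<open>A w\<close> is a convergent power series in \<open>w\<close> that is
  constant on the real interval from 0 to 1, hence constant on the disc. Comparing coefficients
  shows that every higher Taylor coefficient has mean 0, which is what makes \<kappa> free in the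
  error estimate.\<close>

lemma beta_functional_coeff:
  assumes ab: "0 < Re a" "0 < Re b"
  shows "norm w < 3 * pi / 2 \<Longrightarrow> beta_functional a b (\<lambda>s. f a b s w) = Beta a b"
    and "0 < j \<Longrightarrow> beta_functional a b (coeff a b j) = 0"
proof -
  define A where "A = (\<lambda>w. beta_functional a b (\<lambda>s. f a b s w))"
  obtain K where K: "\<And>j s. 0 \<le> s \<Longrightarrow> s \<le> 1 \<Longrightarrow> norm (coeff a b j s) \<le> K / (3 * pi / 2) ^ j"
    using norm_coeff_le by blast
  have sums: "(\<lambda>j. beta_functional a b (coeff a b j) * w ^ j) sums A w" if w: "norm w < 3 * pi / 2" for w
  proof -
    have w2: "norm w < 2 * pi" using w pi_gt_zero by linarith
    have "(\<lambda>j. beta_functional a b (\<lambda>s. w ^ j * coeff a b j s)) sums A w"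
      unfolding A_def
    proof (rule beta_functional_sums[OF ab])
      show "continuous_on {0..1} (\<lambda>s. w ^ j * coeff a b j s)" for j
        by (intro continuous_on_mult continuous_on_const continuous_on_coeff)
      show "continuous_on {0..1} (\<lambda>s. f a b s w)" by (rule continuous_on_f[OF w2])
      show "summable (\<lambda>j. K * (norm w / (3 * pi / 2)) ^ j)"
        using w pi_gt_zero by (intro summable_mult summable_geometric) (simp add: divide_less_eq)
      fix s :: real assume s: "0 \<le> s" "s \<le> 1"
      show "(\<lambda>j. w ^ j * coeff a b j s) sums f a b s w"
        using coeff_sums[OF s w2, of a b] by (simp add: mult.commute)
      fix j
      have "norm w ^ j * norm (coeff a b j s) \<le> norm w ^ j * (K / (3 * pi / 2) ^ j)"
        using K[OF s] by (intro mult_left_mono) auto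
      moreover have "x ^ j * (K / r ^ j) = K * (x / r) ^ j" for x r :: real by (simp add: power_divide)
      ultimately show "norm (w ^ j * coeff a b j s) \<le> K * (norm w / (3 * pi / 2)) ^ j"
        by (simp only: norm_mult norm_power)
    qed
    thus ?thesis by (simp add: beta_functional_cmult mult.commute)
  qed
  have hol: "A holomorphic_on ball 0 (3 * pi / 2)"
    by (rule power_series_holomorphic[of 0 _ "\<lambda>j. beta_functional a b (coeff a b j)"]) (use sums in simp)
  have A: "A w = Beta a b" if w: "norm w < 3 * pi / 2" for w
  proof -
    have "A w - Beta a b = 0"
    proof (rule analytic_continuation[of "\<lambda>w. A w - Beta a b" "ball 0 (3 * pi / 2)" "of_real ` {0<..<1}" 0])
      show "of_real ` {0<..<1} \<subseteq> ball (0::complex) (3 * pi / 2)" using pi_gt3 by auto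
      show "0 islimpt (complex_of_real ` {0<..<1})"
        unfolding islimpt_approachable
      proof safe
        fix e :: real assume "0 < e"
        thus "\<exists>x'\<in>complex_of_real ` {0<..<1}. x' \<noteq> 0 \<and> dist x' 0 < e"
          by (intro bexI[of _ "of_real (min (e / 2) (1 / 2))"]) (auto simp: min_def)
      qed
      show "A z - Beta a b = 0" if "z \<in> of_real ` {0<..<1}" for z
        using that beta_functional_f_real[OF ab] by (auto simp: A_def)
    qed (use hol w in \<open>auto intro!: holomorphic_intros\<close>)
    thus ?thesis by simp
  qed
  thus "beta_functional a b (\<lambda>s. f a b s w) = Beta a b" if "norm w < 3 * pi / 2"
    using that by (simp add: A_def)
  have "(\<lambda>_. Beta a b) has_fps_expansion Abs_fps (\<lambda>j. beta_functional a b (coeff a b j))"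
  proof (rule has_fps_expansionI)
    have "\<forall>\<^sub>F z in nhds 0. z \<in> ball (0::complex) (3 * pi / 2)"
      by (intro eventually_nhds_in_open) auto
    thus "\<forall>\<^sub>F z in nhds 0. (\<lambda>j. fps_nth (Abs_fps (\<lambda>j. beta_functional a b (coeff a b j))) j * z ^ j) sums Beta a b"
      by eventually_elim (use sums A in force)
  qed
  from fps_nth_fps_expansion[OF this, of j]
  show "beta_functional a b (coeff a b j) = 0" if "0 < j"
    using that by simp
qed

text \<open>The exponential is the \<open>n\<close>-th power of
  \<open>1 + (exp w - 1) * curve w s\<close>. The binomial theorem and the moments of the curve
  reproduce \<open>P_poly_eq_sum\<close> term by term.\<close>

lemma P_poly_integral:
  assumes ab: "0 < Re a" "0 < Re b" and w: "norm w < 3 * pi / 2" "w \<noteq> 0"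
  shows "beta_functional a b (\<lambda>s. exp (of_nat n * w * of_real s) * f a b s w) =
    hyp2f1 (- of_nat n) a (a + b) (1 - exp w) * Beta a b"
proof -
  have w2: "norm w < 2 * pi" using w pi_gt_zero by linarith
  have ew: "exp w \<noteq> 1" using exp_neq_1_disc[OF w2 w(2)] .
  have cont: "continuous_on {0..1} (\<lambda>s. f a b s w * curve w (of_real s) ^ m)" for m
    unfolding curve_def using ew by (intro continuous_intros continuous_on_f w2) auto
  have "exp (of_nat n * w * of_real s) * f a b s w =
      (\<Sum>m\<le>n. (of_nat (n choose m) * (exp w - 1) ^ m) * (f a b s w * curve w (of_real s) ^ m))" for s
  proof -
    have "exp (of_nat n * w * of_real s) = exp (w * of_real s) ^ n" by (simp add: mult.assoc exp_of_nat_mult)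
    also have "exp (w * of_real s) = (exp w - 1) * curve w (of_real s) + 1" using ew by (simp add: curve_def)
    also have "\<dots> ^ n = (\<Sum>m\<le>n. of_nat (n choose m) * ((exp w - 1) * curve w (of_real s)) ^ m)"
      by (subst binomial_ring) simp
    finally show ?thesis by (simp add: sum_distrib_left sum_distrib_right power_mult_distrib mult_ac)
  qed
  hence "beta_functional a b (\<lambda>s. exp (of_nat n * w * of_real s) * f a b s w) =
     beta_functional a b (\<lambda>s. \<Sum>m\<le>n. (of_nat (n choose m) * (exp w - 1) ^ m) * (f a b s w * curve w (of_real s) ^ m))"
    by simp
  also have "\<dots> = (\<Sum>m\<le>n. (of_nat (n choose m) * (exp w - 1) ^ m) * (pochhammer a m / pochhammer (a + b) m * Beta a b))"
    by (subst beta_functional_sum[OF ab])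
      (simp, intro continuous_on_mult continuous_on_const cont,
       simp only: beta_functional_cmult curve_moment[OF ab w2 w(2)] beta_functional_coeff(1)[OF ab w(1)])
  finally show ?thesis unfolding P_poly_eq_sum by (simp add: sum_distrib_left sum_distrib_right mult_ac)
qed

end

section \<open>The error bound\<close>

definition expansion_term :: "complex \<Rightarrow> complex \<Rightarrow> complex \<Rightarrow> nat \<Rightarrow> complex" where
  "expansion_term a b \<zeta> j = (\<Sum>(i1, i2, i3)\<in>{(i1, i2, i3). i1 + i2 + i3 = j}.
     gen_bernoulli i1 (1 - a) b / fact i1 * (gen_bernoulli i2 (1 - b) 0 / fact i2)
     * (gen_bernoulli i3 (a + b - 1) 0 / fact i3)
     * (pochhammer a i1 * pochhammer b i2 / pochhammer (a + b) (i1 + i2))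
     * hyp1f1 (a + of_nat i1) (a + b + of_nat i1 + of_nat i2) \<zeta>)"

text \<open>Passing to absolute values replaces \<open>norm (Beta a b)\<close> by the Beta function
  of the real parts. Its third Gamma factor is removed by \<open>norm_Gamma_le\<close> at
  \<open>a + b\<close>, so only quotients for \<open>a\<close> and \<open>b\<close> survive.\<close>

lemma Beta_ratio_le:
  assumes "0 < Re a" "0 < Re b"
  shows "Beta (Re a) (Re b) \<le> Gamma (Re a) * Gamma (Re b) / (norm (Gamma a) * norm (Gamma b)) * norm (Beta a b)"
    and "Beta a b \<noteq> 0"
proof -
  have nz: "Gamma a \<noteq> 0" "Gamma b \<noteq> 0" "Gamma (a + b) \<noteq> 0"
    using not_nonpos_Int[of a] not_nonpos_Int[of b] not_nonpos_Int[of "a + b"] assms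
    by (simp_all add: Gamma_eq_zero_iff)
  thus "Beta a b \<noteq> 0" by (simp add: Beta_def)
  have pos: "0 < Gamma (Re a)" "0 < Gamma (Re b)" using assms by simp_all
  have "norm (Gamma (a + b)) \<le> Gamma (Re a + Re b)"
    using norm_Gamma_le[of "a + b"] assms by simp
  hence "Gamma (Re a) * Gamma (Re b) / Gamma (Re a + Re b) \<le> Gamma (Re a) * Gamma (Re b) / norm (Gamma (a + b))"
    using nz pos assms by (intro divide_left_mono mult_pos_pos Gamma_real_pos) auto
  thus "Beta (Re a) (Re b) \<le> Gamma (Re a) * Gamma (Re b) / (norm (Gamma a) * norm (Gamma b)) * norm (Beta a b)"
    using nz by (simp add: Beta_def norm_mult norm_divide)
qed

context log_branch
begin

lemma beta_functional_exp_coeff: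
  assumes ab: "0 < Re a" "0 < Re b"
  shows "beta_functional a b (\<lambda>s. exp (\<zeta> * of_real s) * coeff a b j s) = expansion_term a b \<zeta> j * Beta a b"
proof -
  define T where "T = {(i1, i2, i3). i1 + i2 + i3 = j}"
  define B where "B = (\<lambda>p. case p of (i1, i2, i3) \<Rightarrow> gen_bernoulli i1 (1 - a) b / fact i1 * (gen_bernoulli i2 (1 - b) 0 / fact i2)
     * (gen_bernoulli i3 (a + b - 1) 0 / fact i3))"
  define m where "m = (\<lambda>p s. case p of (i1::nat, i2::nat, i3::nat) \<Rightarrow> of_real s ^ i1 * of_real (1 - s) ^ i2 * exp (\<zeta> * complex_of_real s))"
  have "beta_functional a b (\<lambda>s. exp (\<zeta> * of_real s) * coeff a b j s) = beta_functional a b (\<lambda>s. \<Sum>p\<in>T. B p * m p s)"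
    unfolding coeff_def T_def B_def m_def by (simp add: sum_distrib_left case_prod_unfold mult_ac)
  also have "\<dots> = (\<Sum>p\<in>T. beta_functional a b (\<lambda>s. B p * m p s))"
  proof (rule beta_functional_sum[OF ab])
    show "finite T" unfolding T_def by (rule finite_triples)
    show "continuous_on {0..1} (\<lambda>s. B p * m p s)" for p
      unfolding m_def case_prod_unfold by (intro continuous_intros)
  qed
  also have "\<dots> = expansion_term a b \<zeta> j * Beta a b"
    unfolding expansion_term_def T_def[symmetric] sum_distrib_right
  proof (rule sum.cong[OF refl])
    fix p :: "nat \<times> nat \<times> nat"
    obtain i1 i2 i3 where p: "p = (i1, i2, i3)" by (cases p)
    show "beta_functional a b (\<lambda>s. B p * m p s) = (case p of (i1, i2, i3) \<Rightarrow>
       gen_bernoulli i1 (1 - a) b / fact i1 * (gen_bernoulli i2 (1 - b) 0 / fact i2)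
       * (gen_bernoulli i3 (a + b - 1) 0 / fact i3)
       * (pochhammer a i1 * pochhammer b i2 / pochhammer (a + b) (i1 + i2))
       * hyp1f1 (a + of_nat i1) (a + b + of_nat i1 + of_nat i2) \<zeta>) * Beta a b"
      unfolding beta_functional_cmult unfolding p m_def B_def case_prod_conv beta_functional_exp_moment[OF ab]
      by (simp only: mult_ac)
  qed
  finally show ?thesis .
qed

lemma expansion_remainder_bound:
  assumes ab: "0 < Re a" "0 < Re b" and \<theta>: "\<bar>\<theta>\<bar> \<le> pi" "\<theta> \<noteq> 0" and n: "1 \<le> n"
    and w: "w = \<i> * of_real \<theta> / of_nat n" and q: "q = 2 * \<bar>\<theta>\<bar> / (3 * pi * real n)"
  shows "norm (hyp2f1 (- of_nat n) a (a + b) (1 - exp w) -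
      (hyp1f1 a (a + b) (\<i> * of_real \<theta>) + (\<Sum>j=1..k. expansion_term a b (\<i> * of_real \<theta>) j * w ^ j)))
    \<le> Gamma (Re a) * Gamma (Re b) / (norm (Gamma a) * norm (Gamma b)) *
       (1 / (1 + q) * q ^ Suc k * (S b (1 - a) * S 0 (1 - b) * S 0 (a + b - 1)))"
proof -
  define C where "C = S b (1 - a) * S 0 (1 - b) * S 0 (a + b - 1)"
  define \<zeta> where "\<zeta> = \<i> * complex_of_real \<theta>"
  define D where "D = hyp2f1 (- of_nat n) a (a + b) (1 - exp w) -
      (hyp1f1 a (a + b) \<zeta> + (\<Sum>j=1..k. expansion_term a b \<zeta> j * w ^ j))"
  have C: "0 < C" unfolding C_def by (intro mult_pos_pos S_pos)
  have q0: "0 \<le> q" unfolding q by simp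
  have q1: "q \<le> 2 / 3"
  proof -
    have "\<bar>\<theta>\<bar> \<le> pi * real n" using \<theta> order_trans[OF _ mult_left_mono[of 1 "real n" pi], of "\<bar>\<theta>\<bar>"] n by simp
    thus ?thesis unfolding q using n by (simp add: divide_simps)
  qed
  have nw: "norm w = q * (3 * pi / 2)" using n by (simp add: w q norm_mult norm_divide)
  have w1: "norm w < 3 * pi / 2" unfolding nw using q1 pi_gt_zero by simp
  have w2: "norm w < 2 * pi" using w1 pi_gt_zero by linarith
  have w0: "w \<noteq> 0" using \<theta> n by (simp add: w)
  have nwz: "of_nat n * w = \<zeta>" using n by (simp add: w \<zeta>_def)
  define tail where "tail = (\<lambda>s. f a b s w - (\<Sum>j\<le>k. w ^ j * coeff a b j s))"
  have cont_e: "continuous_on {0..1} (\<lambda>s. exp (\<zeta> * complex_of_real s))" by (intro continuous_intros)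
  have cont_t: "continuous_on {0..1} (\<lambda>s. \<Sum>j\<le>k. w ^ j * coeff a b j s)"
    by (intro continuous_on_sum continuous_on_mult continuous_on_const continuous_on_coeff)
  have cont: "continuous_on {0..1} tail"
    unfolding tail_def by (intro continuous_on_diff continuous_on_f w2 cont_t)
  have "beta_functional a b tail = Beta a b - (\<Sum>j\<le>k. w ^ j * beta_functional a b (coeff a b j))"
    unfolding tail_def
    by (subst beta_functional_diff[OF ab continuous_on_f[OF w2] cont_t], subst beta_functional_sum[OF ab])
      (simp, intro continuous_on_mult continuous_on_const continuous_on_coeff,
       simp only: beta_functional_cmult beta_functional_coeff(1)[OF ab w1])
  also have "(\<Sum>j\<le>k. w ^ j * beta_functional a b (coeff a b j)) = (\<Sum>j\<in>{0}. w ^ j * beta_functional a b (coeff a b j))"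
    by (rule sum.mono_neutral_right) (auto simp: beta_functional_coeff(2)[OF ab])
  also have "beta_functional a b (coeff a b 0) = beta_functional a b (\<lambda>_. 1)"
    unfolding beta_functional_def by (intro integral_cong) (simp add: coeff_0)
  hence "(\<Sum>j\<in>{0}. w ^ j * beta_functional a b (coeff a b j)) = Beta a b"
    by (simp add: beta_integral_complex[OF ab])
  finally have tail0: "beta_functional a b tail = 0" by simp
  \<comment> \<open>Subtracting \<kappa> costs nothing because the tail has mean 0. The identity is
    proved for all \<kappa>, since the suitable one is produced only later by
    \<open>kernel_majorant\<close>.\<close>
  have DB: "D * Beta a b = beta_functional a b (\<lambda>s. (exp (\<zeta> * of_real s) - \<kappa>) * tail s)" for \<kappa>
  proof -
    have "beta_functional a b (\<lambda>s. (exp (\<zeta> * of_real s) - \<kappa>) * tail s) =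
       beta_functional a b (\<lambda>s. exp (\<zeta> * of_real s) * tail s) - beta_functional a b (\<lambda>s. \<kappa> * tail s)"
      unfolding left_diff_distrib
      by (intro beta_functional_diff ab continuous_on_mult cont_e cont continuous_on_const)
    also have "beta_functional a b (\<lambda>s. \<kappa> * tail s) = 0" unfolding beta_functional_cmult tail0 by simp
    also have "(\<lambda>s. exp (\<zeta> * of_real s) * tail s) = (\<lambda>s. exp (of_nat n * w * of_real s) * f a b s w
        - (\<Sum>j\<le>k. w ^ j * (exp (\<zeta> * of_real s) * coeff a b j s)))"
      unfolding tail_def nwz by (simp add: right_diff_distrib sum_distrib_left mult_ac)
    also have "beta_functional a b \<dots> = hyp2f1 (- of_nat n) a (a + b) (1 - exp w) * Beta a b
        - (\<Sum>j\<le>k. w ^ j * (expansion_term a b \<zeta> j * Beta a b))"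
    proof -
      have c1: "continuous_on {0..1} (\<lambda>s. exp (of_nat n * w * of_real s) * f a b s w)"
        unfolding nwz by (intro continuous_on_mult cont_e continuous_on_f w2)
      have c2: "continuous_on {0..1} (\<lambda>s. w ^ j * (exp (\<zeta> * of_real s) * coeff a b j s))" for j
        by (intro continuous_on_mult cont_e continuous_on_const continuous_on_coeff)
      have c3: "continuous_on {0..1} (\<lambda>s. \<Sum>j\<le>k. w ^ j * (exp (\<zeta> * of_real s) * coeff a b j s))"
        by (intro continuous_on_sum c2)
      show ?thesis
        unfolding beta_functional_diff[OF ab c1 c3] beta_functional_sum[OF ab finite_atMost c2]
          beta_functional_cmult beta_functional_exp_coeff[OF ab] P_poly_integral[OF ab w1 w0] by (rule refl)
    qed
    also have "(\<Sum>j\<le>k. w ^ j * (expansion_term a b \<zeta> j * Beta a b)) =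
        expansion_term a b \<zeta> 0 * Beta a b + (\<Sum>j=1..k. expansion_term a b \<zeta> j * w ^ j) * Beta a b"
      by (simp add: sum.atMost_shift sum.atLeast1_atMost_eq lessThan_Suc_atMost sum_distrib_left sum_distrib_right mult_ac)
    also have "expansion_term a b \<zeta> 0 * Beta a b = hyp1f1 a (a + b) \<zeta> * Beta a b"
    proof -
      have "beta_functional a b (\<lambda>s. exp (\<zeta> * of_real s) * coeff a b 0 s) = beta_functional a b (\<lambda>s. exp (\<zeta> * of_real s))"
        unfolding beta_functional_def by (intro integral_cong) (simp add: coeff_0)
      thus ?thesis unfolding beta_functional_exp_coeff[OF ab] beta_functional_exp[OF ab] .
    qed
    finally show ?thesis by (simp add: D_def algebra_simps)
  qed
  define m1 m2 where "m1 = ln (S b (1 - a))" "m2 = ln (S 0 (1 - b))"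
  have m1: "1.298 * Re b \<le> m1" "4.712 * Re b - 3.163 * (1 - Re a) \<le> m1 \<or> 4.712 * Re b - 3.14 * (1 - Re a) \<le> m1"
      "1.203 * (1 - Re a) \<le> m1"
    unfolding m1_m2_def using ab by (intro ln_S_ge; simp)+
  have m2: "0 \<le> m2" "1.55 * (1 - Re b) \<le> m2"
    unfolding m1_m2_def using ln_S_ge(4)[of 0 b] ln_S_nonneg by simp_all
  obtain \<kappa> G I where I: "I \<le> 0.5205 * Beta (Re a) (Re b)"
    and G: "((\<lambda>s. s powr (Re a - 1) * (1 - s) powr (Re b - 1) * G s) has_integral I) {0..1}"
    and le: "\<And>s. 0 \<le> s \<Longrightarrow> s \<le> 1 \<Longrightarrow> norm (exp (\<i> * of_real (\<theta> * s)) - \<kappa>)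
        * exp (- m1 * ((1 - s) / (1 + s)) - m2 * (s / (2 - s))) \<le> G s"
    by (rule kernel_majorant[OF ab \<theta>(1) m1 m2]) (rule that)
  define K where "K = 1.15265 * C * q ^ Suc k"
  have K0: "0 \<le> K" unfolding K_def using C q0 by simp
  have "norm (beta_functional a b (\<lambda>s. (exp (\<zeta> * of_real s) - \<kappa>) * tail s)) \<le> K * I"
  proof (rule norm_beta_functional_le[OF ab])
    show "continuous_on {0..1} (\<lambda>s. (exp (\<zeta> * of_real s) - \<kappa>) * tail s)"
      by (intro continuous_on_mult continuous_on_diff cont_e cont continuous_on_const)
    show "((\<lambda>s. s powr (Re a - 1) * (1 - s) powr (Re b - 1) * (K * G s)) has_integral K * I) {0..1}"
      using has_integral_mult_right[OF G, of K] by (simp add: mult_ac)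
    fix s :: real assume s: "0 \<le> s" "s \<le> 1"
    define W where "W = exp (- m1 * ((1 - s) / (1 + s)) - m2 * (s / (2 - s)))"
    have "norm (f a b s w - (\<Sum>j\<le>k. (deriv ^^ j) (f a b s) 0 / fact j * w ^ j)) \<le> 1.15265 * (C * W) * q ^ Suc k"
    proof (rule Taylor_remainder_bound[OF f_holomorphic[OF s] _ _ _ nw q0 q1])
      show "3 * pi / 2 < 2 * pi" using pi_gt_zero by linarith
      show "norm (f a b s z) \<le> C * W" if "norm z = 3 * pi / 2" for z
        using norm_f_le[OF that s, of a b] unfolding C_def W_def m1_m2_def .
    qed simp
    hence t: "norm (tail s) \<le> K * W"
      unfolding tail_def K_def by (simp add: coeff_eq_deriv[OF s] mult_ac)
    have e: "exp (\<zeta> * of_real s) = exp (\<i> * of_real (\<theta> * s))" by (simp add: \<zeta>_def mult_ac)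
    have "norm ((exp (\<zeta> * of_real s) - \<kappa>) * tail s) \<le> norm (exp (\<i> * of_real (\<theta> * s)) - \<kappa>) * (K * W)"
      unfolding norm_mult e by (intro mult_left_mono t) auto
    also have "\<dots> = K * (norm (exp (\<i> * of_real (\<theta> * s)) - \<kappa>) * W)" by (simp only: mult_ac)
    also have "\<dots> \<le> K * G s" using le[OF s] unfolding W_def by (intro mult_left_mono K0)
    finally show "norm ((exp (\<zeta> * of_real s) - \<kappa>) * tail s) \<le> K * G s" .
  qed
  hence "norm D * norm (Beta a b) \<le> K * I" unfolding DB[of \<kappa>, symmetric] norm_mult .
  also have "\<dots> \<le> K * (0.5205 * Beta (Re a) (Re b))" by (intro mult_left_mono I K0)
  also have "\<dots> \<le> K * (0.5205 * (Gamma (Re a) * Gamma (Re b) / (norm (Gamma a) * norm (Gamma b)) * norm (Beta a b)))"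
    using Beta_ratio_le(1)[OF ab] by (intro mult_left_mono K0) auto
  also have "\<dots> = (K * 0.5205 * (Gamma (Re a) * Gamma (Re b) / (norm (Gamma a) * norm (Gamma b)))) * norm (Beta a b)"
    by (simp only: mult_ac)
  finally have "norm D \<le> K * 0.5205 * (Gamma (Re a) * Gamma (Re b) / (norm (Gamma a) * norm (Gamma b)))"
    by (rule mult_right_le_imp_le) (use Beta_ratio_le(2)[OF ab] in simp)
  also have "\<dots> \<le> (1 / (1 + q) * q ^ Suc k * C) * (Gamma (Re a) * Gamma (Re b) / (norm (Gamma a) * norm (Gamma b)))"
  proof (rule mult_right_mono)
    have "1.15265 * 0.5205 \<le> 1 / (1 + q)" using q0 q1 by (simp add: field_simps)
    hence "1.15265 * 0.5205 * (q ^ Suc k * C) \<le> 1 / (1 + q) * (q ^ Suc k * C)"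
      using q0 C by (intro mult_right_mono) auto
    thus "K * 0.5205 \<le> 1 / (1 + q) * q ^ Suc k * C" unfolding K_def by (simp only: mult_ac)
    show "0 \<le> Gamma (Re a) * Gamma (Re b) / (norm (Gamma a) * norm (Gamma b))"
      using ab by (simp add: less_imp_le)
  qed
  finally show ?thesis unfolding D_def \<zeta>_def C_def by (simp only: mult.commute)
qed

text \<open>For \<open>b = 0\<close> the Beta distribution degenerates to the point
  \<open>s = 1\<close>: \<open>pochhammer 0 i2\<close> vanishes unless \<open>i2 = 0\<close>,
  exactly as \<open>(1 - s) ^ i2\<close> does there. The sums thus become multiples of the Taylor
  coefficients of \<open>f a 0 1\<close>, which is constantly 1.\<close>

lemma expansion_exact:
  assumes a: "0 < Re a" and n: "1 \<le> n" and w: "of_nat n * w = \<zeta>"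
  shows "hyp2f1 (- of_nat n) a (a + 0) (1 - exp w) =
      hyp1f1 a (a + 0) \<zeta> + (\<Sum>j=1..k. expansion_term a 0 \<zeta> j * w ^ j)"
proof -
  have hyp: "hyp1f1 c c \<zeta> = exp \<zeta>" if "0 < Re c" for c
    using pochhammer_nonzero[OF that] exp_converges[of \<zeta>]
    by (simp add: hyp1f1_series sums_iff scaleR_conv_of_real field_simps)
  have "expansion_term a 0 \<zeta> j = 0" if j: "1 \<le> j" for j
  proof -
    have "expansion_term a 0 \<zeta> j = exp \<zeta> * coeff a 0 j 1"
      unfolding expansion_term_def coeff_def sum_distrib_left
    proof (rule sum.cong[OF refl], clarsimp)
      fix i1 i2 i3 :: nat
      show "gen_bernoulli i1 (1 - a) 0 * gen_bernoulli i2 1 0 * gen_bernoulli i3 (a - 1) 0 *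
          (pochhammer a i1 * pochhammer 0 i2) * hyp1f1 (a + of_nat i1) (a + of_nat i1 + of_nat i2) \<zeta> /
          (fact i1 * fact i2 * fact i3 * pochhammer a (i1 + i2)) =
          exp \<zeta> * (gen_bernoulli i1 (1 - a) 0 * gen_bernoulli i2 1 0 * gen_bernoulli i3 (a - 1) 0 * 0 ^ i2) /
          (fact i1 * fact i2 * fact i3)"
        using pochhammer_nonzero[OF a] hyp[of "a + of_nat i1"] a by (cases i2) (auto simp: pochhammer_0_left)
    qed
    moreover have "f a 0 1 = (\<lambda>z. 1)"
      by (rule ext) (simp add: f_def E_def H_0 algebra_simps flip: exp_add)
    hence "coeff a 0 j 1 = 0" using j by (simp add: coeff_eq_deriv)
    ultimately show ?thesis by simp
  qed
  moreover have "hyp2f1 (- of_nat n) a (a + 0) (1 - exp w) = exp \<zeta>"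
  proof -
    have "hyp2f1 (- of_nat n) a a (1 - exp w) = (\<Sum>m\<le>n. of_nat (n choose m) * (exp w - 1) ^ m)"
      unfolding P_poly_eq_sum using pochhammer_nonzero[OF a] by simp
    also have "\<dots> = ((exp w - 1) + 1) ^ n" by (subst binomial_ring) simp
    also have "\<dots> = exp \<zeta>" by (simp flip: w add: exp_of_nat_mult)
    finally show ?thesis by simp
  qed
  ultimately show ?thesis using hyp[OF a] by simp
qed

end

section \<open>The bound in extended reals and the degenerate cases\<close>

lemma hyp1f1_0: "hyp1f1 a c 0 = 1"
  unfolding hyp1f1_series using powser_zero[of "\<lambda>m. pochhammer a m / pochhammer c m / fact m"] by simp

lemma Gamma_quot_pos:
  assumes "0 \<le> Re w"
  shows "0 < Gamma_quot w"
proof (cases "Re w = 0")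
  case False
  hence "0 < Re w" using assms by simp
  thus ?thesis using not_nonpos_Int[of w] by (auto simp: Gamma_quot_def Gamma_eq_zero_iff)
qed (simp add: Gamma_quot_def)

theorem theorem1:
  fixes \<alpha> \<beta> :: complex
  assumes "(\<alpha>, \<beta>) \<in> Omega"
  shows "\<exists>R :: nat \<Rightarrow> nat \<Rightarrow> real \<Rightarrow> complex.
    \<forall>\<theta>\<in>{-pi..<pi}. \<forall>n\<ge>1. \<forall>k\<ge>1.
      P_poly n \<alpha> \<beta> (exp (\<i> * of_real \<theta> / of_nat n)) =
        hyp1f1 (\<alpha> + \<beta> + 1) (2 * \<alpha> + 1) (\<i> * of_real \<theta>)
        + (\<Sum>j=1..k. \<Sum>(i1, i2, i3)\<in>{(i1, i2, i3). i1 + i2 + i3 = j}.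
             gen_bernoulli i1 (- \<alpha> - \<beta>) (\<alpha> - \<beta>) / fact i1
             * (gen_bernoulli i2 (- \<alpha> + \<beta> + 1) 0 / fact i2)
             * (gen_bernoulli i3 (2 * \<alpha>) 0 / fact i3)
             * (pochhammer (\<alpha> + \<beta> + 1) i1 * pochhammer (\<alpha> - \<beta>) i2
                / pochhammer (2 * \<alpha> + 1) (i1 + i2))
             * hyp1f1 (1 + \<alpha> + \<beta> + of_nat i1) (1 + 2 * \<alpha> + of_nat i1 + of_nat i2)
                 (\<i> * of_real \<theta>)
             * (\<i> * of_real \<theta> / of_nat n) ^ j)
        + R k n \<theta>
      \<and> ereal (norm (R k n \<theta>)) \<le>
          Gamma_quot (\<alpha> + \<beta> + 1) * Gamma_quot (\<alpha> - \<beta>)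
          * ereal (\<bar>1 / (1 - 2 * \<theta> / (3 * pi * real n))\<bar>
                   * \<bar>2 * \<theta> / (3 * pi * real n)\<bar> ^ (k + 1)
                   * C_const \<alpha> \<beta>)"
proof -
  obtain H where H: "H holomorphic_on ball 0 (2 * pi)" "H 0 = 0"
    "\<And>z. z \<in> ball 0 (2 * pi) \<Longrightarrow> z \<noteq> 0 \<Longrightarrow> exp (H z) = z / (exp z - 1)"
    using log_branch_exists by blast
  interpret log_branch H by standard (use H in auto)
  define a b where "a = \<alpha> + \<beta> + 1" "b = \<alpha> - \<beta>"
  have a: "0 < Re a" and b: "0 \<le> Re b" using assms by (auto simp: a_b_def Omega_def)
  have eqs: "- \<alpha> - \<beta> = 1 - a" "- \<alpha> + \<beta> + 1 = 1 - b" "2 * \<alpha> = a + b - 1" "1 + \<alpha> + \<beta> = a"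
    "1 + (a + b - 1) = a + b" "a + b - 1 + 1 = a + b" by (simp_all add: a_b_def)
  have C: "C_const \<alpha> \<beta> = S b (1 - a) * S 0 (1 - b) * S 0 (a + b - 1)"
    unfolding C_const_eq a_b_def(2)[symmetric] eqs ..
  have C0: "0 < C_const \<alpha> \<beta>" unfolding C by (intro mult_pos_pos S_pos)
  define R where "R = (\<lambda>k n \<theta>. hyp2f1 (- of_nat n) a (a + b) (1 - exp (\<i> * of_real \<theta> / of_nat n)) -
      (hyp1f1 a (a + b) (\<i> * of_real \<theta>) + (\<Sum>j=1..k. expansion_term a b (\<i> * of_real \<theta>) j * (\<i> * of_real \<theta> / of_nat n) ^ j)))"
  have bound: "ereal (norm (R k n \<theta>)) \<le> Gamma_quot a * Gamma_quot b
      * ereal (\<bar>1 / (1 - 2 * \<theta> / (3 * pi * real n))\<bar> * \<bar>2 * \<theta> / (3 * pi * real n)\<bar> ^ (k + 1) * C_const \<alpha> \<beta>)"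
    if \<theta>: "\<theta> \<in> {-pi..<pi}" and n: "1 \<le> n" for k n \<theta>
  proof -
    define q where "q = 2 * \<bar>\<theta>\<bar> / (3 * pi * real n)"
    define u where "u = 2 * \<theta> / (3 * pi * real n)"
    define F where "F = \<bar>1 / (1 - u)\<bar> * \<bar>u\<bar> ^ (k + 1) * C_const \<alpha> \<beta>"
    have u: "\<bar>u\<bar> = q" using n by (simp add: u_def q_def abs_mult)
    have \<theta>': "\<bar>\<theta>\<bar> \<le> pi" using \<theta> by auto
    have q1: "q \<le> 2 / 3"
    proof -
      have "\<bar>\<theta>\<bar> \<le> pi * real n" using \<theta>' order_trans[OF _ mult_left_mono[of 1 "real n" pi], of "\<bar>\<theta>\<bar>"] n by simp
      thus ?thesis unfolding q_def using n by (simp add: divide_simps)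
    qed
    have F0: "0 \<le> F" unfolding F_def using C0 by simp
    have "ereal (norm (R k n \<theta>)) \<le> Gamma_quot a * Gamma_quot b * ereal F"
    \<comment> \<open>At \<theta> = 0 the factor \<open>F\<close> is 0, and the extended real
      product of \<infinity> and 0 is 0, so the remainder must vanish exactly even if a Gamma
      quotient is infinite.\<close>
    proof (cases "\<theta> = 0 \<or> b = 0")
      case True
      have "R k n \<theta> = 0"
      proof (cases "b = 0")
        case True
        show ?thesis unfolding R_def True
          using expansion_exact[OF a n, of "\<i> * of_real \<theta> / of_nat n" "\<i> * of_real \<theta>" k] n by simp
      next
        case False
        hence "\<theta> = 0" using \<open>\<theta> = 0 \<or> b = 0\<close> by simp
        moreover have "hyp2f1 (- of_nat n) a (a + b) (1 - 1) = 1"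
          unfolding P_poly_eq_sum by (simp add: power_0_left if_distrib cong: if_cong)
        moreover have "(\<Sum>j=1..k. expansion_term a b 0 j * 0 ^ j) = 0"
          by (intro sum.neutral) auto
        ultimately show ?thesis by (simp add: R_def hyp1f1_0)
      qed
      moreover have "0 \<le> Gamma_quot a * Gamma_quot b * ereal F"
        using Gamma_quot_pos[of a] Gamma_quot_pos[OF b] a F0 by (intro ereal_0_le_mult) auto
      ultimately show ?thesis by (simp add: zero_ereal_def)
    next
      case False
      have u0: "0 < \<bar>u\<bar>" using False n by (simp add: u_def)
      \<comment> \<open>For either sign of \<theta> the claimed factor is at least
        \<open>1 / (1 + q)\<close>, so the estimate for negative \<theta> covers both signs.\<close>
      have F1: "1 / (1 + q) * q ^ Suc k * C_const \<alpha> \<beta> \<le> F"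
      proof -
        have "\<bar>1 - u\<bar> \<le> 1 + q" "0 < \<bar>1 - u\<bar>" using u q1 by auto
        hence "1 / (1 + q) \<le> \<bar>1 / (1 - u)\<bar>" by (simp add: abs_divide frac_le)
        thus ?thesis unfolding F_def u Suc_eq_plus1 using C0 u0 u by (intro mult_right_mono) simp_all
      qed
      show ?thesis
      proof (cases "Re b = 0")
        case True
        \<comment> \<open>Strict positivity of \<open>F\<close> is what makes the right side
          infinite here, because \<infinity> times 0 would be 0.\<close>
        have "0 < 1 / (1 + q) * q ^ Suc k * C_const \<alpha> \<beta>" using u0 u C0 by (intro mult_pos_pos) auto
        hence "0 < F" using F1 by linarith
        moreover have "Gamma_quot b = \<infinity>" using True False by (simp add: Gamma_quot_def)
        moreover have "0 < Gamma_quot a" using Gamma_quot_pos a by simp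
        ultimately show ?thesis by simp
      next
        case False
        hence b': "0 < Re b" using b by simp
        define c where "c = Gamma (Re a) * Gamma (Re b) / (norm (Gamma a) * norm (Gamma b))"
        have c0: "0 \<le> c" unfolding c_def using a b' by (simp add: less_imp_le)
        have "norm (R k n \<theta>) \<le> c * (1 / (1 + q) * q ^ Suc k * C_const \<alpha> \<beta>)"
          unfolding R_def c_def C using \<open>\<not> (\<theta> = 0 \<or> b = 0)\<close>
          by (intro expansion_remainder_bound a b' \<theta>' n refl q_def) auto
        also have "\<dots> \<le> c * F" by (intro mult_left_mono F1 c0)
        finally have "norm (R k n \<theta>) \<le> c * F" .
        moreover have "Gamma_quot a * Gamma_quot b = ereal c"
          using a b' by (auto simp: Gamma_quot_def c_def)
        ultimately show ?thesis by simp
      qed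
    qed
    thus ?thesis unfolding F_def u_def .
  qed
  show ?thesis
    unfolding P_poly_def a_b_def[symmetric] eqs
  proof (intro exI[of _ R] ballI allI impI conjI)
    fix \<theta> n k
    show "ereal (norm (R k n \<theta>)) \<le> Gamma_quot a * Gamma_quot b
      * ereal (\<bar>1 / (1 - 2 * \<theta> / (3 * pi * real n))\<bar> * \<bar>2 * \<theta> / (3 * pi * real n)\<bar> ^ (k + 1) * C_const \<alpha> \<beta>)"
      if "\<theta> \<in> {-pi..<pi}" "1 \<le> n" using bound that .
  qed (simp add: R_def expansion_term_def sum_distrib_right case_prod_unfold)
qed

end
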